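(* Let $\mathcal A$ be a right asphericity structure. For every functor $w:J\to I$ between small categories, the functors $$w_!:\mathsf{Hot}(J)\to\mathsf{Hot}(I),\qquad w^*:\mathsf{Hot}(I)\to\mathsf{Hot}(J)$$ form an adjoint pair, with $w_!$ left adjoint to $w^*$.
   Context: $\mathsf{Cat}$ is the category of small categories and functors. For a functor $u:A\to B$ and an object $b$ of $B$, $A/b$ denotes the category whose objects are pairs $(a,p:u(a)\to b)$, a morphism $(a,p)\to(a',p')$ being an arrow $f:a\to a'$ of $A$ with $p'\,u(f)=p$. A right asphericity structure is a class $\mathcal A$ of small categories such that: (As1) every small category with a final object is in $\mathcal A$; (As2) for every functor $u:A\to B$ between small categories, if $B$ is in $\mathcal A$ and $A/b$ is in $\mathcal A$ for every object $b$ of $B$, then $A$ is in $\mathcal A$. A functor $u:A\to B$ between small categories is aspheric if $A/b$ is in $\mathcal A$ for every object $b$ of $B$. For a small category $I$, $\underline{\mathsf{Hom}}(I,\mathsf{Cat})$ is the category of (covariant) functors $I\to\mathsf{Cat}$ and natural transformations; $\mathcal{A}sph(I)$ is the class of natural transformations which are componentwise aspheric functors; and $\mathsf{Hot}(I)=\mathcal{A}sph(I)^{-1}\,\underline{\mathsf{Hom}}(I,\mathsf{Cat})$ is the category obtained by formally inverting these arrows. For $w:J\to I$, the functor $F\mapsto F\circ w$ from $\underline{\mathsf{Hom}}(I,\mathsf{Cat})$ to $\underline{\mathsf{Hom}}(J,\mathsf{Cat})$ sends $\mathcal{A}sph(I)$ into $\mathcal{A}sph(J)$, and $w^*:\mathsf{Hot}(I)\to\mathsf{Hot}(J)$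 is the induced functor. For $F:J\to\mathsf{Cat}$, the category $\int F$ (Grothendieck construction) has objects the pairs $(j,a)$ with $j\in\mathrm{Ob}(J)$, $a\in\mathrm{Ob}(F(j))$, and morphisms $(j,a)\to(j',a')$ the pairs $(k,f)$ with $k:j\to j'$ in $J$ and $f:F(k)(a)\to a'$ in $F(j')$, composition being $(k',f')\circ(k,f)=(k'k,\,f'\cdot F(k')(f))$; the canonical functor $\int F\to J$ is $(j,a)\mapsto j$, $(k,f)\mapsto k$. The functor $w_!:\underline{\mathsf{Hom}}(J,\mathsf{Cat})\to\underline{\mathsf{Hom}}(I,\mathsf{Cat})$ is defined by $w_!(F)(i)=(\int F)/i$, where $(\int F)/i$ is formed with respect to the composite $\int F\to J\xrightarrow{w}I$ (with functoriality in $i$ by composition of arrows of $I$, and the evident functoriality in $F$). It sends $\mathcal{A}sph(J)$ into $\mathcal{A}sph(I)$, and $w_!:\mathsf{Hot}(J)\to\mathsf{Hot}(I)$ denotes the induced functor. *)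

theory Defs
  imports "HOL-Library.FuncSet" "HOL-Library.Nat_Bijection"
begin

section \<open>Categories, functors, natural transformations\<close>

text \<open>
  The structure maps of a category are relevant only on objects, arrows and composable pairs;
  \<open>Comp C g f\<close> is \<open>g\<close> after \<open>f\<close>.
\<close>

record ('o, 'a) cat =
  Obj :: "'o set"
  Arr :: "'a set"
  Dom :: "'a \<Rightarrow> 'o"
  Cod :: "'a \<Rightarrow> 'o"
  Ident :: "'o \<Rightarrow> 'a"
  Comp :: "'a \<Rightarrow> 'a \<Rightarrow> 'a"

definition hom :: "('o, 'a) cat \<Rightarrow> 'o \<Rightarrow> 'o \<Rightarrow> 'a set" where
  "hom C x y = {f \<in> Arr C. Dom C f = x \<and> Cod C f = y}"

definition category :: "('o, 'a) cat \<Rightarrow> bool" where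
  "category C \<longleftrightarrow>
     (\<forall>f \<in> Arr C. Dom C f \<in> Obj C \<and> Cod C f \<in> Obj C) \<and>
     (\<forall>x \<in> Obj C. Ident C x \<in> hom C x x) \<and>
     (\<forall>f \<in> Arr C. \<forall>g \<in> Arr C. Dom C g = Cod C f \<longrightarrow> Comp C g f \<in> hom C (Dom C f) (Cod C g)) \<and>
     (\<forall>f \<in> Arr C. Comp C f (Ident C (Dom C f)) = f \<and> Comp C (Ident C (Cod C f)) f = f) \<and>
     (\<forall>f \<in> Arr C. \<forall>g \<in> Arr C. \<forall>h \<in> Arr C. Dom C g = Cod C f \<longrightarrow> Dom C h = Cod C g \<longrightarrow>
        Comp C h (Comp C g f) = Comp C (Comp C h g) f)"

definition final_object :: "('o, 'a) cat \<Rightarrow> 'o \<Rightarrow> bool" where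
  "final_object C t \<longleftrightarrow> t \<in> Obj C \<and> (\<forall>x \<in> Obj C. \<exists>!f. f \<in> hom C x t)"

text \<open>
  Functors and natural transformations take the value \<open>undefined\<close> outside their domains, so
  that HOL equality is equality of functors and of natural transformations.
\<close>

record ('o, 'a, 'p, 'b) ftr =
  OM :: "'o \<Rightarrow> 'p"
  AM :: "'a \<Rightarrow> 'b"

definition is_functor :: "('o, 'a) cat \<Rightarrow> ('p, 'b) cat \<Rightarrow> ('o, 'a, 'p, 'b) ftr \<Rightarrow> bool" where
  "is_functor A B F \<longleftrightarrow>
     category A \<and> category B \<and>
     OM F \<in> Obj A \<rightarrow>\<^sub>E Obj B \<and>
     AM F \<in> Arr A \<rightarrow>\<^sub>E Arr B \<and>
     (\<forall>f \<in> Arr A. Dom B (AM F f) = OM F (Dom A f) \<and> Cod B (AM F f) = OM F (Cod A f)) \<and>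
     (\<forall>x \<in> Obj A. AM F (Ident A x) = Ident B (OM F x)) \<and>
     (\<forall>f \<in> Arr A. \<forall>g \<in> Arr A. Dom A g = Cod A f \<longrightarrow>
        AM F (Comp A g f) = Comp B (AM F g) (AM F f))"

definition id_ftr :: "('o, 'a) cat \<Rightarrow> ('o, 'a, 'o, 'a) ftr" where
  "id_ftr A = \<lparr>OM = \<lambda>x\<in>Obj A. x, AM = \<lambda>f\<in>Arr A. f\<rparr>"

definition comp_ftr ::
  "('o, 'a) cat \<Rightarrow> ('p, 'b, 'q, 'c) ftr \<Rightarrow> ('o, 'a, 'p, 'b) ftr \<Rightarrow> ('o, 'a, 'q, 'c) ftr" where
  "comp_ftr A G F = \<lparr>OM = \<lambda>x\<in>Obj A. OM G (OM F x), AM = \<lambda>f\<in>Arr A. AM G (AM F f)\<rparr>"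

definition nat_trans ::
  "('o, 'a) cat \<Rightarrow> ('p, 'b) cat \<Rightarrow> ('o, 'a, 'p, 'b) ftr \<Rightarrow> ('o, 'a, 'p, 'b) ftr \<Rightarrow> ('o \<Rightarrow> 'b) \<Rightarrow> bool"
where
  "nat_trans A B F G \<tau> \<longleftrightarrow>
     is_functor A B F \<and> is_functor A B G \<and> \<tau> \<in> extensional (Obj A) \<and>
     (\<forall>x \<in> Obj A. \<tau> x \<in> hom B (OM F x) (OM G x)) \<and>
     (\<forall>f \<in> Arr A. Comp B (\<tau> (Cod A f)) (AM F f) = Comp B (AM G f) (\<tau> (Dom A f)))"

text \<open>In categories of functors, of functors between categories, etc., an arrow is stored
  together with its domain and codomain.\<close>

definition src :: "'x \<times> 'm \<times> 'x \<Rightarrow> 'x" where "src t = fst t"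
definition und :: "'x \<times> 'm \<times> 'x \<Rightarrow> 'm" where "und t = fst (snd t)"
definition trg :: "'x \<times> 'm \<times> 'x \<Rightarrow> 'x" where "trg t = snd (snd t)"

definition functor_cat :: "('o, 'a) cat \<Rightarrow> ('p, 'b) cat \<Rightarrow>
  (('o, 'a, 'p, 'b) ftr, ('o, 'a, 'p, 'b) ftr \<times> ('o \<Rightarrow> 'b) \<times> ('o, 'a, 'p, 'b) ftr) cat" where
  "functor_cat A B =
     \<lparr>Obj = {F. is_functor A B F},
      Arr = {(F, \<tau>, G) | F \<tau> G. nat_trans A B F G \<tau>},
      Dom = src, Cod = trg,
      Ident = (\<lambda>F. (F, \<lambda>x\<in>Obj A. Ident B (OM F x), F)),
      Comp = (\<lambda>t s. (src s, \<lambda>x\<in>Obj A. Comp B (und t x) (und s x), trg t))\<rparr>"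

definition adjoint_pair :: "('o, 'a) cat \<Rightarrow> ('p, 'b) cat \<Rightarrow>
  ('o, 'a, 'p, 'b) ftr \<Rightarrow> ('p, 'b, 'o, 'a) ftr \<Rightarrow> bool" where \<comment> \<open>\<open>L\<close> is left adjoint to \<open>R\<close>\<close>
  "adjoint_pair C D L R \<longleftrightarrow>
     is_functor C D L \<and> is_functor D C R \<and>
     (\<exists>\<eta> \<epsilon>. nat_trans C C (id_ftr C) (comp_ftr C R L) \<eta> \<and>
            nat_trans D D (comp_ftr D L R) (id_ftr D) \<epsilon> \<and>
            (\<forall>x \<in> Obj C. Comp D (\<epsilon> (OM L x)) (AM L (\<eta> x)) = Ident D (OM L x)) \<and>
            (\<forall>y \<in> Obj D. Comp C (AM R (\<epsilon> y)) (\<eta> (OM R y)) = Ident C (OM R y)))"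


section \<open>Localization\<close>

text \<open>
  The category obtained by formally inverting a class \<open>W\<close> of arrows: its arrows are the zigzags of
  arrows, those pointing backwards being in \<open>W\<close>, modulo the congruence generated by the
  composition of the given category and by the requirement that \<open>Bwd s\<close> be inverse to \<open>Fwd s\<close>.
  Zigzags are written in diagrammatic order: the head of the list is the arrow applied first.
\<close>

datatype 'a step = Fwd 'a | Bwd 'a

inductive zigzag :: "('o, 'a) cat \<Rightarrow> 'a set \<Rightarrow> 'o \<Rightarrow> 'a step list \<Rightarrow> 'o \<Rightarrow> bool"
  for C W where
  zz_nil: "x \<in> Obj C \<Longrightarrow> zigzag C W x [] x"
| zz_fwd: "f \<in> Arr C \<Longrightarrow> zigzag C W (Cod C f) l y \<Longrightarrow> zigzag C W (Dom C f) (Fwd f # l) y"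
| zz_bwd: "s \<in> W \<Longrightarrow> s \<in> Arr C \<Longrightarrow> zigzag C W (Dom C s) l y \<Longrightarrow>
     zigzag C W (Cod C s) (Bwd s # l) y"

inductive zz_eq :: "('o, 'a) cat \<Rightarrow> 'a set \<Rightarrow> 'o \<Rightarrow> 'o \<Rightarrow> 'a step list \<Rightarrow> 'a step list \<Rightarrow> bool"
  for C W where
  zz_refl: "zigzag C W x l y \<Longrightarrow> zz_eq C W x y l l"
| zz_sym: "zz_eq C W x y l m \<Longrightarrow> zz_eq C W x y m l"
| zz_trans: "zz_eq C W x y l m \<Longrightarrow> zz_eq C W x y m n \<Longrightarrow> zz_eq C W x y l n"
| zz_append: "zz_eq C W x y l l' \<Longrightarrow> zz_eq C W y z m m' \<Longrightarrow> zz_eq C W x z (l @ m) (l' @ m')"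
| zz_ident: "x \<in> Obj C \<Longrightarrow> zz_eq C W x x [Fwd (Ident C x)] []"
| zz_comp: "f \<in> Arr C \<Longrightarrow> g \<in> Arr C \<Longrightarrow> Dom C g = Cod C f \<Longrightarrow>
     zz_eq C W (Dom C f) (Cod C g) [Fwd f, Fwd g] [Fwd (Comp C g f)]"
| zz_inv_right: "s \<in> W \<Longrightarrow> s \<in> Arr C \<Longrightarrow> zz_eq C W (Dom C s) (Dom C s) [Fwd s, Bwd s] []"
| zz_inv_left: "s \<in> W \<Longrightarrow> s \<in> Arr C \<Longrightarrow> zz_eq C W (Cod C s) (Cod C s) [Bwd s, Fwd s] []"

definition zz_class ::
  "('o, 'a) cat \<Rightarrow> 'a set \<Rightarrow> 'o \<Rightarrow> 'o \<Rightarrow> 'a step list \<Rightarrow> 'a step list set" where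
  "zz_class C W x y l = {m. zz_eq C W x y l m}"

definition localization :: "('o, 'a) cat \<Rightarrow> 'a set \<Rightarrow> ('o, 'o \<times> 'a step list set \<times> 'o) cat" where
  "localization C W =
     \<lparr>Obj = Obj C,
      Arr = {(x, zz_class C W x y l, y) | x l y. zigzag C W x l y},
      Dom = src, Cod = trg,
      Ident = (\<lambda>x. (x, zz_class C W x x [], x)),
      Comp = (\<lambda>t s. (src s,
        \<Union>l\<in>und s. \<Union>m\<in>und t. zz_class C W (src s) (trg t) (l @ m), trg t))\<rparr>"

text \<open>
  The functor induced on localizations by a functor \<open>H\<close> from \<open>C\<close> to \<open>D\<close> with \<open>AM H ` W \<subseteq> V\<close>.
\<close>

definition loc_ftr :: "('o, 'a) cat \<Rightarrow> 'a set \<Rightarrow> ('p, 'b) cat \<Rightarrow> 'b set \<Rightarrow> ('o, 'a, 'p, 'b) ftr \<Rightarrow>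
  ('o, 'o \<times> 'a step list set \<times> 'o, 'p, 'p \<times> 'b step list set \<times> 'p) ftr" where
  "loc_ftr C W D V H =
     \<lparr>OM = (\<lambda>x\<in>Obj C. OM H x),
      AM = (\<lambda>t\<in>Arr (localization C W).
        (OM H (src t),
         \<Union>l\<in>und t. zz_class D V (OM H (src t)) (OM H (trg t)) (map (map_step (AM H)) l),
         OM H (trg t)))\<rparr>"


section \<open>Small categories\<close>

text \<open>
  Smallness is relative to a universe, that is, a type with ordered pairs and a notion of small set.
  The set-theoretic reading is that the type consists of the elements of a Grothendieck universe
  \<open>U\<close> with Kuratowski pairs, the small sets being those that are elements of \<open>U\<close>; only the
  closure properties listed here are required.
\<close>

class universe =
  fixes pair :: "'a \<Rightarrow> 'a \<Rightarrow> 'a"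
    and pi1 :: "'a \<Rightarrow> 'a"
    and pi2 :: "'a \<Rightarrow> 'a"
    and small :: "'a set \<Rightarrow> bool"
  assumes pi1_pair [simp]: "pi1 (pair x y) = x"
    and pi2_pair [simp]: "pi2 (pair x y) = y"
    and universe_infinite: "infinite (UNIV :: 'a set)"
    and small_finite: "finite X \<Longrightarrow> small X"
    and small_subset: "small X \<Longrightarrow> Y \<subseteq> X \<Longrightarrow> small Y"
    and small_UN: "small X \<Longrightarrow> (\<And>x. x \<in> X \<Longrightarrow> small (K x)) \<Longrightarrow> small (\<Union>x\<in>X. K x)"

text \<open>A model of the axioms: the sets of natural numbers, all of them small.\<close>

instantiation nat :: universe
begin

definition "pair x y = prod_encode (x, y)" for x y :: nat
definition "pi1 x = fst (prod_decode x)" for x :: nat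
definition "pi2 x = snd (prod_decode x)" for x :: nat
definition "small X = True" for X :: "nat set"

instance
  by standard (simp_all add: pair_nat_def pi1_nat_def pi2_nat_def small_nat_def)

end

type_synonym 'u scat = "('u, 'u) cat"
type_synonym 'u sftr = "('u, 'u, 'u, 'u) ftr"
type_synonym 'u sarr = "'u scat \<times> 'u sftr \<times> 'u scat"
type_synonym 'u diag = "('u, 'u, 'u scat, 'u sarr) ftr"
type_synonym 'u darr = "'u diag \<times> ('u \<Rightarrow> 'u sarr) \<times> 'u diag"

definition small_category :: "'u::universe scat \<Rightarrow> bool" where
  "small_category A \<longleftrightarrow> category A \<and> small (Obj A) \<and> small (Arr A)"

definition Cat :: "('u::universe scat, 'u sarr) cat" where
  "Cat =
     \<lparr>Obj = {A. small_category A},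
      Arr = {(A, u, B) | A u B. small_category A \<and> small_category B \<and> is_functor A B u},
      Dom = src, Cod = trg,
      Ident = (\<lambda>A. (A, id_ftr A, A)),
      Comp = (\<lambda>t s. (src s, comp_ftr (src s) (und t) (und s), trg t))\<rparr>"

text \<open>
  In the constructions below an arrow \<open>f\<close> from \<open>x\<close> to \<open>y\<close> is coded as the triple \<open>mk_arr x f y\<close>.
\<close>

definition mk_arr :: "'u::universe \<Rightarrow> 'u \<Rightarrow> 'u \<Rightarrow> 'u" where "mk_arr x f y = pair x (pair f y)"
definition asrc :: "'u::universe \<Rightarrow> 'u" where "asrc t = pi1 t"
definition aund :: "'u::universe \<Rightarrow> 'u" where "aund t = pi1 (pi2 t)"
definition atrg :: "'u::universe \<Rightarrow> 'u" where "atrg t = pi2 (pi2 t)"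

definition slice :: "'u::universe scat \<Rightarrow> 'u scat \<Rightarrow> 'u sftr \<Rightarrow> 'u \<Rightarrow> 'u scat" where
  \<comment> \<open>\<open>A/b\<close>, for a functor \<open>u\<close> from \<open>A\<close> to \<open>B\<close>\<close>
  "slice A B u b =
     \<lparr>Obj = {pair a p | a p. a \<in> Obj A \<and> p \<in> hom B (OM u a) b},
      Arr = {mk_arr (pair a p) f (pair a' p') | a p f a' p'.
               a \<in> Obj A \<and> p \<in> hom B (OM u a) b \<and> a' \<in> Obj A \<and> p' \<in> hom B (OM u a') b \<and>
               f \<in> hom A a a' \<and> Comp B p' (AM u f) = p},
      Dom = asrc, Cod = atrg,
      Ident = (\<lambda>x. mk_arr x (Ident A (pi1 x)) x),
      Comp = (\<lambda>t s. mk_arr (asrc s) (Comp A (aund t) (aund s)) (atrg t))\<rparr>"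


section \<open>Asphericity structures\<close>

definition right_asphericity_structure :: "'u::universe scat set \<Rightarrow> bool" where
  "right_asphericity_structure \<A> \<longleftrightarrow>
     (\<forall>A \<in> \<A>. small_category A) \<and>
     (\<forall>A. small_category A \<and> (\<exists>t. final_object A t) \<longrightarrow> A \<in> \<A>) \<and>
     (\<forall>A B u. small_category A \<and> small_category B \<and> is_functor A B u \<and>
        B \<in> \<A> \<and> (\<forall>b \<in> Obj B. slice A B u b \<in> \<A>) \<longrightarrow> A \<in> \<A>)"

definition aspheric :: "'u::universe scat set \<Rightarrow> 'u scat \<Rightarrow> 'u scat \<Rightarrow> 'u sftr \<Rightarrow> bool" where
  "aspheric \<A> A B u \<longleftrightarrow>
     small_category A \<and> small_category B \<and> is_functor A B u \<and> (\<forall>b \<in> Obj B. slice A B u b \<in> \<A>)"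

definition Asph :: "'u::universe scat set \<Rightarrow> 'u scat \<Rightarrow> 'u darr set" where
  "Asph \<A> I = {t \<in> Arr (functor_cat I Cat).
     \<forall>i \<in> Obj I. aspheric \<A> (src (und t i)) (trg (und t i)) (und (und t i))}"

definition Hot :: "'u::universe scat set \<Rightarrow> 'u scat \<Rightarrow>
  ('u diag, 'u diag \<times> 'u darr step list set \<times> 'u diag) cat" where
  "Hot \<A> I = localization (functor_cat I Cat) (Asph \<A> I)"


section \<open>Inverse image\<close>

definition pullback :: "'u::universe scat \<Rightarrow> 'u scat \<Rightarrow> 'u sftr \<Rightarrow> ('u diag, 'u darr, 'u diag, 'u darr) ftr"
where
  "pullback J I w =
     \<lparr>OM = (\<lambda>F\<in>Obj (functor_cat I Cat). comp_ftr J F w),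
      AM = (\<lambda>t\<in>Arr (functor_cat I Cat).
        (comp_ftr J (src t) w, \<lambda>j\<in>Obj J. und t (OM w j), comp_ftr J (trg t) w))\<rparr>"


section \<open>The Grothendieck construction and direct image\<close>

definition groth :: "'u::universe scat \<Rightarrow> 'u diag \<Rightarrow> 'u scat" where
  "groth J F =
     \<lparr>Obj = {pair j a | j a. j \<in> Obj J \<and> a \<in> Obj (OM F j)},
      Arr = {mk_arr (pair j a) (pair k f) (pair j' a') | j a k f j' a'.
               j \<in> Obj J \<and> a \<in> Obj (OM F j) \<and> j' \<in> Obj J \<and> a' \<in> Obj (OM F j') \<and>
               k \<in> hom J j j' \<and> f \<in> hom (OM F j') (OM (und (AM F k)) a) a'},
      Dom = asrc, Cod = atrg,
      Ident = (\<lambda>x. mk_arr x (pair (Ident J (pi1 x)) (Ident (OM F (pi1 x)) (pi2 x))) x),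
      Comp = (\<lambda>t s.
        let k = pi1 (aund s); f = pi2 (aund s); k' = pi1 (aund t); f' = pi2 (aund t)
        in mk_arr (asrc s)
             (pair (Comp J k' k) (Comp (OM F (pi1 (atrg t))) f' (AM (und (AM F k')) f)))
             (atrg t))\<rparr>"

definition groth_proj :: "'u::universe scat \<Rightarrow> 'u diag \<Rightarrow> 'u sftr" where
  "groth_proj J F =
     \<lparr>OM = (\<lambda>x\<in>Obj (groth J F). pi1 x), AM = (\<lambda>t\<in>Arr (groth J F). pi1 (aund t))\<rparr>"

definition groth_map :: "'u::universe scat \<Rightarrow> 'u diag \<Rightarrow> 'u diag \<Rightarrow> ('u \<Rightarrow> 'u sarr) \<Rightarrow> 'u sftr" where
  \<comment> \<open>the functor \<open>(j, a) \<mapsto> (j, \<tau> j a)\<close>, \<open>(k, f) \<mapsto> (k, \<tau> j' f)\<close> for \<open>k\<close> with codomain \<open>j'\<close>\<close>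
  "groth_map J F G \<tau> =
     (let h = (\<lambda>x. pair (pi1 x) (OM (und (\<tau> (pi1 x))) (pi2 x))) in
     \<lparr>OM = (\<lambda>x\<in>Obj (groth J F). h x),
      AM = (\<lambda>t\<in>Arr (groth J F).
        mk_arr (h (asrc t))
          (pair (pi1 (aund t)) (AM (und (\<tau> (pi1 (atrg t)))) (pi2 (aund t))))
          (h (atrg t)))\<rparr>)"

definition shriek_obj :: "'u::universe scat \<Rightarrow> 'u scat \<Rightarrow> 'u sftr \<Rightarrow> 'u diag \<Rightarrow> 'u \<Rightarrow> 'u scat" where
  "shriek_obj J I w F i = slice (groth J F) I (comp_ftr (groth J F) w (groth_proj J F)) i"

text \<open>
  The functor between \<open>(\<integral>F)/i\<close> and \<open>(\<integral>G)/i'\<close> given by \<open>(x, p) \<mapsto> (h x, q p)\<close> on objects and by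
  \<open>h\<close> on arrows.
\<close>

definition slice_map :: "'u::universe scat \<Rightarrow> 'u sftr \<Rightarrow> ('u \<Rightarrow> 'u) \<Rightarrow> 'u sftr" where
  "slice_map S h q =
     (let g = (\<lambda>z. pair (OM h (pi1 z)) (q (pi2 z))) in
     \<lparr>OM = (\<lambda>z\<in>Obj S. g z),
      AM = (\<lambda>t\<in>Arr S. mk_arr (g (asrc t)) (AM h (aund t)) (g (atrg t)))\<rparr>)"

definition shriek_diag :: "'u::universe scat \<Rightarrow> 'u scat \<Rightarrow> 'u sftr \<Rightarrow> 'u diag \<Rightarrow> 'u diag" where
  "shriek_diag J I w F =
     \<lparr>OM = (\<lambda>i\<in>Obj I. shriek_obj J I w F i),
      AM = (\<lambda>r\<in>Arr I.
        (shriek_obj J I w F (Dom I r),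
         slice_map (shriek_obj J I w F (Dom I r)) (id_ftr (groth J F)) (\<lambda>p. Comp I r p),
         shriek_obj J I w F (Cod I r)))\<rparr>"

definition shriek :: "'u::universe scat \<Rightarrow> 'u scat \<Rightarrow> 'u sftr \<Rightarrow> ('u diag, 'u darr, 'u diag, 'u darr) ftr"
where
  "shriek J I w =
     \<lparr>OM = (\<lambda>F\<in>Obj (functor_cat J Cat). shriek_diag J I w F),
      AM = (\<lambda>t\<in>Arr (functor_cat J Cat).
        (shriek_diag J I w (src t),
         \<lambda>i\<in>Obj I.
           (shriek_obj J I w (src t) i,
            slice_map (shriek_obj J I w (src t) i) (groth_map J (src t) (trg t) (und t)) (\<lambda>p. p),
            shriek_obj J I w (trg t) i),
         shriek_diag J I w (trg t)))\<rparr>"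

definition hot_pullback :: "'u::universe scat set \<Rightarrow> 'u scat \<Rightarrow> 'u scat \<Rightarrow> 'u sftr \<Rightarrow>
  ('u diag, 'u diag \<times> 'u darr step list set \<times> 'u diag,
   'u diag, 'u diag \<times> 'u darr step list set \<times> 'u diag) ftr" where
  "hot_pullback \<A> J I w =
     loc_ftr (functor_cat I Cat) (Asph \<A> I) (functor_cat J Cat) (Asph \<A> J) (pullback J I w)"

definition hot_shriek :: "'u::universe scat set \<Rightarrow> 'u scat \<Rightarrow> 'u scat \<Rightarrow> 'u sftr \<Rightarrow>
  ('u diag, 'u diag \<times> 'u darr step list set \<times> 'u diag,
   'u diag, 'u diag \<times> 'u darr step list set \<times> 'u diag) ftr" where
  "hot_shriek \<A> J I w =
     loc_ftr (functor_cat J Cat) (Asph \<A> J) (functor_cat I Cat) (Asph \<A> I) (shriek J I w)"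

end

theory Submission
  imports Defs
begin

text \<open>
  The counit \<open>w\<^sub>! w\<^sup>* G \<rightarrow> G\<close>, \<open>((j, a), p) \<mapsto> G(p)(a)\<close>, exists before localization. The unit
  \<open>a \<mapsto> ((j, a), id)\<close> from \<open>F(j)\<close> to \<open>(\<integral>F)/w(j)\<close> is only lax natural in \<open>j\<close>, so it is replaced by
  the fraction \<open>F \<leftarrow> id\<^sub>! F \<rightarrow> w\<^sup>* w\<^sub>! F\<close>. Its left leg is the counit of \<open>id\<^sub>J\<close>, whose components
  \<open>(\<integral>F)/j \<rightarrow> F(j)\<close> have right adjoints and are therefore aspheric: the slices occurring in the
  definition have final objects. One triangle identity holds strictly. The other holds up to a
  natural transformation between componentwise functors, and arrows of diagrams linked by such a
  2-cell agree in \<open>Hot\<close>: in the diagram of arrows of the target, domain and codomain have a common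
  section and the codomain is aspheric.
\<close>

section \<open>Categories, functors and natural transformations\<close>

text \<open>(As1) favours final objects over initial ones, and this decides every choice of
  direction. A functor is proved aspheric from scratch by exhibiting a right adjoint; a left adjoint
  would not do. So in the category of arrows it is the codomain projection that is inverted, and the
  replacement of F(j) is the slice (\<integral>F)/j, which maps to F(j) by a left adjoint. This
  slice also removes the laxness: an object ((j', a), p) remembers an arrow p into j, and a
  transition along k composes with p instead of transporting a, so nothing has to commute with F(k).

  The direct image of a componentwise aspheric morphism is the one place where slices need not have
  final objects. Such a slice is compared with a slice of one given component through a functor with
  a right adjoint, and (As2) carries membership back.

  The failing triangle compares two ways of using p: composing it into the structure arrow in I, or
  transporting a along it. In \<integral>F the resulting objects differ, but are joined by the
  canonical arrow (p, id); this is the origin of the 2-cell.\<close>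

lemma src_simp [simp]: "src (x, m, y) = x" by (simp add: src_def)
lemma und_simp [simp]: "und (x, m, y) = m" by (simp add: und_def)
lemma trg_simp [simp]: "trg (x, m, y) = y" by (simp add: trg_def)

lemma src_und_trg: "(src t, und t, trg t) = t" by (simp add: src_def und_def trg_def)

lemma category_simps [simp]:
  assumes "category C"
  shows "f \<in> Arr C \<Longrightarrow> Dom C f \<in> Obj C"
    and "f \<in> Arr C \<Longrightarrow> Cod C f \<in> Obj C"
    and "x \<in> Obj C \<Longrightarrow> Ident C x \<in> Arr C"
    and "x \<in> Obj C \<Longrightarrow> Dom C (Ident C x) = x"
    and "x \<in> Obj C \<Longrightarrow> Cod C (Ident C x) = x"
    and "f \<in> Arr C \<Longrightarrow> g \<in> Arr C \<Longrightarrow> Dom C g = Cod C f \<Longrightarrow> Comp C g f \<in> Arr C"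
    and "f \<in> Arr C \<Longrightarrow> g \<in> Arr C \<Longrightarrow> Dom C g = Cod C f \<Longrightarrow> Dom C (Comp C g f) = Dom C f"
    and "f \<in> Arr C \<Longrightarrow> g \<in> Arr C \<Longrightarrow> Dom C g = Cod C f \<Longrightarrow> Cod C (Comp C g f) = Cod C g"
    and "f \<in> Arr C \<Longrightarrow> Dom C f = x \<Longrightarrow> Comp C f (Ident C x) = f"
    and "f \<in> Arr C \<Longrightarrow> Cod C f = x \<Longrightarrow> Comp C (Ident C x) f = f"
    and "f \<in> Arr C \<Longrightarrow> g \<in> Arr C \<Longrightarrow> h \<in> Arr C \<Longrightarrow> Dom C g = Cod C f \<Longrightarrow> Dom C h = Cod C g \<Longrightarrow>
      Comp C (Comp C h g) f = Comp C h (Comp C g f)"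
  using assms by (auto simp: category_def hom_def)

lemma categoryI:
  assumes "\<And>f. f \<in> Arr C \<Longrightarrow> Dom C f \<in> Obj C"
    and "\<And>f. f \<in> Arr C \<Longrightarrow> Cod C f \<in> Obj C"
    and "\<And>x. x \<in> Obj C \<Longrightarrow> Ident C x \<in> Arr C \<and> Dom C (Ident C x) = x \<and> Cod C (Ident C x) = x"
    and "\<And>f g. f \<in> Arr C \<Longrightarrow> g \<in> Arr C \<Longrightarrow> Dom C g = Cod C f \<Longrightarrow>
      Comp C g f \<in> Arr C \<and> Dom C (Comp C g f) = Dom C f \<and> Cod C (Comp C g f) = Cod C g"
    and "\<And>f. f \<in> Arr C \<Longrightarrow> Comp C f (Ident C (Dom C f)) = f"
    and "\<And>f. f \<in> Arr C \<Longrightarrow> Comp C (Ident C (Cod C f)) f = f"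
    and "\<And>f g h. f \<in> Arr C \<Longrightarrow> g \<in> Arr C \<Longrightarrow> h \<in> Arr C \<Longrightarrow> Dom C g = Cod C f \<Longrightarrow>
      Dom C h = Cod C g \<Longrightarrow> Comp C h (Comp C g f) = Comp C (Comp C h g) f"
  shows "category C"
  using assms unfolding category_def hom_def by simp

lemma functor_category:
  assumes "is_functor A B F"
  shows "category A" "category B"
  using assms by (auto simp: is_functor_def)

lemma functor_simps:
  assumes "is_functor A B F"
  shows "x \<in> Obj A \<Longrightarrow> OM F x \<in> Obj B"
    and "f \<in> Arr A \<Longrightarrow> AM F f \<in> Arr B"
    and "f \<in> Arr A \<Longrightarrow> Dom B (AM F f) = OM F (Dom A f)"
    and "f \<in> Arr A \<Longrightarrow> Cod B (AM F f) = OM F (Cod A f)"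
    and "x \<in> Obj A \<Longrightarrow> AM F (Ident A x) = Ident B (OM F x)"
    and "f \<in> Arr A \<Longrightarrow> g \<in> Arr A \<Longrightarrow> Dom A g = Cod A f \<Longrightarrow>
      AM F (Comp A g f) = Comp B (AM F g) (AM F f)"
  using assms by (auto simp: is_functor_def)

lemma functor_ext:
  assumes "is_functor A B F"
  shows "OM F \<in> extensional (Obj A)" "AM F \<in> extensional (Arr A)"
  using assms by (auto simp: is_functor_def PiE_def)

lemma functorI:
  assumes "category A" "category B"
    and "OM F \<in> extensional (Obj A)" "AM F \<in> extensional (Arr A)"
    and "\<And>x. x \<in> Obj A \<Longrightarrow> OM F x \<in> Obj B"
    and "\<And>f. f \<in> Arr A \<Longrightarrow>
      AM F f \<in> Arr B \<and> Dom B (AM F f) = OM F (Dom A f) \<and> Cod B (AM F f) = OM F (Cod A f)"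
    and "\<And>x. x \<in> Obj A \<Longrightarrow> AM F (Ident A x) = Ident B (OM F x)"
    and "\<And>f g. f \<in> Arr A \<Longrightarrow> g \<in> Arr A \<Longrightarrow> Dom A g = Cod A f \<Longrightarrow>
      AM F (Comp A g f) = Comp B (AM F g) (AM F f)"
  shows "is_functor A B F"
  using assms by (auto simp: is_functor_def PiE_def)

lemma functor_eqI:
  fixes F G :: "('o, 'a, 'p, 'b) ftr"
  assumes "OM F \<in> extensional X" "OM G \<in> extensional X"
    and "AM F \<in> extensional Y" "AM G \<in> extensional Y"
    and "\<And>x. x \<in> X \<Longrightarrow> OM F x = OM G x" "\<And>f. f \<in> Y \<Longrightarrow> AM F f = AM G f"
  shows "F = G"
  using extensionalityI[OF assms(1,2)] extensionalityI[OF assms(3,4)] assms(5,6)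
  by (cases F, cases G) auto

lemma id_ftr_simps [simp]:
  "x \<in> Obj A \<Longrightarrow> OM (id_ftr A) x = x"
  "f \<in> Arr A \<Longrightarrow> AM (id_ftr A) f = f"
  by (simp_all add: id_ftr_def)

lemma id_ftr_ext [simp]:
  "OM (id_ftr A) \<in> extensional (Obj A)"
  "AM (id_ftr A) \<in> extensional (Arr A)"
  by (simp_all add: id_ftr_def)

lemma comp_ftr_simps [simp]:
  "x \<in> Obj A \<Longrightarrow> OM (comp_ftr A G F) x = OM G (OM F x)"
  "f \<in> Arr A \<Longrightarrow> AM (comp_ftr A G F) f = AM G (AM F f)"
  by (simp_all add: comp_ftr_def)

lemma comp_ftr_ext [simp]:
  "OM (comp_ftr A G F) \<in> extensional (Obj A)"
  "AM (comp_ftr A G F) \<in> extensional (Arr A)"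
  by (simp_all add: comp_ftr_def)

lemma functor_id: "category A \<Longrightarrow> is_functor A A (id_ftr A)"
  by (rule functorI) auto

lemma functor_comp:
  assumes "is_functor A B F" "is_functor B C G"
  shows "is_functor A C (comp_ftr A G F)"
  by (rule functorI)
    (use assms in \<open>simp_all add: functor_category[OF assms(1)] functor_category[OF assms(2)]
      functor_simps[OF assms(1)] functor_simps[OF assms(2)]\<close>)

lemma comp_ftr_eqI:
  assumes "\<And>x. x \<in> Obj A \<Longrightarrow> OM G (OM F x) = OM G' (OM F' x)"
    and "\<And>f. f \<in> Arr A \<Longrightarrow> AM G (AM F f) = AM G' (AM F' f)"
  shows "comp_ftr A G F = comp_ftr A G' F'"
  using assms by (auto simp: comp_ftr_def cong: restrict_cong)

lemma comp_ftr_id: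
  assumes "is_functor A B F"
  shows "comp_ftr A F (id_ftr A) = F" "comp_ftr A (id_ftr B) F = F"
  by (rule functor_eqI[of _ "Obj A" _ "Arr A"];
      simp add: functor_ext[OF assms] functor_simps[OF assms])+

lemma comp_ftr_assoc:
  assumes "is_functor A B F"
  shows "comp_ftr A H (comp_ftr A G F) = comp_ftr A (comp_ftr B H G) F"
  by (rule comp_ftr_eqI) (simp_all add: functor_simps[OF assms])

lemma nat_transI:
  assumes "is_functor A B F" "is_functor A B G" "\<tau> \<in> extensional (Obj A)"
    and "\<And>x. x \<in> Obj A \<Longrightarrow> \<tau> x \<in> Arr B \<and> Dom B (\<tau> x) = OM F x \<and> Cod B (\<tau> x) = OM G x"
    and "\<And>f. f \<in> Arr A \<Longrightarrow> Comp B (\<tau> (Cod A f)) (AM F f) = Comp B (AM G f) (\<tau> (Dom A f))"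
  shows "nat_trans A B F G \<tau>"
  using assms by (simp add: nat_trans_def hom_def)

lemma nat_trans_simps:
  assumes "nat_trans A B F G \<tau>"
  shows "x \<in> Obj A \<Longrightarrow> \<tau> x \<in> Arr B"
    and "x \<in> Obj A \<Longrightarrow> Dom B (\<tau> x) = OM F x"
    and "x \<in> Obj A \<Longrightarrow> Cod B (\<tau> x) = OM G x"
    and "f \<in> Arr A \<Longrightarrow> Comp B (\<tau> (Cod A f)) (AM F f) = Comp B (AM G f) (\<tau> (Dom A f))"
  using assms by (auto simp: nat_trans_def hom_def)

section \<open>Functor categories\<close>

lemma functor_cat_simps [simp]:
  "Obj (functor_cat A B) = {F. is_functor A B F}"
  "Dom (functor_cat A B) = src"
  "Cod (functor_cat A B) = trg"
  "Ident (functor_cat A B) F = (F, \<lambda>x\<in>Obj A. Ident B (OM F x), F)"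
  "Comp (functor_cat A B) t s = (src s, \<lambda>x\<in>Obj A. Comp B (und t x) (und s x), trg t)"
  by (simp_all add: functor_cat_def)

lemma functor_cat_Arr:
  "t \<in> Arr (functor_cat A B) \<longleftrightarrow> nat_trans A B (src t) (trg t) (und t)"
  by (cases t) (auto simp: functor_cat_def)

lemma category_functor_cat: "category (functor_cat A B)"
proof (rule categoryI)
  fix t assume t: "t \<in> Arr (functor_cat A B)"
  then have n: "nat_trans A B (src t) (trg t) (und t)" by (simp add: functor_cat_Arr)
  then have F: "is_functor A B (src t)" "is_functor A B (trg t)" "und t \<in> extensional (Obj A)"
    by (auto simp: nat_trans_def)
  note B = functor_category[OF F(1)]
  show "Dom (functor_cat A B) t \<in> Obj (functor_cat A B)"
    "Cod (functor_cat A B) t \<in> Obj (functor_cat A B)" using F by simp_all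
  have u: "(\<lambda>x\<in>Obj A. und t x) = und t" by (rule extensional_restrict[OF F(3)])
  show "Comp (functor_cat A B) t (Ident (functor_cat A B) (Dom (functor_cat A B) t)) = t"
    "Comp (functor_cat A B) (Ident (functor_cat A B) (Cod (functor_cat A B) t)) t = t"
    using u src_und_trg[of t] by (simp_all add: nat_trans_simps[OF n] B functor_simps[OF F(1)]
      functor_simps[OF F(2)] cong: restrict_cong)
next
  fix F assume "F \<in> Obj (functor_cat A B)"
  then have F: "is_functor A B F" by simp
  note B = functor_category[OF F(1)]
  have "nat_trans A B F F (\<lambda>x\<in>Obj A. Ident B (OM F x))"
    by (rule nat_transI) (simp_all add: F functor_simps[OF F] B)
  then show "Ident (functor_cat A B) F \<in> Arr (functor_cat A B) \<and>
    Dom (functor_cat A B) (Ident (functor_cat A B) F) = F \<and>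
    Cod (functor_cat A B) (Ident (functor_cat A B) F) = F"
    by (simp add: functor_cat_Arr)
next
  fix s t assume "s \<in> Arr (functor_cat A B)" "t \<in> Arr (functor_cat A B)"
    and e: "Dom (functor_cat A B) t = Cod (functor_cat A B) s"
  then have n: "nat_trans A B (src s) (trg s) (und s)" "nat_trans A B (trg s) (trg t) (und t)"
    by (auto simp add: functor_cat_Arr)
  then have F: "is_functor A B (src s)" "is_functor A B (trg s)" "is_functor A B (trg t)"
    by (auto simp: nat_trans_def)
  note B = functor_category[OF F(1)]
  note r = nat_trans_simps[OF n(1)] nat_trans_simps[OF n(2)] functor_simps[OF F(1)]
    functor_simps[OF F(2)] functor_simps[OF F(3)]
  have "nat_trans A B (src s) (trg t) (\<lambda>x\<in>Obj A. Comp B (und t x) (und s x))"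
  proof (rule nat_transI)
    fix f assume f: "f \<in> Arr A"
    \<comment> \<open>Pasting of two naturality squares. The square of \<open>t\<close> is withheld
      from the simplifier here, since it would rewrite the right-hand side alone.\<close>
    have "Comp B (und t (Cod A f)) (Comp B (AM (trg s) f) (und s (Dom A f))) =
      Comp B (Comp B (und t (Cod A f)) (AM (trg s) f)) (und s (Dom A f))"
      using f B by (simp add: r del: nat_trans_simps(4)[OF n(2)])
    also have "\<dots> = Comp B (AM (trg t) f) (Comp B (und t (Dom A f)) (und s (Dom A f)))"
      using f B by (simp add: r)
    finally show "Comp B ((\<lambda>x\<in>Obj A. Comp B (und t x) (und s x)) (Cod A f)) (AM (src s) f) =
      Comp B (AM (trg t) f) ((\<lambda>x\<in>Obj A. Comp B (und t x) (und s x)) (Dom A f))"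
      using f B by (simp add: r)
  qed (use F B in \<open>simp_all add: r\<close>)
  then show "Comp (functor_cat A B) t s \<in> Arr (functor_cat A B) \<and>
    Dom (functor_cat A B) (Comp (functor_cat A B) t s) = Dom (functor_cat A B) s \<and>
    Cod (functor_cat A B) (Comp (functor_cat A B) t s) = Cod (functor_cat A B) t"
    by (simp add: functor_cat_Arr)
next
  fix s t v assume "s \<in> Arr (functor_cat A B)" "t \<in> Arr (functor_cat A B)"
    "v \<in> Arr (functor_cat A B)"
    "Dom (functor_cat A B) t = Cod (functor_cat A B) s"
    "Dom (functor_cat A B) v = Cod (functor_cat A B) t"
  then have n: "nat_trans A B (src s) (trg s) (und s)" "nat_trans A B (trg s) (trg t) (und t)"
     "nat_trans A B (trg t) (trg v) (und v)"
    by (auto simp add: functor_cat_Arr)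
  then have F: "is_functor A B (src s)" by (auto simp: nat_trans_def)
  show "Comp (functor_cat A B) v (Comp (functor_cat A B) t s) =
    Comp (functor_cat A B) (Comp (functor_cat A B) v t) s"
    using functor_category[OF F]
    by (simp add: nat_trans_simps[OF n(1)] nat_trans_simps[OF n(2)] nat_trans_simps[OF n(3)]
      cong: restrict_cong)
qed

section \<open>The category of small categories\<close>

lemma Cat_simps [simp]:
  "Obj Cat = {A. small_category A}"
  "Dom Cat = src" "Cod Cat = trg"
  "Ident Cat A = (A, id_ftr A, A)"
  "Comp Cat t s = (src s, comp_ftr (src s) (und t) (und s), trg t)"
  by (simp_all add: Cat_def)

lemma Cat_Arr:
  "t \<in> Arr Cat \<longleftrightarrow> small_category (src t) \<and> small_category (trg t) \<and> is_functor (src t) (trg t) (und t)"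
  by (cases t) (auto simp: Cat_def)

lemma small_category_category [simp]: "small_category A \<Longrightarrow> category A"
  by (simp add: small_category_def)

lemma category_Cat: "category Cat"
proof (rule categoryI)
  fix f :: "'a sarr" assume f: "f \<in> Arr Cat"
  then have F: "is_functor (src f) (trg f) (und f)" by (simp add: Cat_Arr)
  show "Comp Cat f (Ident Cat (Dom Cat f)) = f" "Comp Cat (Ident Cat (Cod Cat f)) f = f"
    using comp_ftr_id[OF F] src_und_trg[of f] by simp_all
next
  fix f g h :: "'a sarr" assume "f \<in> Arr Cat" and "Dom Cat g = Cod Cat f"
  then show "Comp Cat h (Comp Cat g f) = Comp Cat (Comp Cat h g) f"
    using comp_ftr_assoc[of "src f" "trg f" "und f"] by (auto simp: Cat_Arr)
next
  fix f g :: "'a sarr" assume f: "f \<in> Arr Cat" "g \<in> Arr Cat" "Dom Cat g = Cod Cat f"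
  then show "Comp Cat g f \<in> Arr Cat \<and> Dom Cat (Comp Cat g f) = Dom Cat f \<and>
    Cod Cat (Comp Cat g f) = Cod Cat g"
    using functor_comp[of "src f" "trg f" "und f" "trg g" "und g"] by (simp add: Cat_Arr)
qed (auto simp: Cat_Arr functor_id)

text \<open>Here (As1) enters: a small category with a final object is a member, so final objects in
  the slices suffice.\<close>

lemma final_object_slice_aspheric:
  fixes u :: "'u::universe sftr"
  assumes "right_asphericity_structure \<A>" "small_category A" "small_category B" "is_functor A B u"
    and "\<And>b. b \<in> Obj B \<Longrightarrow> small_category (slice A B u b) \<and> (\<exists>t. final_object (slice A B u b) t)"
  shows "aspheric \<A> A B u"
  using assms unfolding aspheric_def right_asphericity_structure_def by metis


section \<open>Localization\<close>

lemma zigzag_simps [simp]: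
  "zigzag C W x [] y \<longleftrightarrow> x = y \<and> x \<in> Obj C"
  "zigzag C W x (Fwd f # l) y \<longleftrightarrow> f \<in> Arr C \<and> Dom C f = x \<and> zigzag C W (Cod C f) l y"
  "zigzag C W x (Bwd f # l) y \<longleftrightarrow>
    f \<in> W \<and> f \<in> Arr C \<and> Cod C f = x \<and> zigzag C W (Dom C f) l y"
  by (subst zigzag.simps; blast)+

lemma zigzag_append:
  "zigzag C W x l y \<Longrightarrow> zigzag C W y m z \<Longrightarrow> zigzag C W x (l @ m) z"
  by (induction rule: zigzag.induct) auto

lemma zigzag_obj:
  assumes "category C"
  shows "zigzag C W x l y \<Longrightarrow> x \<in> Obj C \<and> y \<in> Obj C"
  by (induction rule: zigzag.induct) (use assms in auto)

lemma zz_eq_context: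
  assumes "zz_eq C W y z l l'" "zigzag C W x p y" "zigzag C W z q w"
  shows "zz_eq C W x w (p @ l @ q) (p @ l' @ q)"
  using assms by (intro zz_append zz_refl)

text \<open>Arrows of the localization are handled through chosen representatives: with both ends
  recorded, composition, identities and induced functors become operations on lists.\<close>

definition zarr :: "('o, 'a) cat \<Rightarrow> 'a set \<Rightarrow> 'o \<Rightarrow> 'a step list \<Rightarrow> 'o \<Rightarrow> 'o \<times> 'a step list set \<times> 'o" where
  "zarr C W x l y = (x, zz_class C W x y l, y)"

lemma zarr_simps [simp]: "src (zarr C W x l y) = x" "trg (zarr C W x l y) = y"
  by (simp_all add: zarr_def)

lemma zarr_eqI: "zz_eq C W x y l m \<Longrightarrow> zarr C W x l y = zarr C W x m y"
  unfolding zarr_def zz_class_def by (auto intro: zz_sym zz_trans)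

lemma localization_simps [simp]:
  "Obj (localization C W) = Obj C"
  "Dom (localization C W) = src"
  "Cod (localization C W) = trg"
  "Ident (localization C W) x = zarr C W x [] x"
  by (simp_all add: localization_def zarr_def)

lemma localization_Arr:
  "t \<in> Arr (localization C W) \<longleftrightarrow> (\<exists>x l y. t = zarr C W x l y \<and> zigzag C W x l y)"
  by (auto simp: localization_def zarr_def)

lemma zarr_Arr [simp]: "zigzag C W x l y \<Longrightarrow> zarr C W x l y \<in> Arr (localization C W)"
  by (auto simp: localization_Arr)

text \<open>The union over all representatives in \<open>localization\<close> is a single class:
  \<open>zz_append\<close> makes concatenation independent of the representatives, and reflexivity
  puts the given ones among them.\<close>

lemma localization_Comp:
  assumes "zigzag C W x l y" "zigzag C W y m z"
  shows "Comp (localization C W) (zarr C W y m z) (zarr C W x l y) = zarr C W x (l @ m) z"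
proof -
  have "(\<Union>l'\<in>zz_class C W x y l. \<Union>m'\<in>zz_class C W y z m. zz_class C W x z (l' @ m')) =
      zz_class C W x z (l @ m)" (is "?A = ?B")
  proof
    show "?A \<subseteq> ?B"
      unfolding zz_class_def using zz_append[of C W x y l _ z m] zz_trans[of C W x z "l @ m"] by blast
    show "?B \<subseteq> ?A"
      unfolding zz_class_def using zz_refl[OF assms(1)] zz_refl[OF assms(2)] by blast
  qed
  then show ?thesis by (simp add: localization_def zarr_def)
qed

lemma category_localization:
  assumes "category C"
  shows "category (localization C W)"
proof (rule categoryI)
  fix t assume "t \<in> Arr (localization C W)"
  then obtain x l y where t: "t = zarr C W x l y" "zigzag C W x l y" by (auto simp: localization_Arr)
  note o = zigzag_obj[OF assms t(2)]
  show "Dom (localization C W) t \<in> Obj (localization C W)"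
    "Cod (localization C W) t \<in> Obj (localization C W)" using o t by simp_all
  show "Comp (localization C W) t (Ident (localization C W) (Dom (localization C W) t)) = t"
    "Comp (localization C W) (Ident (localization C W) (Cod (localization C W) t)) t = t"
    using localization_Comp[OF zz_nil t(2)] localization_Comp[OF t(2) zz_nil] o t(1) by auto
next
  fix f g assume "f \<in> Arr (localization C W)" "g \<in> Arr (localization C W)"
    and "Dom (localization C W) g = Cod (localization C W) f"
  then show "Comp (localization C W) g f \<in> Arr (localization C W) \<and>
    Dom (localization C W) (Comp (localization C W) g f) = Dom (localization C W) f \<and>
    Cod (localization C W) (Comp (localization C W) g f) = Cod (localization C W) g"
    by (auto simp: localization_Arr localization_Comp intro!: exI zigzag_append)
next
  fix f g h assume "f \<in> Arr (localization C W)" "g \<in> Arr (localization C W)"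
    "h \<in> Arr (localization C W)" "Dom (localization C W) g = Cod (localization C W) f"
    "Dom (localization C W) h = Cod (localization C W) g"
  then show "Comp (localization C W) h (Comp (localization C W) g f) =
    Comp (localization C W) (Comp (localization C W) h g) f"
    by (auto simp: localization_Arr localization_Comp zigzag_append)
qed (simp add: zz_nil)

section \<open>Functors induced on localizations\<close>

abbreviation step_maps :: "('o, 'a, 'p, 'b) ftr \<Rightarrow> 'a step list \<Rightarrow> 'b step list" where
  "step_maps H \<equiv> map (map_step (AM H))"

lemma zigzag_step_maps:
  assumes "is_functor C D H" "AM H ` (W \<inter> Arr C) \<subseteq> V"
  shows "zigzag C W x l y \<Longrightarrow> zigzag D V (OM H x) (step_maps H l) (OM H y)"
proof (induction rule: zigzag.induct)
  case (zz_fwd f l y)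
  then show ?case
    using zigzag.zz_fwd[of "AM H f" D V] by (simp add: functor_simps[OF assms(1)])
next
  case (zz_bwd s l y)
  have "AM H s \<in> V" using assms(2) zz_bwd(1,2) by auto
  with zz_bwd show ?case
    using zigzag.zz_bwd[of "AM H s" V D] by (simp add: functor_simps[OF assms(1)])
qed (use assms in \<open>simp add: zz_nil functor_simps[OF assms(1)]\<close>)

text \<open>Each generating relation of the congruence is sent by \<open>H\<close> to a generating
  relation of the target. The inclusion is asked only on \<open>W \<inter> Arr C\<close>, as the
  steps of a zigzag are arrows of \<open>C\<close>.\<close>

lemma zz_eq_step_maps:
  assumes "is_functor C D H" "AM H ` (W \<inter> Arr C) \<subseteq> V"
  shows "zz_eq C W x y l m \<Longrightarrow> zz_eq D V (OM H x) (OM H y) (step_maps H l) (step_maps H m)"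
proof (induction rule: zz_eq.induct)
  case (zz_refl x l y)
  then show ?case by (simp add: zz_eq.zz_refl zigzag_step_maps[OF assms])
next
  case (zz_ident x)
  then show ?case using zz_eq.zz_ident[of "OM H x" D V] by (simp add: functor_simps[OF assms(1)])
next
  case (zz_comp f g)
  then show ?case
    using zz_eq.zz_comp[of "AM H f" D "AM H g" V] by (simp add: functor_simps[OF assms(1)])
next
  case (zz_inv_right s)
  have "AM H s \<in> V" using assms(2) zz_inv_right by auto
  with zz_inv_right show ?case
    using zz_eq.zz_inv_right[of "AM H s" V D] by (simp add: functor_simps[OF assms(1)])
next
  case (zz_inv_left s)
  have "AM H s \<in> V" using assms(2) zz_inv_left by auto
  with zz_inv_left show ?case
    using zz_eq.zz_inv_left[of "AM H s" V D] by (simp add: functor_simps[OF assms(1)])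
qed (auto intro: zz_eq.zz_sym zz_eq.zz_trans zz_eq.zz_append)

lemma loc_ftr_OM [simp]: "x \<in> Obj C \<Longrightarrow> OM (loc_ftr C W D V H) x = OM H x"
  by (simp add: loc_ftr_def)

text \<open>As for composition, the union in \<open>loc_ftr\<close> runs over classes that all
  coincide, because \<open>H\<close> preserves the congruence.\<close>

lemma loc_ftr_AM:
  assumes "is_functor C D H" "AM H ` (W \<inter> Arr C) \<subseteq> V" "zigzag C W x l y"
  shows "AM (loc_ftr C W D V H) (zarr C W x l y) = zarr D V (OM H x) (step_maps H l) (OM H y)"
proof -
  let ?k = "\<lambda>l. zz_class D V (OM H x) (OM H y) (step_maps H l)"
  have "?k m = ?k l" if "m \<in> zz_class C W x y l" for m
    using zarr_eqI[OF zz_eq_step_maps[OF assms(1,2)]] that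
    by (fastforce simp: zz_class_def[of C] zarr_def)
  moreover have "l \<in> zz_class C W x y l" using assms(3) by (simp add: zz_class_def zz_refl)
  ultimately have "(\<Union>m\<in>zz_class C W x y l. ?k m) = ?k l" by blast
  moreover have "zarr C W x l y \<in> Arr (localization C W)" using assms(3) by simp
  ultimately show ?thesis by (simp add: loc_ftr_def zarr_def)
qed

lemma loc_ftr_functor:
  assumes "is_functor C D H" "AM H ` (W \<inter> Arr C) \<subseteq> V"
  shows "is_functor (localization C W) (localization D V) (loc_ftr C W D V H)"
proof -
  note C = functor_category[OF assms(1)]
  note h = loc_ftr_AM[OF assms] zigzag_step_maps[OF assms]
  show ?thesis
  proof (rule functorI)
    fix t assume "t \<in> Arr (localization C W)"
    then obtain x l y where t: "t = zarr C W x l y" "zigzag C W x l y"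
      by (auto simp: localization_Arr)
    with zigzag_obj[OF C(1) t(2)]
    show "AM (loc_ftr C W D V H) t \<in> Arr (localization D V) \<and>
      Dom (localization D V) (AM (loc_ftr C W D V H) t) =
        OM (loc_ftr C W D V H) (Dom (localization C W) t) \<and>
      Cod (localization D V) (AM (loc_ftr C W D V H) t) =
        OM (loc_ftr C W D V H) (Cod (localization C W) t)"
      by (auto simp: h)
  next
    fix f g assume "f \<in> Arr (localization C W)" "g \<in> Arr (localization C W)"
      and "Dom (localization C W) g = Cod (localization C W) f"
    then obtain x l y m z where "f = zarr C W x l y" "g = zarr C W y m z"
      and zz: "zigzag C W x l y" "zigzag C W y m z"
      by (auto simp: localization_Arr)
    then show "AM (loc_ftr C W D V H) (Comp (localization C W) g f) =
      Comp (localization D V) (AM (loc_ftr C W D V H) g) (AM (loc_ftr C W D V H) f)"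
      by (simp add: localization_Comp h zigzag_append localization_Comp[OF zigzag_step_maps[OF assms zz(1)]
        zigzag_step_maps[OF assms zz(2)]])
  next
    fix x assume "x \<in> Obj (localization C W)"
    then show "AM (loc_ftr C W D V H) (Ident (localization C W) x) =
      Ident (localization D V) (OM (loc_ftr C W D V H) x)"
      by (simp add: h)
  qed (simp_all add: category_localization C functor_simps[OF assms(1)] loc_ftr_def[of C])
qed


section \<open>Calculus of zigzags: natural families, spans, path objects\<close>

lemma step_maps_id: "zigzag C W x l y \<Longrightarrow> step_maps (id_ftr C) l = l"
  by (induction rule: zigzag.induct) auto

text \<open>The zigzag serves as a typing condition: \<open>comp_ftr\<close> agrees with successive
  application only on arrows of \<open>C\<close>, being \<open>undefined\<close> elsewhere.\<close>

lemma step_maps_comp: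
  "zigzag C W x l y \<Longrightarrow> step_maps (comp_ftr C G F) l = step_maps G (step_maps F l)"
  by (induction rule: zigzag.induct) auto

text \<open>Naturality need only be checked on the arrows of \<open>C\<close>, since a square for
  \<open>s\<close> yields one for its formal inverse. Thus a family on the objects of
  \<open>C\<close>, even one whose components are mere zigzags, becomes a natural transformation
  between the induced functors.\<close>

lemma zz_eq_natural:
  assumes H: "is_functor C D H" "AM H ` (W \<inter> Arr C) \<subseteq> V" and K: "is_functor C D K" "AM K ` (W \<inter> Arr C) \<subseteq> V"
    and n: "\<And>x. x \<in> Obj C \<Longrightarrow> zigzag D V (OM H x) (n x) (OM K x)"
    and gen: "\<And>f. f \<in> Arr C \<Longrightarrow> zz_eq D V (OM H (Dom C f)) (OM K (Cod C f))
      (n (Dom C f) @ [Fwd (AM K f)]) (Fwd (AM H f) # n (Cod C f))"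
  shows "zigzag C W x l y \<Longrightarrow>
    zz_eq D V (OM H x) (OM K y) (n x @ step_maps K l) (step_maps H l @ n y)"
proof (induction rule: zigzag.induct)
  case (zz_nil x)
  then show ?case using n by (simp add: zz_refl)
next
  case (zz_fwd f l y)
  note HK = functor_simps[OF H(1)] functor_simps[OF K(1)]
  have 1: "zz_eq D V (OM H (Dom C f)) (OM K y) ((n (Dom C f) @ [Fwd (AM K f)]) @ step_maps K l)
    ((Fwd (AM H f) # n (Cod C f)) @ step_maps K l)"
    using zz_append[OF gen[OF zz_fwd(1)] zz_refl[OF zigzag_step_maps[OF K zz_fwd(2)]]] .
  have 2: "zz_eq D V (OM H (Dom C f)) (OM K y) ([Fwd (AM H f)] @ (n (Cod C f) @ step_maps K l))
    ([Fwd (AM H f)] @ (step_maps H l @ n y))"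
    using zz_append[OF zz_refl zz_fwd(3), of "OM H (Dom C f)" "[Fwd (AM H f)]"]
      zz_fwd(1) functor_category[OF H(1)] by (simp add: HK)
  show ?case using zz_trans[OF 1] 2 by simp
next
  case (zz_bwd s l y)
  note HK = functor_simps[OF H(1)] functor_simps[OF K(1)] functor_category[OF H(1)]
  let ?a = "Dom C s" and ?b = "Cod C s"
  have V: "AM H s \<in> V" "AM K s \<in> V" using H(2) K(2) zz_bwd(1,2) by auto
  note n' = n[of ?a] n[of ?b]
  have l: "zigzag D V (OM K ?a) (step_maps K l) (OM K y)"
    using zigzag_step_maps[OF K zz_bwd(3)] .
  \<comment> \<open>The square for the inverse of \<open>s\<close>: insert the inverse of
    \<open>AM H s\<close> followed by \<open>AM H s\<close> in front, use the square of
    \<open>s\<close> backwards, and cancel \<open>AM K s\<close> against its inverse at the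
    end.\<close>
  have 1: "zz_eq D V (OM H ?b) (OM K ?a) (n ?b @ [Bwd (AM K s)])
    ([Bwd (AM H s), Fwd (AM H s)] @ n ?b @ [Bwd (AM K s)])"
    using zz_bwd zz_sym[OF zz_inv_left[of "AM H s" V D]] V n'
    by (intro zz_append[of _ _ _ "OM H ?b" "[]", simplified] zz_refl zigzag_append)
      (auto simp: HK)
  have 2: "zz_eq D V (OM H ?b) (OM K ?a)
    ([Bwd (AM H s)] @ (Fwd (AM H s) # n ?b) @ [Bwd (AM K s)])
    ([Bwd (AM H s)] @ (n ?a @ [Fwd (AM K s)]) @ [Bwd (AM K s)])"
    using zz_sym[OF gen[OF zz_bwd(2)]] zz_bwd V n'
    by (intro zz_eq_context) (auto simp: HK)
  have 3: "zz_eq D V (OM H ?b) (OM K ?a)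
    (([Bwd (AM H s)] @ n ?a) @ [Fwd (AM K s), Bwd (AM K s)] @ [])
    (([Bwd (AM H s)] @ n ?a) @ [] @ [])"
    using zz_inv_right[of "AM K s" V D] zz_bwd V n'
    by (intro zz_eq_context zigzag_append) (auto simp: HK)
  have 4: "zz_eq D V (OM H ?b) (OM K ?a) (n ?b @ [Bwd (AM K s)]) (Bwd (AM H s) # n ?a)"
    using zz_trans[OF zz_trans[OF 1] 3] 2 by simp
  have 5: "zz_eq D V (OM H ?b) (OM K y) ((n ?b @ [Bwd (AM K s)]) @ step_maps K l)
    ((Bwd (AM H s) # n ?a) @ step_maps K l)"
    using zz_append[OF 4 zz_refl[OF l]] .
  have 6: "zz_eq D V (OM H ?b) (OM K y) ([Bwd (AM H s)] @ (n ?a @ step_maps K l))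
    ([Bwd (AM H s)] @ (step_maps H l @ n y))"
    using zz_append[OF zz_refl zz_bwd(4), of "OM H ?b" "[Bwd (AM H s)]"] zz_bwd(1,2) V
    by (simp add: HK)
  show ?case using zz_trans[OF 5] 6 by simp
qed

text \<open>A morphism of spans \<open>(f, g, h)\<close> from \<open>(e, k)\<close> to
  \<open>(e', k')\<close> gives a commuting square between the fractions they represent: insert
  \<open>e'\<close> and its inverse after \<open>g\<close>, trade \<open>g\<close>,
  \<open>e'\<close> for \<open>e\<close>, \<open>f\<close>, and cancel \<open>e\<close>. This is
  what makes a unit that is only a fraction natural.\<close>

lemma zz_eq_square:
  assumes C: "category C" and e: "e \<in> W" "e \<in> Arr C" "e' \<in> W" "e' \<in> Arr C"
    and f: "f \<in> Arr C" "Dom C f = Cod C e" "Cod C f = Cod C e'"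
    and g: "g \<in> Arr C" "Dom C g = Dom C e" "Cod C g = Dom C e'"
    and k: "k \<in> Arr C" "Dom C k = Dom C e" "k' \<in> Arr C" "Dom C k' = Dom C e'"
    and h: "h \<in> Arr C" "Dom C h = Cod C k" "Cod C h = Cod C k'"
    and eq: "Comp C e' g = Comp C f e" "Comp C k' g = Comp C h k"
  shows "zz_eq C W (Cod C e) (Cod C k') [Bwd e, Fwd k, Fwd h] [Fwd f, Bwd e', Fwd k']"
proof -
  note assms [simp]
  have a: "zz_eq C W (Dom C e) (Cod C k') [Fwd k, Fwd h] [Fwd g, Fwd k']"
    using zz_trans[OF _ zz_sym[OF zz_comp[of g C k' W]]] zz_comp[of k C h W] by simp
  have b: "zz_eq C W (Dom C e) (Cod C f) [Fwd g, Fwd e'] [Fwd e, Fwd f]"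
    using zz_trans[OF _ zz_sym[OF zz_comp[of e C f W]]] zz_comp[of g C e' W] by simp
  have 1: "zz_eq C W (Cod C e) (Cod C k') [Bwd e, Fwd k, Fwd h] [Bwd e, Fwd g, Fwd k']"
    using zz_eq_context[OF a, of "Cod C e" "[Bwd e]" "[]"] by simp
  have 2: "zz_eq C W (Cod C e) (Cod C k') [Bwd e, Fwd g, Fwd e', Bwd e', Fwd k'] [Bwd e, Fwd g, Fwd k']"
    using zz_eq_context[OF zz_inv_right[OF e(3,4)], of "Cod C e" "[Bwd e, Fwd g]" "[Fwd k']"] by simp
  have 3: "zz_eq C W (Cod C e) (Cod C k') [Bwd e, Fwd g, Fwd e', Bwd e', Fwd k']
    [Bwd e, Fwd e, Fwd f, Bwd e', Fwd k']"
    using zz_eq_context[OF b, of "Cod C e" "[Bwd e]" "[Bwd e', Fwd k']"] by simp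
  have 4: "zz_eq C W (Cod C e) (Cod C k') [Bwd e, Fwd e, Fwd f, Bwd e', Fwd k'] [Fwd f, Bwd e', Fwd k']"
    using zz_eq_context[OF zz_inv_left[OF e(1,2)], of "Cod C e" "[]" "[Fwd f, Bwd e', Fwd k']"] by simp
  show ?thesis using zz_trans[OF 1 zz_trans[OF zz_sym[OF 2] zz_trans[OF 3 4]]] .
qed

text \<open>Once \<open>c\<close> is inverted, its section \<open>i\<close> becomes its inverse, so
  d = d (i c) = (d i) c = c. With \<open>c\<close> and \<open>d\<close> the two ends of a path
  object and \<open>a\<close> a homotopy, the maps at both ends of the homotopy are
  identified.\<close>

lemma zz_eq_path_object:
  assumes C: "category C" and c: "c \<in> W" "c \<in> Arr C" and d: "d \<in> Arr C" and i: "i \<in> Arr C"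
    and t: "Dom C c = Cod C i" "Cod C c = Dom C i" "Dom C d = Cod C i" "Cod C d = Dom C i"
    and eq: "Comp C c i = Ident C (Dom C i)" "Comp C d i = Ident C (Dom C i)"
    and a: "a \<in> Arr C" "Cod C a = Cod C i"
  shows "zz_eq C W (Dom C a) (Dom C i) [Fwd (Comp C d a)] [Fwd (Comp C c a)]"
proof -
  note assms [simp]
  have ci: "zz_eq C W (Dom C i) (Dom C i) [Fwd i, Fwd c] []"
    using zz_trans[OF _ zz_ident[of "Dom C i" C W]] zz_comp[of i C c W] by simp
  have di: "zz_eq C W (Dom C i) (Dom C i) [Fwd i, Fwd d] []"
    using zz_trans[OF _ zz_ident[of "Dom C i" C W]] zz_comp[of i C d W] by simp
  have 1: "zz_eq C W (Cod C i) (Dom C i) [Fwd c, Bwd c, Fwd d] [Fwd d]"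
    using zz_eq_context[OF zz_inv_right[OF c], of "Cod C i" "[]" "[Fwd d]"] by simp
  have 2: "zz_eq C W (Cod C i) (Dom C i) [Fwd c, Fwd i, Fwd c, Bwd c, Fwd d] [Fwd c, Bwd c, Fwd d]"
    using zz_eq_context[OF ci, of "Cod C i" "[Fwd c]" "[Bwd c, Fwd d]"] by simp
  have 3: "zz_eq C W (Cod C i) (Dom C i) [Fwd c, Fwd i, Fwd c, Bwd c, Fwd d] [Fwd c, Fwd i, Fwd d]"
    using zz_eq_context[OF zz_inv_right[OF c], of "Cod C i" "[Fwd c, Fwd i]" "[Fwd d]"] by simp
  have 4: "zz_eq C W (Cod C i) (Dom C i) [Fwd c, Fwd i, Fwd d] [Fwd c]"
    using zz_eq_context[OF di, of "Cod C i" "[Fwd c]" "[]"] by simp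
  have "zz_eq C W (Cod C i) (Dom C i) [Fwd d] [Fwd c]"
    using zz_trans[OF zz_sym[OF 1] zz_trans[OF zz_sym[OF 2] zz_trans[OF 3 4]]] .
  from zz_eq_context[OF this, of "Dom C a" "[Fwd a]" "[]"]
  have 5: "zz_eq C W (Dom C a) (Dom C i) [Fwd a, Fwd d] [Fwd a, Fwd c]" by simp
  show ?thesis using zz_trans[OF zz_sym zz_trans[OF 5]] zz_comp[of a C d W] zz_comp[of a C c W] by simp
qed

text \<open>\<open>E\<close> is a replacement functor with projection \<open>\<epsilon>\<close>, and
  the unit is the fraction of \<open>\<kappa>\<close> by \<open>\<epsilon>\<close>. The triangle
  identities are stated with this denominator multiplied through, so each has
  \<open>\<epsilon>\<close> or its image on the right: \<open>T2\<close> holds on the nose,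
  \<open>T1\<close> only after localization.\<close>

theorem localization_adjunction:
  assumes L: "is_functor C D L" "AM L ` (W \<inter> Arr C) \<subseteq> V" and R: "is_functor D C R" "AM R ` (V \<inter> Arr D) \<subseteq> W"
    and \<epsilon>: "nat_trans C C E (id_ftr C) \<epsilon>" "\<And>x. x \<in> Obj C \<Longrightarrow> \<epsilon> x \<in> W"
    and \<kappa>: "nat_trans C C E (comp_ftr C R L) \<kappa>"
    and \<gamma>: "nat_trans D D (comp_ftr D L R) (id_ftr D) \<gamma>"
    and T1: "\<And>x. x \<in> Obj C \<Longrightarrow> zz_eq D V (OM L (OM E x)) (OM L x)
      [Fwd (Comp D (\<gamma> (OM L x)) (AM L (\<kappa> x)))] [Fwd (AM L (\<epsilon> x))]"
    and T2: "\<And>y. y \<in> Obj D \<Longrightarrow> Comp C (AM R (\<gamma> y)) (\<kappa> (OM R y)) = \<epsilon> (OM R y)"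
  shows "adjoint_pair (localization C W) (localization D V) (loc_ftr C W D V L) (loc_ftr D V C W R)"
proof -
  let ?C = "localization C W" and ?D = "localization D V"
  let ?L = "loc_ftr C W D V L" and ?R = "loc_ftr D V C W R"
  have E: "is_functor C C E" using \<epsilon>(1) by (simp add: nat_trans_def)
  note CD = functor_category[OF L(1)]
  note LR = functor_comp[OF L(1) R(1)] functor_comp[OF R(1) L(1)]
  note fL = loc_ftr_functor[OF L] and fR = loc_ftr_functor[OF R]
  note cC = category_localization[OF CD(1), of W] and cD = category_localization[OF CD(2), of V]
  note [simp] = CD functor_simps[OF L(1)] functor_simps[OF R(1)] functor_simps[OF E] \<epsilon>(2)
    nat_trans_simps(1-3)[OF \<epsilon>(1)] nat_trans_simps(1-3)[OF \<kappa>] nat_trans_simps(1-3)[OF \<gamma>]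
  note nat\<epsilon> = nat_trans_simps(4)[OF \<epsilon>(1)] and nat\<kappa> = nat_trans_simps(4)[OF \<kappa>]
    and nat\<gamma> = nat_trans_simps(4)[OF \<gamma>]
  let ?n = "\<lambda>x. [Bwd (\<epsilon> x), Fwd (\<kappa> x)]"
  let ?\<eta> = "\<lambda>x\<in>Obj C. zarr C W x (?n x) (OM R (OM L x))"
  let ?g = "\<lambda>y\<in>Obj D. zarr D V (OM L (OM R y)) [Fwd (\<gamma> y)] y"
  have n: "zigzag C W x (?n x) (OM R (OM L x))" if "x \<in> Obj C" for x
    using that by simp
  have g: "zigzag D V (OM L (OM R y)) [Fwd (\<gamma> y)] y" if "y \<in> Obj D" for y
    using that by simp
  have LV: "AM L f \<in> V" if "f \<in> W" "f \<in> Arr C" for f using that L(2) by auto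
  have RW: "AM R f \<in> W" if "f \<in> V" "f \<in> Arr D" for f using that R(2) by auto
  have "nat_trans ?C ?C (id_ftr ?C) (comp_ftr ?C ?R ?L) ?\<eta>"
  proof (rule nat_transI)
    fix t assume "t \<in> Arr ?C"
    then obtain x l y where t: "t = zarr C W x l y" and l: "zigzag C W x l y"
      by (auto simp: localization_Arr)
    have xy: "x \<in> Obj C" "y \<in> Obj C" using zigzag_obj[OF CD(1) l] by auto
    have "zz_eq C W (OM (id_ftr C) x) (OM (comp_ftr C R L) y) (?n x @ step_maps (comp_ftr C R L) l)
      (step_maps (id_ftr C) l @ ?n y)"
    proof (rule zz_eq_natural[OF functor_id[OF CD(1)] _ LR(1) _ _ _ l])
      fix f assume f: "f \<in> Arr C"
      then show "zz_eq C W (OM (id_ftr C) (Dom C f)) (OM (comp_ftr C R L) (Cod C f))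
         (?n (Dom C f) @ [Fwd (AM (comp_ftr C R L) f)]) (Fwd (AM (id_ftr C) f) # ?n (Cod C f))"
        using zz_eq_square[of C "\<epsilon> (Dom C f)" W "\<epsilon> (Cod C f)" f "AM E f" "\<kappa> (Dom C f)"
          "\<kappa> (Cod C f)" "AM R (AM L f)"] nat\<epsilon>[OF f] nat\<kappa>[OF f] by simp
    qed (use LV RW n in auto)
    then have "zz_eq C W x (OM R (OM L y)) (l @ ?n y) (?n x @ step_maps R (step_maps L l))"
      using xy by (simp add: step_maps_id[OF l] step_maps_comp[OF l] zz_sym)
    from zarr_eqI[OF this]
    show "Comp ?C (?\<eta> (Cod ?C t)) (AM (id_ftr ?C) t) =
      Comp ?C (AM (comp_ftr ?C ?R ?L) t) (?\<eta> (Dom ?C t))"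
      using xy l localization_Comp[OF n zigzag_step_maps[OF R zigzag_step_maps[OF L l]]]
        localization_Comp[OF l n]
      by (simp add: t loc_ftr_AM[OF L l] loc_ftr_AM[OF R zigzag_step_maps[OF L l]])
  qed (use functor_id[OF cC] functor_comp[OF fL fR] n in simp_all)
  moreover have "nat_trans ?D ?D (comp_ftr ?D ?L ?R) (id_ftr ?D) ?g"
  proof (rule nat_transI)
    fix t assume "t \<in> Arr ?D"
    then obtain x l y where t: "t = zarr D V x l y" and l: "zigzag D V x l y"
      by (auto simp: localization_Arr)
    have xy: "x \<in> Obj D" "y \<in> Obj D" using zigzag_obj[OF CD(2) l] by auto
    have "zz_eq D V (OM (comp_ftr D L R) x) (OM (id_ftr D) y) ([Fwd (\<gamma> x)] @ step_maps (id_ftr D) l)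
      (step_maps (comp_ftr D L R) l @ [Fwd (\<gamma> y)])"
    proof (rule zz_eq_natural[OF LR(2) _ functor_id[OF CD(2)] _ _ _ l])
      fix f assume f: "f \<in> Arr D"
      then show "zz_eq D V (OM (comp_ftr D L R) (Dom D f)) (OM (id_ftr D) (Cod D f))
         ([Fwd (\<gamma> (Dom D f))] @ [Fwd (AM (id_ftr D) f)])
         (Fwd (AM (comp_ftr D L R) f) # [Fwd (\<gamma> (Cod D f))])"
        using zz_trans[OF _ zz_sym[OF zz_comp[of "AM L (AM R f)" D "\<gamma> (Cod D f)" V]]]
          zz_comp[of "\<gamma> (Dom D f)" D f V] nat\<gamma>[OF f]
        by simp
    qed (use LV RW in auto)
    then have "zz_eq D V (OM L (OM R x)) y (step_maps L (step_maps R l) @ [Fwd (\<gamma> y)]) (Fwd (\<gamma> x) # l)"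
      using xy by (simp add: step_maps_id[OF l] step_maps_comp[OF l] zz_sym)
    from zarr_eqI[OF this]
    show "Comp ?D (?g (Cod ?D t)) (AM (comp_ftr ?D ?L ?R) t) =
      Comp ?D (AM (id_ftr ?D) t) (?g (Dom ?D t))"
      using xy l localization_Comp[OF g l]
        localization_Comp[OF zigzag_step_maps[OF L zigzag_step_maps[OF R l]] g]
      by (simp add: t loc_ftr_AM[OF R l] loc_ftr_AM[OF L zigzag_step_maps[OF R l]])
  qed (use functor_id[OF cD] functor_comp[OF fR fL] g in simp_all)
  moreover have "Comp ?D (?g (OM ?L x)) (AM ?L (?\<eta> x)) = Ident ?D (OM ?L x)"
    if "x \<in> Obj ?C" for x
  proof -
    have x [simp]: "x \<in> Obj C" using that by simp
    have V: "AM L (\<epsilon> x) \<in> V" using LV \<epsilon>(2)[OF x] by simp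
    have 1: "zz_eq D V (OM L (OM E x)) (OM L x)
      [Fwd (AM L (\<kappa> x)), Fwd (\<gamma> (OM L x))] [Fwd (AM L (\<epsilon> x))]"
      using zz_trans[OF _ T1[OF x]] zz_comp[of "AM L (\<kappa> x)" D "\<gamma> (OM L x)" V] by simp
    have "zz_eq D V (OM L x) (OM L x)
      [Bwd (AM L (\<epsilon> x)), Fwd (AM L (\<kappa> x)), Fwd (\<gamma> (OM L x))] []"
      using zz_trans[OF zz_eq_context[OF 1, of "OM L x" "[Bwd (AM L (\<epsilon> x))]" "[]"]]
        zz_inv_left[of "AM L (\<epsilon> x)" V D] V by simp
    from zarr_eqI[OF this] show ?thesis
      using localization_Comp[OF zigzag_step_maps[OF L n[OF x]] g[of "OM L x"]]
      by (simp add: loc_ftr_AM[OF L n[OF x], simplified])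
  qed
  moreover have "Comp ?C (AM ?R (?g y)) (?\<eta> (OM ?R y)) = Ident ?C (OM ?R y)"
    if "y \<in> Obj ?D" for y
  proof -
    have y [simp]: "y \<in> Obj D" using that by simp
    have 1: "zz_eq C W (OM E (OM R y)) (OM R y)
      [Fwd (\<kappa> (OM R y)), Fwd (AM R (\<gamma> y))] [Fwd (\<epsilon> (OM R y))]"
      using zz_comp[of "\<kappa> (OM R y)" C "AM R (\<gamma> y)" W] by (simp add: T2)
    have "zz_eq C W (OM R y) (OM R y)
      [Bwd (\<epsilon> (OM R y)), Fwd (\<kappa> (OM R y)), Fwd (AM R (\<gamma> y))] []"
      using zz_trans[OF zz_eq_context[OF 1, of "OM R y" "[Bwd (\<epsilon> (OM R y))]" "[]"]]
        zz_inv_left[of "\<epsilon> (OM R y)" W C] by simp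
    from zarr_eqI[OF this] show ?thesis
      using localization_Comp[OF n[of "OM R y"] zigzag_step_maps[OF R g[OF y]]]
      by (simp add: loc_ftr_AM[OF R g[OF y], simplified])
  qed
  ultimately show ?thesis unfolding adjoint_pair_def using fL fR by blast
qed


section \<open>Slices and diagrams of categories\<close>

lemma functor_eqI':
  assumes "is_functor A B F" "OM G \<in> extensional (Obj A)" "AM G \<in> extensional (Arr A)"
    and "\<And>x. x \<in> Obj A \<Longrightarrow> OM F x = OM G x" "\<And>f. f \<in> Arr A \<Longrightarrow> AM F f = AM G f"
  shows "F = G"
  using functor_eqI[OF functor_ext(1)[OF assms(1)] assms(2) functor_ext(2)[OF assms(1)] assms(3-5)] .

text \<open>Simplification nests composites to the right, so a known composite
  \<open>Comp C h g\<close> may no longer occur as a subterm; this form applies it under a further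
  precomposition.\<close>

lemma Comp_reassoc:
  assumes "Comp C h g = k" "category C" "f \<in> Arr C" "g \<in> Arr C" "h \<in> Arr C"
    "Dom C g = Cod C f" "Dom C h = Cod C g"
  shows "Comp C h (Comp C g f) = Comp C k f"
  using assms(2-) by (simp flip: assms(1))

text \<open>\<open>pair\<close> is not assumed surjective, so an element need not be recovered from
  its projections. With this predicate and \<open>tripled\<close>, the existential descriptions of
  objects and arrows become conditions on projections, which suit rewriting.\<close>

definition paired :: "'u::universe \<Rightarrow> bool" where
  "paired z \<longleftrightarrow> z = pair (pi1 z) (pi2 z)"

definition tripled :: "'u::universe \<Rightarrow> bool" where
  "tripled t \<longleftrightarrow> t = mk_arr (asrc t) (aund t) (atrg t)"

lemma mk_arr_simps [simp]:
  "asrc (mk_arr x f y) = x" "aund (mk_arr x f y) = f" "atrg (mk_arr x f y) = y"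
  by (simp_all add: mk_arr_def asrc_def aund_def atrg_def)

lemma paired_pair [simp]: "paired (pair x y)" by (simp add: paired_def)
lemma tripled_mk_arr [simp]: "tripled (mk_arr x f y)" by (simp add: tripled_def)
lemma paired_eq [simp]: "paired z \<Longrightarrow> pair (pi1 z) (pi2 z) = z" by (simp add: paired_def)
lemma tripled_eq [simp]:
  "tripled t \<Longrightarrow> asrc t = x \<Longrightarrow> atrg t = y \<Longrightarrow> mk_arr x (aund t) y = t"
  by (auto simp: tripled_def)

lemma pair_eq_iff [simp]: "pair x y = pair x' y' \<longleftrightarrow> x = x' \<and> y = y'"
  by (metis pi1_pair pi2_pair)

lemma small_pairs:
  assumes "small X" "small Y"
  shows "small {pair x y | x y. x \<in> X \<and> y \<in> Y}"
proof -
  have "{pair x y | x y. x \<in> X \<and> y \<in> Y} = (\<Union>x\<in>X. \<Union>y\<in>Y. {pair x y})" by auto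
  then show ?thesis by (simp add: small_UN small_finite assms)
qed

lemma small_triples:
  assumes "small X" "small Y" "small Z"
  shows "small {mk_arr x y z | x y z. x \<in> X \<and> y \<in> Y \<and> z \<in> Z}"
proof -
  have "{mk_arr x y z | x y z. x \<in> X \<and> y \<in> Y \<and> z \<in> Z} = (\<Union>x\<in>X. \<Union>y\<in>Y. \<Union>z\<in>Z. {mk_arr x y z})"
    by auto
  then show ?thesis by (simp add: small_UN small_finite assms)
qed

section \<open>Slice categories\<close>

lemma slice_simps [simp]:
  "Dom (slice A B u b) = asrc" "Cod (slice A B u b) = atrg"
  "Ident (slice A B u b) x = mk_arr x (Ident A (pi1 x)) x"
  "Comp (slice A B u b) t s = mk_arr (asrc s) (Comp A (aund t) (aund s)) (atrg t)"
  by (simp_all add: slice_def)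

lemma slice_Obj [simp]:
  "z \<in> Obj (slice A B u b) \<longleftrightarrow> paired z \<and> pi1 z \<in> Obj A \<and> pi2 z \<in> Arr B \<and>
    Dom B (pi2 z) = OM u (pi1 z) \<and> Cod B (pi2 z) = b"
proof
  assume "paired z \<and> pi1 z \<in> Obj A \<and> pi2 z \<in> Arr B \<and>
    Dom B (pi2 z) = OM u (pi1 z) \<and> Cod B (pi2 z) = b"
  then have "\<exists>a p. z = pair a p \<and> a \<in> Obj A \<and> p \<in> hom B (OM u a) b"
    by (intro exI[of _ "pi1 z"] exI[of _ "pi2 z"]) (simp add: hom_def)
  then show "z \<in> Obj (slice A B u b)" by (simp add: slice_def)
qed (auto simp: slice_def hom_def)

lemma slice_Arr [simp]:
  "t \<in> Arr (slice A B u b) \<longleftrightarrow> tripled t \<and> asrc t \<in> Obj (slice A B u b) \<and>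
    atrg t \<in> Obj (slice A B u b) \<and> aund t \<in> Arr A \<and> Dom A (aund t) = pi1 (asrc t) \<and>
    Cod A (aund t) = pi1 (atrg t) \<and> Comp B (pi2 (atrg t)) (AM u (aund t)) = pi2 (asrc t)"
  (is "_ \<longleftrightarrow> ?P t")
proof
  assume "?P t"
  then have "\<exists>a p f a' p'. t = mk_arr (pair a p) f (pair a' p') \<and>
    a \<in> Obj A \<and> p \<in> hom B (OM u a) b \<and> a' \<in> Obj A \<and> p' \<in> hom B (OM u a') b \<and>
               f \<in> hom A a a' \<and> Comp B p' (AM u f) = p"
    by (intro exI[of _ "pi1 (asrc t)"] exI[of _ "pi2 (asrc t)"] exI[of _ "pi1 (atrg t)"]
        exI[of _ "pi2 (atrg t)"] exI[of _ "aund t"]) (simp add: hom_def)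
  then show "t \<in> Arr (slice A B u b)" by (simp add: slice_def)
qed (auto simp: slice_def hom_def)

lemma category_slice:
  assumes "is_functor A B u"
  shows "category (slice A B u b)"
proof -
  note [simp] = functor_category[OF assms] functor_simps[OF assms]
  show ?thesis
    by (rule categoryI) (auto simp: Comp_reassoc[where C = B])
qed

lemma small_category_slice:
  assumes "small_category A" "small_category B" "is_functor A B u"
  shows "small_category (slice A B u b)"
proof -
  have "Obj (slice A B u b) \<subseteq> {pair x y | x y. x \<in> Obj A \<and> y \<in> Arr B}"
    by (auto simp del: pair_eq_iff) (metis paired_def)
  then have o: "small (Obj (slice A B u b))"
    using small_subset[OF small_pairs[of "Obj A" "Arr B"]] assms by (simp add: small_category_def)
  have "Arr (slice A B u b) \<subseteq> {mk_arr x y z | x y z. x \<in> Obj (slice A B u b) \<and> y \<in> Arr A \<and> z \<in> Obj (slice A B u b)}"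
    (is "_ \<subseteq> ?R")
  proof
    fix t assume "t \<in> Arr (slice A B u b)"
    then show "t \<in> ?R"
      by (intro CollectI exI[of _ "asrc t"] exI[of _ "aund t"] exI[of _ "atrg t"]) auto
  qed
  then have "small (Arr (slice A B u b))"
    using small_subset[OF small_triples[of "Obj (slice A B u b)" "Arr A" "Obj (slice A B u b)"]]
      assms(1) o by (simp add: small_category_def)
  with o show ?thesis using category_slice[OF assms(3)] by (simp add: small_category_def)
qed

section \<open>Diagrams of small categories and their morphisms\<close>

abbreviation ob :: "'u::universe diag \<Rightarrow> 'u \<Rightarrow> 'u \<Rightarrow> 'u" where
  "ob F k \<equiv> OM (und (AM F k))"

abbreviation ar :: "'u::universe diag \<Rightarrow> 'u \<Rightarrow> 'u \<Rightarrow> 'u" where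
  "ar F k \<equiv> AM (und (AM F k))"

lemma diag_simps:
  assumes F: "is_functor J Cat F"
  shows "category J"
    and "j \<in> Obj J \<Longrightarrow> small_category (OM F j)"
    and "k \<in> Arr J \<Longrightarrow> is_functor (OM F (Dom J k)) (OM F (Cod J k)) (und (AM F k))"
    and "k \<in> Arr J \<Longrightarrow> Cod J k = j' \<Longrightarrow> a \<in> Obj (OM F (Dom J k)) \<Longrightarrow> ob F k a \<in> Obj (OM F j')"
    and "k \<in> Arr J \<Longrightarrow> Cod J k = j' \<Longrightarrow> f \<in> Arr (OM F (Dom J k)) \<Longrightarrow> ar F k f \<in> Arr (OM F j')"
    and "k \<in> Arr J \<Longrightarrow> Cod J k = j' \<Longrightarrow> f \<in> Arr (OM F (Dom J k)) \<Longrightarrow>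
      Dom (OM F j') (ar F k f) = ob F k (Dom (OM F (Dom J k)) f)"
    and "k \<in> Arr J \<Longrightarrow> Cod J k = j' \<Longrightarrow> f \<in> Arr (OM F (Dom J k)) \<Longrightarrow>
      Cod (OM F j') (ar F k f) = ob F k (Cod (OM F (Dom J k)) f)"
    and "k \<in> Arr J \<Longrightarrow> C = OM F (Dom J k) \<Longrightarrow> a \<in> Obj C \<Longrightarrow>
      ar F k (Ident C a) = Ident (OM F (Cod J k)) (ob F k a)"
    and "k \<in> Arr J \<Longrightarrow> C = OM F (Dom J k) \<Longrightarrow> f \<in> Arr C \<Longrightarrow> g \<in> Arr C \<Longrightarrow> Dom C g = Cod C f \<Longrightarrow>
      ar F k (Comp C g f) = Comp (OM F (Cod J k)) (ar F k g) (ar F k f)"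
    and "j \<in> Obj J \<Longrightarrow> a \<in> Obj (OM F j) \<Longrightarrow> ob F (Ident J j) a = a"
    and "j \<in> Obj J \<Longrightarrow> f \<in> Arr (OM F j) \<Longrightarrow> ar F (Ident J j) f = f"
    and "k \<in> Arr J \<Longrightarrow> k' \<in> Arr J \<Longrightarrow> Dom J k' = Cod J k \<Longrightarrow> a \<in> Obj (OM F (Dom J k)) \<Longrightarrow>
      ob F (Comp J k' k) a = ob F k' (ob F k a)"
    and "k \<in> Arr J \<Longrightarrow> k' \<in> Arr J \<Longrightarrow> Dom J k' = Cod J k \<Longrightarrow> f \<in> Arr (OM F (Dom J k)) \<Longrightarrow>
      ar F (Comp J k' k) f = ar F k' (ar F k f)"
proof -
  note f = functor_simps[OF F]
  show "category J" using functor_category[OF F] by simp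
  show "j \<in> Obj J \<Longrightarrow> small_category (OM F j)" using f(1) by simp
  have a: "AM F k \<in> Arr Cat" "src (AM F k) = OM F (Dom J k)" "trg (AM F k) = OM F (Cod J k)"
    if "k \<in> Arr J" for k
    using f(2-4)[OF that] by simp_all
  show fk: "is_functor (OM F (Dom J k)) (OM F (Cod J k)) (und (AM F k))" if "k \<in> Arr J" for k
    using a[OF that] by (simp add: Cat_Arr)
  show "j \<in> Obj J \<Longrightarrow> a \<in> Obj (OM F j) \<Longrightarrow> ob F (Ident J j) a = a"
    "j \<in> Obj J \<Longrightarrow> f \<in> Arr (OM F j) \<Longrightarrow> ar F (Ident J j) f = f"
    by (simp_all add: f(5))
  show "k \<in> Arr J \<Longrightarrow> k' \<in> Arr J \<Longrightarrow> Dom J k' = Cod J k \<Longrightarrow> a \<in> Obj (OM F (Dom J k)) \<Longrightarrow>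
      ob F (Comp J k' k) a = ob F k' (ob F k a)"
    "k \<in> Arr J \<Longrightarrow> k' \<in> Arr J \<Longrightarrow> Dom J k' = Cod J k \<Longrightarrow> f \<in> Arr (OM F (Dom J k)) \<Longrightarrow>
      ar F (Comp J k' k) f = ar F k' (ar F k f)"
    by (simp_all add: f(6) a)
qed (use functor_simps[of "OM F (Dom J k)" "OM F (Cod J k)" "und (AM F k)"] functor_simps[OF F] in
    \<open>auto simp: Cat_Arr\<close>)

text \<open>Strict functoriality can be checked on the objects and arrows of the fibres, because
  functors are extensional and hence equal as soon as their values agree.\<close>

lemma diagI:
  assumes "category I" and "\<And>i. i \<in> Obj I \<Longrightarrow> small_category (X i)"
    and Y: "\<And>r. r \<in> Arr I \<Longrightarrow> is_functor (X (Dom I r)) (X (Cod I r)) (Y r)"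
    and "\<And>i x. i \<in> Obj I \<Longrightarrow> x \<in> Obj (X i) \<Longrightarrow> OM (Y (Ident I i)) x = x"
    and "\<And>i f. i \<in> Obj I \<Longrightarrow> f \<in> Arr (X i) \<Longrightarrow> AM (Y (Ident I i)) f = f"
    and "\<And>r s x. r \<in> Arr I \<Longrightarrow> s \<in> Arr I \<Longrightarrow> Dom I s = Cod I r \<Longrightarrow> x \<in> Obj (X (Dom I r)) \<Longrightarrow>
      OM (Y (Comp I s r)) x = OM (Y s) (OM (Y r) x)"
    and "\<And>r s f. r \<in> Arr I \<Longrightarrow> s \<in> Arr I \<Longrightarrow> Dom I s = Cod I r \<Longrightarrow> f \<in> Arr (X (Dom I r)) \<Longrightarrow>
      AM (Y (Comp I s r)) f = AM (Y s) (AM (Y r) f)"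
  shows "is_functor I Cat \<lparr>OM = \<lambda>i\<in>Obj I. X i, AM = \<lambda>r\<in>Arr I. (X (Dom I r), Y r, X (Cod I r))\<rparr>"
proof (rule functorI)
  fix i assume i: "i \<in> Obj I"
  have "is_functor (X i) (X i) (Y (Ident I i))" using Y[of "Ident I i"] i assms(1) by simp
  from functor_eqI'[OF this, of "id_ftr (X i)"] have "Y (Ident I i) = id_ftr (X i)"
    using assms(4,5)[OF i] by simp
  then show "AM \<lparr>OM = \<lambda>i\<in>Obj I. X i, AM = \<lambda>r\<in>Arr I. (X (Dom I r), Y r, X (Cod I r))\<rparr> (Ident I i) =
    Ident Cat (OM \<lparr>OM = \<lambda>i\<in>Obj I. X i, AM = \<lambda>r\<in>Arr I. (X (Dom I r), Y r, X (Cod I r))\<rparr> i)"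
    using i assms(1) by simp
next
  fix r s assume rs: "r \<in> Arr I" "s \<in> Arr I" "Dom I s = Cod I r"
  have "is_functor (X (Dom I r)) (X (Cod I s)) (Y (Comp I s r))"
    using Y[of "Comp I s r"] rs assms(1) by simp
  from functor_eqI'[OF this, of "comp_ftr (X (Dom I r)) (Y s) (Y r)"]
  have "Y (Comp I s r) = comp_ftr (X (Dom I r)) (Y s) (Y r)"
    using assms(6,7)[OF rs] by simp
  then show "AM \<lparr>OM = \<lambda>i\<in>Obj I. X i, AM = \<lambda>r\<in>Arr I. (X (Dom I r), Y r, X (Cod I r))\<rparr> (Comp I s r) =
    Comp Cat (AM \<lparr>OM = \<lambda>i\<in>Obj I. X i, AM = \<lambda>r\<in>Arr I. (X (Dom I r), Y r, X (Cod I r))\<rparr> s)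
      (AM \<lparr>OM = \<lambda>i\<in>Obj I. X i, AM = \<lambda>r\<in>Arr I. (X (Dom I r), Y r, X (Cod I r))\<rparr> r)"
    using rs assms(1) by simp
qed (use assms in \<open>simp_all add: category_Cat Cat_Arr\<close>)

text \<open>
  Morphisms of diagrams are handled through the family \<open>u\<close> of the functors underlying their
  components: \<open>darr\<close> turns such a family into an arrow of \<open>functor_cat I Cat\<close>.
\<close>

definition dmor :: "'u::universe scat \<Rightarrow> 'u diag \<Rightarrow> ('u \<Rightarrow> 'u sftr) \<Rightarrow> 'u diag \<Rightarrow> bool" where
  "dmor I F u G \<longleftrightarrow> is_functor I Cat F \<and> is_functor I Cat G \<and>
    (\<forall>i\<in>Obj I. is_functor (OM F i) (OM G i) (u i)) \<and>
    (\<forall>r\<in>Arr I. comp_ftr (OM F (Dom I r)) (u (Cod I r)) (und (AM F r)) =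
      comp_ftr (OM F (Dom I r)) (und (AM G r)) (u (Dom I r)))"

definition darr :: "'u::universe scat \<Rightarrow> 'u diag \<Rightarrow> ('u \<Rightarrow> 'u sftr) \<Rightarrow> 'u diag \<Rightarrow> 'u darr" where
  "darr I F u G = (F, \<lambda>i\<in>Obj I. (OM F i, u i, OM G i), G)"

lemma darr_simps [simp]:
  "src (darr I F u G) = F" "trg (darr I F u G) = G"
  "i \<in> Obj I \<Longrightarrow> und (darr I F u G) i = (OM F i, u i, OM G i)"
  by (simp_all add: darr_def)

lemma darr_cong: "(\<And>i. i \<in> Obj I \<Longrightarrow> u i = v i) \<Longrightarrow> darr I F u G = darr I F v G"
  by (simp add: darr_def cong: restrict_cong)

lemma dmorI:
  assumes "is_functor I Cat F" "is_functor I Cat G"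
    and "\<And>i. i \<in> Obj I \<Longrightarrow> is_functor (OM F i) (OM G i) (u i)"
    and "\<And>r x. r \<in> Arr I \<Longrightarrow> x \<in> Obj (OM F (Dom I r)) \<Longrightarrow>
      OM (u (Cod I r)) (ob F r x) = ob G r (OM (u (Dom I r)) x)"
    and "\<And>r f. r \<in> Arr I \<Longrightarrow> f \<in> Arr (OM F (Dom I r)) \<Longrightarrow>
      AM (u (Cod I r)) (ar F r f) = ar G r (AM (u (Dom I r)) f)"
  shows "dmor I F u G"
  unfolding dmor_def using assms by (auto intro!: comp_ftr_eqI)

lemma dmor_functor:
  assumes "dmor I F u G"
  shows "is_functor I Cat F" "is_functor I Cat G"
    "i \<in> Obj I \<Longrightarrow> is_functor (OM F i) (OM G i) (u i)"
  using assms by (auto simp: dmor_def)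

lemma dmor_natural:
  assumes u: "dmor I F u G" and r: "r \<in> Arr I" "Cod I r = i'"
  shows "x \<in> Obj (OM F (Dom I r)) \<Longrightarrow> OM (u i') (ob F r x) = ob G r (OM (u (Dom I r)) x)"
    and "f \<in> Arr (OM F (Dom I r)) \<Longrightarrow> AM (u i') (ar F r f) = ar G r (AM (u (Dom I r)) f)"
proof -
  have e: "comp_ftr (OM F (Dom I r)) (u i') (und (AM F r)) =
      comp_ftr (OM F (Dom I r)) (und (AM G r)) (u (Dom I r))"
    using u r by (auto simp: dmor_def)
  from arg_cong[OF e, of OM] arg_cong[OF e, of AM]
  show "x \<in> Obj (OM F (Dom I r)) \<Longrightarrow> OM (u i') (ob F r x) = ob G r (OM (u (Dom I r)) x)"
    "f \<in> Arr (OM F (Dom I r)) \<Longrightarrow> AM (u i') (ar F r f) = ar G r (AM (u (Dom I r)) f)"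
    by (auto simp: comp_ftr_def restrict_def dest: fun_cong[of _ _ x] fun_cong[of _ _ f] split: if_splits)
qed

lemma dmor_simps:
  assumes u: "dmor I F u G"
  shows "i \<in> Obj I \<Longrightarrow> x \<in> Obj (OM F i) \<Longrightarrow> OM (u i) x \<in> Obj (OM G i)"
    and "i \<in> Obj I \<Longrightarrow> f \<in> Arr (OM F i) \<Longrightarrow> AM (u i) f \<in> Arr (OM G i)"
    and "i \<in> Obj I \<Longrightarrow> f \<in> Arr (OM F i) \<Longrightarrow> Dom (OM G i) (AM (u i) f) = OM (u i) (Dom (OM F i) f)"
    and "i \<in> Obj I \<Longrightarrow> f \<in> Arr (OM F i) \<Longrightarrow> Cod (OM G i) (AM (u i) f) = OM (u i) (Cod (OM F i) f)"
    and "i \<in> Obj I \<Longrightarrow> x \<in> Obj (OM F i) \<Longrightarrow> AM (u i) (Ident (OM F i) x) = Ident (OM G i) (OM (u i) x)"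
    and "i \<in> Obj I \<Longrightarrow> f \<in> Arr (OM F i) \<Longrightarrow> g \<in> Arr (OM F i) \<Longrightarrow>
      Dom (OM F i) g = Cod (OM F i) f \<Longrightarrow>
      AM (u i) (Comp (OM F i) g f) = Comp (OM G i) (AM (u i) g) (AM (u i) f)"
  by (simp_all add: functor_simps[OF dmor_functor(3)[OF u]])

lemma darr_Arr [simp]: "darr I F u G \<in> Arr (functor_cat I Cat) \<longleftrightarrow> dmor I F u G"
proof
  assume d: "dmor I F u G"
  note F = dmor_functor[OF d]
  note s = diag_simps[OF F(1)] diag_simps[OF F(2)]
  have "nat_trans I Cat F G (\<lambda>i\<in>Obj I. (OM F i, u i, OM G i))"
  proof (rule nat_transI)
    fix r assume r: "r \<in> Arr I"
    have "comp_ftr (OM F (Dom I r)) (u (Cod I r)) (und (AM F r)) =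
      comp_ftr (OM F (Dom I r)) (und (AM G r)) (u (Dom I r))"
      using d r by (simp add: dmor_def)
    then show "Comp Cat ((\<lambda>i\<in>Obj I. (OM F i, u i, OM G i)) (Cod I r)) (AM F r) =
         Comp Cat (AM G r) ((\<lambda>i\<in>Obj I. (OM F i, u i, OM G i)) (Dom I r))"
      using r functor_simps(3,4)[OF F(1)] functor_simps(3,4)[OF F(2)] by (simp add: s(1))
  qed (use F s in \<open>simp_all add: Cat_Arr\<close>)
  then show "darr I F u G \<in> Arr (functor_cat I Cat)" by (simp add: functor_cat_Arr darr_def)
next
  assume "darr I F u G \<in> Arr (functor_cat I Cat)"
  then have n: "nat_trans I Cat F G (\<lambda>i\<in>Obj I. (OM F i, u i, OM G i))"
    by (simp add: functor_cat_Arr darr_def)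
  then have F: "is_functor I Cat F" "is_functor I Cat G" by (auto simp: nat_trans_def)
  have "comp_ftr (OM F (Dom I r)) (u (Cod I r)) (und (AM F r)) =
      comp_ftr (OM F (Dom I r)) (und (AM G r)) (u (Dom I r))" if "r \<in> Arr I" for r
    using nat_trans_simps(4)[OF n that] that functor_simps(3,4)[OF F(1) that] diag_simps(1)[OF F(1)]
    by auto
  then show "dmor I F u G"
    using F nat_trans_simps(1)[OF n] by (auto simp: dmor_def Cat_Arr)
qed

text \<open>A natural transformation into \<open>Cat\<close> records source and target both globally
  and in each component. Its typing makes these agree and extensionality fixes the family off
  \<open>Obj I\<close>, so only the underlying functors remain as data.\<close>

lemma functor_cat_ArrE:
  assumes "t \<in> Arr (functor_cat I Cat)"
  obtains F u G where "t = darr I F u G" "dmor I F u G"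
proof -
  have n: "nat_trans I Cat (src t) (trg t) (und t)" using assms by (simp add: functor_cat_Arr)
  have "und t i = (OM (src t) i, und (und t i), OM (trg t) i)" if "i \<in> Obj I" for i
    using nat_trans_simps(1-3)[OF n that] src_und_trg[of "und t i"] by simp
  moreover have "und t \<in> extensional (Obj I)" using n by (simp add: nat_trans_def)
  ultimately have "und t = (\<lambda>i\<in>Obj I. (OM (src t) i, und (und t i), OM (trg t) i))"
    by (intro extensionalityI[of _ "Obj I"]) auto
  then have "t = darr I (src t) (\<lambda>i. und (und t i)) (trg t)"
    unfolding darr_def using src_und_trg[of t] by metis
  then show ?thesis using that assms darr_Arr by metis
qed

lemma darr_Comp:
  "Comp (functor_cat I Cat) (darr I G v H) (darr I F u G) = darr I F (\<lambda>i. comp_ftr (OM F i) (v i) (u i)) H"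
  by (simp add: darr_def cong: restrict_cong)

lemma darr_Ident:
  "Ident (functor_cat I Cat) F = darr I F (\<lambda>i. id_ftr (OM F i)) F"
  by (simp add: darr_def cong: restrict_cong)

lemma dmor_id: "is_functor I Cat F \<Longrightarrow> dmor I F (\<lambda>i. id_ftr (OM F i)) F"
  using category_simps(3)[OF category_functor_cat, of F I Cat]
  by (simp only: functor_cat_simps(1) mem_Collect_eq darr_Ident darr_Arr)

lemma dmor_comp:
  assumes "dmor I F u G" "dmor I G v H"
  shows "dmor I F (\<lambda>i. comp_ftr (OM F i) (v i) (u i)) H"
  using category_simps(6)[OF category_functor_cat, of "darr I F u G" I Cat "darr I G v H"] assms
  by (simp only: darr_Comp darr_Arr functor_cat_simps(2,3) darr_simps)


section \<open>The direct image functor\<close>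

lemma groth_simps [simp]:
  "Dom (groth J F) = asrc" "Cod (groth J F) = atrg"
  "Ident (groth J F) x = mk_arr x (pair (Ident J (pi1 x)) (Ident (OM F (pi1 x)) (pi2 x))) x"
  "Comp (groth J F) t s = mk_arr (asrc s)
    (pair (Comp J (pi1 (aund t)) (pi1 (aund s)))
      (Comp (OM F (pi1 (atrg t))) (pi2 (aund t)) (ar F (pi1 (aund t)) (pi2 (aund s))))) (atrg t)"
  by (simp_all add: groth_def Let_def)

lemma groth_Obj [simp]:
  "x \<in> Obj (groth J F) \<longleftrightarrow> paired x \<and> pi1 x \<in> Obj J \<and> pi2 x \<in> Obj (OM F (pi1 x))"
proof
  assume "paired x \<and> pi1 x \<in> Obj J \<and> pi2 x \<in> Obj (OM F (pi1 x))"
  then have "\<exists>j a. x = pair j a \<and> j \<in> Obj J \<and> a \<in> Obj (OM F j)"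
    by (intro exI[of _ "pi1 x"] exI[of _ "pi2 x"]) simp
  then show "x \<in> Obj (groth J F)" by (simp add: groth_def)
qed (auto simp: groth_def)

lemma groth_Arr [simp]:
  "t \<in> Arr (groth J F) \<longleftrightarrow> tripled t \<and> paired (aund t) \<and>
    asrc t \<in> Obj (groth J F) \<and> atrg t \<in> Obj (groth J F) \<and>
    pi1 (aund t) \<in> Arr J \<and> Dom J (pi1 (aund t)) = pi1 (asrc t) \<and> Cod J (pi1 (aund t)) = pi1 (atrg t) \<and>
    pi2 (aund t) \<in> Arr (OM F (pi1 (atrg t))) \<and>
    Dom (OM F (pi1 (atrg t))) (pi2 (aund t)) = ob F (pi1 (aund t)) (pi2 (asrc t)) \<and>
    Cod (OM F (pi1 (atrg t))) (pi2 (aund t)) = pi2 (atrg t)"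
  (is "_ \<longleftrightarrow> ?P t")
proof
  assume P: "?P t"
  have "\<exists>j a k f j' a'. t = mk_arr (pair j a) (pair k f) (pair j' a') \<and>
       j \<in> Obj J \<and> a \<in> Obj (OM F j) \<and> j' \<in> Obj J \<and> a' \<in> Obj (OM F j') \<and>
               k \<in> hom J j j' \<and> f \<in> hom (OM F j') (ob F k a) a'"
    by (rule exI[of _ "pi1 (asrc t)"], rule exI[of _ "pi2 (asrc t)"],
      rule exI[of _ "pi1 (aund t)"], rule exI[of _ "pi2 (aund t)"],
      rule exI[of _ "pi1 (atrg t)"], rule exI[of _ "pi2 (atrg t)"])
      (use P in \<open>simp add: hom_def\<close>)
  then show "t \<in> Arr (groth J F)" by (simp add: groth_def)
next
  assume "t \<in> Arr (groth J F)"
  then obtain j a k f j' a' where "t = mk_arr (pair j a) (pair k f) (pair j' a')"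
    "j \<in> Obj J" "a \<in> Obj (OM F j)" "j' \<in> Obj J" "a' \<in> Obj (OM F j')"
    "k \<in> hom J j j'" "f \<in> hom (OM F j') (ob F k a) a'"
    by (simp add: groth_def) blast
  then show "?P t" by (simp add: hom_def)
qed

lemma category_groth:
  assumes "is_functor J Cat F"
  shows "category (groth J F)"
proof -
  note [simp] = diag_simps[OF assms]
  show ?thesis by (rule categoryI) auto
qed

text \<open>The second component of an arrow over \<open>k\<close> lies in the fibre over
  \<open>Cod J k\<close>, so the codes range over a dependent union rather than a product;
  \<open>small_UN\<close> covers this.\<close>

lemma small_category_groth:
  assumes "small_category J" "is_functor J Cat F"
  shows "small_category (groth J F)"
proof -
  note [simp] = diag_simps[OF assms(2)]
  have "Obj (groth J F) = (\<Union>j\<in>Obj J. \<Union>a\<in>Obj (OM F j). {pair j a})"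
    by (auto simp: groth_def)
  moreover have "small \<dots>"
  proof (intro small_UN)
    fix j assume "j \<in> Obj J"
    then have "small_category (OM F j)" by simp
    then show "small (Obj (OM F j))" by (simp add: small_category_def)
  qed (use assms in \<open>simp_all add: small_finite small_category_def\<close>)
  ultimately have o: "small (Obj (groth J F))" by simp
  have "Arr (groth J F) \<subseteq> {mk_arr x y z | x y z. x \<in> Obj (groth J F) \<and>
      y \<in> (\<Union>k\<in>Arr J. \<Union>f\<in>Arr (OM F (Cod J k)). {pair k f}) \<and> z \<in> Obj (groth J F)}" (is "_ \<subseteq> ?R")
  proof
    fix t assume "t \<in> Arr (groth J F)"
    then have t: "tripled t" "asrc t \<in> Obj (groth J F)" "atrg t \<in> Obj (groth J F)"
      "paired (aund t)" "pi1 (aund t) \<in> Arr J" "Cod J (pi1 (aund t)) = pi1 (atrg t)"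
      "pi2 (aund t) \<in> Arr (OM F (pi1 (atrg t)))" by simp_all
    then have "aund t \<in> (\<Union>k\<in>Arr J. \<Union>f\<in>Arr (OM F (Cod J k)). {pair k f})"
      by (intro UN_I[of "pi1 (aund t)"] UN_I[of "pi2 (aund t)" "Arr (OM F (Cod J (pi1 (aund t))))"])
        simp_all
    then show "t \<in> ?R"
      using t by (intro CollectI exI[of _ "asrc t"] exI[of _ "aund t"] exI[of _ "atrg t"]) auto
  qed
  moreover have "small (\<Union>k\<in>Arr J. \<Union>f\<in>Arr (OM F (Cod J k)). {pair k f})"
  proof (intro small_UN)
    fix k assume "k \<in> Arr J"
    then have "small_category (OM F (Cod J k))" using assms(1) by simp
    then show "small (Arr (OM F (Cod J k)))" by (simp add: small_category_def)
  qed (use assms in \<open>simp_all add: small_finite small_category_def\<close>)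
  ultimately have "small (Arr (groth J F))"
    using small_subset[OF small_triples[OF o _ o]] by blast
  with o show ?thesis using category_groth[OF assms(2)] by (simp add: small_category_def)
qed

lemma groth_proj_simps [simp]:
  "x \<in> Obj (groth J F) \<Longrightarrow> OM (groth_proj J F) x = pi1 x"
  "t \<in> Arr (groth J F) \<Longrightarrow> AM (groth_proj J F) t = pi1 (aund t)"
  by (simp_all add: groth_proj_def del: groth_Obj groth_Arr)

lemma groth_proj_functor:
  assumes "is_functor J Cat F"
  shows "is_functor (groth J F) J (groth_proj J F)"
proof (rule functorI)
  note [simp] = diag_simps[OF assms] category_groth[OF assms]
  show "OM (groth_proj J F) \<in> extensional (Obj (groth J F))"
    "AM (groth_proj J F) \<in> extensional (Arr (groth J F))"
    by (simp_all add: groth_proj_def)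
qed (use diag_simps[OF assms] category_groth[OF assms] in auto)

section \<open>The diagram of slices of \<integral>F and its functoriality\<close>

lemma shriek_obj_simps [simp]:
  "Dom (shriek_obj J I w F i) = asrc" "Cod (shriek_obj J I w F i) = atrg"
  "Ident (shriek_obj J I w F i) x = mk_arr x (Ident (groth J F) (pi1 x)) x"
  "Comp (shriek_obj J I w F i) t s = mk_arr (asrc s) (Comp (groth J F) (aund t) (aund s)) (atrg t)"
  by (simp_all add: shriek_obj_def)

lemma shriek_Obj [simp]:
  "z \<in> Obj (shriek_obj J I w F i) \<longleftrightarrow> paired z \<and> pi1 z \<in> Obj (groth J F) \<and> pi2 z \<in> Arr I \<and>
    Dom I (pi2 z) = OM w (pi1 (pi1 z)) \<and> Cod I (pi2 z) = i"
  by (auto simp: shriek_obj_def)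

lemma shriek_Arr [simp]:
  "t \<in> Arr (shriek_obj J I w F i) \<longleftrightarrow> tripled t \<and> asrc t \<in> Obj (shriek_obj J I w F i) \<and>
    atrg t \<in> Obj (shriek_obj J I w F i) \<and> tripled (aund t) \<and>
    asrc (aund t) = pi1 (asrc t) \<and> atrg (aund t) = pi1 (atrg t) \<and> paired (aund (aund t)) \<and>
    pi1 (aund (aund t)) \<in> Arr J \<and> Dom J (pi1 (aund (aund t))) = pi1 (pi1 (asrc t)) \<and>
    Cod J (pi1 (aund (aund t))) = pi1 (pi1 (atrg t)) \<and>
    pi2 (aund (aund t)) \<in> Arr (OM F (pi1 (pi1 (atrg t)))) \<and>
    Dom (OM F (pi1 (pi1 (atrg t)))) (pi2 (aund (aund t))) =
      ob F (pi1 (aund (aund t))) (pi2 (pi1 (asrc t))) \<and>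
    Cod (OM F (pi1 (pi1 (atrg t)))) (pi2 (aund (aund t))) = pi2 (pi1 (atrg t)) \<and>
    Comp I (pi2 (atrg t)) (AM w (pi1 (aund (aund t)))) = pi2 (asrc t)"
  by (auto simp: shriek_obj_def)

lemma shriek_obj_base:
  assumes "is_functor J I w" "is_functor J Cat F"
  shows "is_functor (groth J F) I (comp_ftr (groth J F) w (groth_proj J F))"
  using functor_comp[OF groth_proj_functor[OF assms(2)] assms(1)] .

lemma category_shriek_obj:
  assumes "is_functor J I w" "is_functor J Cat F"
  shows "category (shriek_obj J I w F i)"
  unfolding shriek_obj_def by (rule category_slice[OF shriek_obj_base[OF assms]])

lemma small_category_shriek_obj:
  assumes "small_category J" "small_category I" "is_functor J I w" "is_functor J Cat F"
  shows "small_category (shriek_obj J I w F i)"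
  unfolding shriek_obj_def
  by (rule small_category_slice[OF small_category_groth[OF assms(1,4)] assms(2)
    shriek_obj_base[OF assms(3,4)]])

lemma slice_map_simps [simp]:
  "z \<in> Obj S \<Longrightarrow> OM (slice_map S h q) z = pair (OM h (pi1 z)) (q (pi2 z))"
  "t \<in> Arr S \<Longrightarrow> AM (slice_map S h q) t = mk_arr (pair (OM h (pi1 (asrc t))) (q (pi2 (asrc t))))
    (AM h (aund t)) (pair (OM h (pi1 (atrg t))) (q (pi2 (atrg t))))"
  by (simp_all add: slice_map_def Let_def)

lemma slice_map_ext [simp]:
  "OM (slice_map S h q) \<in> extensional (Obj S)" "AM (slice_map S h q) \<in> extensional (Arr S)"
  by (simp_all add: slice_map_def Let_def)

text \<open>\<open>h\<close> acts on the objects and \<open>q\<close> on their structure arrows;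
  \<open>nat\<close> is what takes commuting triangles over \<open>b\<close> to commuting triangles
  over \<open>b'\<close>. Three functors have this form: the transitions of a direct image, its
  action on morphisms of diagrams, and the right leg of the unit.\<close>

lemma slice_map_functor:
  assumes u: "is_functor A B u" and u': "is_functor A' B' u'" and h: "is_functor A A' h"
    and q: "\<And>a p. a \<in> Obj A \<Longrightarrow> p \<in> Arr B \<Longrightarrow> Dom B p = OM u a \<Longrightarrow> Cod B p = b \<Longrightarrow>
      q p \<in> Arr B' \<and> Dom B' (q p) = OM u' (OM h a) \<and> Cod B' (q p) = b'"
    and nat: "\<And>f p. f \<in> Arr A \<Longrightarrow> p \<in> Arr B \<Longrightarrow> Dom B p = OM u (Cod A f) \<Longrightarrow> Cod B p = b \<Longrightarrow>
      Comp B' (q p) (AM u' (AM h f)) = q (Comp B p (AM u f))"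
  shows "is_functor (slice A B u b) (slice A' B' u' b') (slice_map (slice A B u b) h q)"
proof -
  note [simp] = functor_category[OF u] functor_category[OF u'] functor_simps[OF u] functor_simps[OF u']
    functor_simps[OF h] nat
  have [simp]: "q (pi2 z) \<in> Arr B' \<and> Dom B' (q (pi2 z)) = OM u' (OM h (pi1 z)) \<and> Cod B' (q (pi2 z)) = b'"
    if "pi1 z \<in> Obj A" "pi2 z \<in> Arr B" "Dom B (pi2 z) = OM u (pi1 z)" "Cod B (pi2 z) = b" for z
    using q that by blast
  show ?thesis
    by (rule functorI)
      (simp_all add: category_slice[OF u] category_slice[OF u'] Comp_reassoc[where C = B])
qed

lemma slice_map_shriek:
  assumes w: "is_functor J I w" "is_functor J Cat F" and w': "is_functor J' I' w'" "is_functor J' Cat F'"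
    and h: "is_functor (groth J F) (groth J' F') h"
    and q: "\<And>x p. x \<in> Obj (groth J F) \<Longrightarrow> p \<in> Arr I \<Longrightarrow> Dom I p = OM w (pi1 x) \<Longrightarrow> Cod I p = i \<Longrightarrow>
      q p \<in> Arr I' \<and> Dom I' (q p) = OM w' (pi1 (OM h x)) \<and> Cod I' (q p) = i'"
    and nat: "\<And>f p. f \<in> Arr (groth J F) \<Longrightarrow> p \<in> Arr I \<Longrightarrow> Dom I p = OM w (pi1 (atrg f)) \<Longrightarrow>
      Cod I p = i \<Longrightarrow>
      Comp I' (q p) (AM w' (pi1 (aund (AM h f)))) = q (Comp I p (AM w (pi1 (aund f))))"
  shows "is_functor (shriek_obj J I w F i) (shriek_obj J' I' w' F' i')
    (slice_map (shriek_obj J I w F i) h q)"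
proof -
  note h' = functor_simps[OF h]
  have "atrg f \<in> Obj (groth J F)" if "f \<in> Arr (groth J F)" for f using that by simp
  then show ?thesis
    unfolding shriek_obj_def
    by (intro slice_map_functor[OF shriek_obj_base[OF w] shriek_obj_base[OF w'] h])
      (use h' q nat in \<open>simp_all del: groth_Obj groth_Arr\<close>)
qed

lemma shriek_diag_simps [simp]:
  "i \<in> Obj I \<Longrightarrow> OM (shriek_diag J I w F) i = shriek_obj J I w F i"
  "r \<in> Arr I \<Longrightarrow> und (AM (shriek_diag J I w F) r) =
    slice_map (shriek_obj J I w F (Dom I r)) (id_ftr (groth J F)) (Comp I r)"
  by (simp_all add: shriek_diag_def)

lemma shriek_diag_functor:
  assumes "small_category J" "small_category I" and w: "is_functor J I w" and F: "is_functor J Cat F"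
  shows "is_functor I Cat (shriek_diag J I w F)"
proof -
  note [simp] = diag_simps[OF F] functor_simps[OF w] assms(2)
    small_category_shriek_obj[OF assms] category_groth[OF F]
  show ?thesis
    unfolding shriek_diag_def
  proof (rule diagI)
    fix r assume "r \<in> Arr I"
    then show "is_functor (shriek_obj J I w F (Dom I r)) (shriek_obj J I w F (Cod I r))
      (slice_map (shriek_obj J I w F (Dom I r)) (id_ftr (groth J F)) (Comp I r))"
      by (intro slice_map_shriek[OF w F w F functor_id]) simp_all
  qed (auto)
qed

lemma groth_map_simps:
  assumes "t = darr J F u G"
  shows "x \<in> Obj (groth J F) \<Longrightarrow> OM (groth_map J F G (und t)) x = pair (pi1 x) (OM (u (pi1 x)) (pi2 x))"
    and "f \<in> Arr (groth J F) \<Longrightarrow> AM (groth_map J F G (und t)) f =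
      mk_arr (pair (pi1 (asrc f)) (OM (u (pi1 (asrc f))) (pi2 (asrc f))))
        (pair (pi1 (aund f)) (AM (u (pi1 (atrg f))) (pi2 (aund f))))
        (pair (pi1 (atrg f)) (OM (u (pi1 (atrg f))) (pi2 (atrg f))))"
  by (simp_all add: groth_map_def Let_def assms)

text \<open>Naturality of \<open>u\<close> is used strictly: for \<open>f\<close> from F(k)(a) to
  a', the image of \<open>f\<close> must start at G(k)(u(a)), and it starts at u(F(k)(a)).\<close>

lemma groth_map_functor:
  assumes u: "dmor J F u G"
  shows "is_functor (groth J F) (groth J G) (groth_map J F G (und (darr J F u G)))"
proof -
  note F = dmor_functor[OF u]
  note [simp] = diag_simps[OF F(1)] diag_simps[OF F(2)] dmor_simps[OF u] dmor_natural[OF u]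
    groth_map_simps[OF refl]
  show ?thesis
  proof (rule functorI)
    show "OM (groth_map J F G (und (darr J F u G))) \<in> extensional (Obj (groth J F))"
      "AM (groth_map J F G (und (darr J F u G))) \<in> extensional (Arr (groth J F))"
      by (simp_all add: groth_map_def Let_def)
  qed (auto simp: category_groth[OF F(1)] category_groth[OF F(2)])
qed

abbreviation shriek_map :: "'u::universe scat \<Rightarrow> 'u scat \<Rightarrow> 'u sftr \<Rightarrow> 'u diag \<Rightarrow> ('u \<Rightarrow> 'u sftr) \<Rightarrow>
  'u diag \<Rightarrow> 'u \<Rightarrow> 'u sftr" where
  "shriek_map J I w F u G i \<equiv>
    slice_map (shriek_obj J I w F i) (groth_map J F G (und (darr J F u G))) (\<lambda>p. p)"

lemma shriek_map_functor:
  assumes w: "is_functor J I w" and u: "dmor J F u G"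
  shows "is_functor (shriek_obj J I w F i) (shriek_obj J I w G i) (shriek_map J I w F u G i)"
  by (rule slice_map_shriek[OF w dmor_functor(1)[OF u] w dmor_functor(2)[OF u] groth_map_functor[OF u]])
    (simp_all add: groth_map_simps[OF refl])

text \<open>The two actions touch different coordinates: transition functors compose the structure
  arrow with an arrow of \<open>I\<close>, whereas \<open>shriek_map\<close> alters only the part in
  \<integral>F. So they commute.\<close>

lemma shriek_map_dmor:
  assumes J: "small_category J" "small_category I" and w: "is_functor J I w" and u: "dmor J F u G"
  shows "dmor I (shriek_diag J I w F) (shriek_map J I w F u G) (shriek_diag J I w G)"
proof -
  note F = dmor_functor[OF u]
  note [simp] = diag_simps[OF F(1)] diag_simps[OF F(2)] dmor_simps[OF u] dmor_natural[OF u]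
    groth_map_simps[OF refl] functor_simps[OF w] J category_groth[OF F(1)] category_groth[OF F(2)]
  show ?thesis
    by (rule dmorI) (simp_all add: shriek_diag_functor[OF J w F(1)] shriek_diag_functor[OF J w F(2)]
      shriek_map_functor[OF w u])
qed

lemma shriek_OM: "is_functor J Cat F \<Longrightarrow> OM (shriek J I w) F = shriek_diag J I w F"
  by (simp add: shriek_def)

lemma shriek_AM:
  assumes "is_functor J I w" "dmor J F u G"
  shows "AM (shriek J I w) (darr J F u G) =
    darr I (shriek_diag J I w F) (shriek_map J I w F u G) (shriek_diag J I w G)"
  unfolding darr_def[of I] using assms by (simp add: shriek_def cong: restrict_cong)

lemma shriek_functor:
  assumes J: "small_category J" "small_category I" and w: "is_functor J I w"
  shows "is_functor (functor_cat J Cat) (functor_cat I Cat) (shriek J I w)"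
proof (rule functorI)
  fix t :: "'a darr" assume "t \<in> Arr (functor_cat J Cat)"
  then obtain F u G where t: "t = darr J F u G" and u: "dmor J F u G" by (rule functor_cat_ArrE)
  show "AM (shriek J I w) t \<in> Arr (functor_cat I Cat) \<and>
    Dom (functor_cat I Cat) (AM (shriek J I w) t) = OM (shriek J I w) (Dom (functor_cat J Cat) t) \<and>
    Cod (functor_cat I Cat) (AM (shriek J I w) t) = OM (shriek J I w) (Cod (functor_cat J Cat) t)"
    using dmor_functor[OF u] by (simp add: t shriek_AM[OF w u] shriek_OM shriek_map_dmor[OF J w u])
next
  fix F :: "'a diag" assume "F \<in> Obj (functor_cat J Cat)"
  then have F: "is_functor J Cat F" by simp
  note [simp] = diag_simps[OF F] groth_map_simps[OF refl] functor_simps[OF w] J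
  have "shriek_map J I w F (\<lambda>j. id_ftr (OM F j)) F i = id_ftr (OM (shriek_diag J I w F) i)"
    if "i \<in> Obj I" for i
    by (rule functor_eqI'[OF shriek_map_functor[OF w dmor_id[OF F]]]) (use that in \<open>simp_all\<close>)
  then show "AM (shriek J I w) (Ident (functor_cat J Cat) F) =
    Ident (functor_cat I Cat) (OM (shriek J I w) F)"
    using shriek_AM[OF w dmor_id[OF F]] shriek_OM[OF F, of I w]
    by (simp only: darr_Ident) (rule darr_cong)
next
  fix s t :: "'a darr" assume st: "s \<in> Arr (functor_cat J Cat)" "t \<in> Arr (functor_cat J Cat)"
    "Dom (functor_cat J Cat) t = Cod (functor_cat J Cat) s"
  from st(1) obtain F u G where s: "s = darr J F u G" and u: "dmor J F u G"
    by (rule functor_cat_ArrE)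
  from st(2) obtain G' v H where "t = darr J G' v H" "dmor J G' v H" by (rule functor_cat_ArrE)
  with st(3) s have t: "t = darr J G v H" and v: "dmor J G v H" by simp_all
  note F = dmor_functor[OF u] and H = dmor_functor(2)[OF v]
  note [simp] = diag_simps[OF F(1)] diag_simps[OF F(2)] diag_simps[OF H] dmor_simps[OF u]
    dmor_natural[OF u] groth_map_simps[OF refl] functor_simps[OF w] J
  note vu = dmor_comp[OF u v]
  have "shriek_map J I w F (\<lambda>j. comp_ftr (OM F j) (v j) (u j)) H i =
    comp_ftr (OM (shriek_diag J I w F) i) (shriek_map J I w G v H i) (shriek_map J I w F u G i)"
    if "i \<in> Obj I" for i
    by (rule functor_eqI'[OF shriek_map_functor[OF w vu]]) (use that in \<open>simp_all\<close>)
  then show "AM (shriek J I w) (Comp (functor_cat J Cat) t s) =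
    Comp (functor_cat I Cat) (AM (shriek J I w) t) (AM (shriek J I w) s)"
    unfolding s t darr_Comp shriek_AM[OF w u] shriek_AM[OF w v] shriek_AM[OF w vu]
    by (rule darr_cong)
qed (use shriek_diag_functor[OF J w] in \<open>simp_all add: category_functor_cat shriek_def\<close>)


section \<open>Counit and unit before localization\<close>

lemma pullback_OM: "is_functor I Cat F \<Longrightarrow> OM (pullback J I w) F = comp_ftr J F w"
  by (simp add: pullback_def)

lemma pullback_AM:
  assumes "is_functor J I w" "dmor I F u G"
  shows "AM (pullback J I w) (darr I F u G) =
    darr J (comp_ftr J F w) (\<lambda>j. u (OM w j)) (comp_ftr J G w)"
  unfolding darr_def[of J] using assms
  by (simp add: pullback_def functor_simps[OF assms(1)] cong: restrict_cong)

lemma pullback_dmor: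
  assumes w: "is_functor J I w" and u: "dmor I F u G"
  shows "dmor J (comp_ftr J F w) (\<lambda>j. u (OM w j)) (comp_ftr J G w)"
proof -
  note F = dmor_functor[OF u]
  note [simp] = functor_category[OF w] functor_simps[OF w] dmor_simps[OF u] dmor_natural[OF u]
  show ?thesis
    by (rule dmorI) (simp_all add: F functor_comp[OF w])
qed

lemma pullback_functor:
  assumes w: "is_functor J I w"
  shows "is_functor (functor_cat I Cat) (functor_cat J Cat) (pullback J I w)"
proof (rule functorI)
  fix t :: "'a darr" assume "t \<in> Arr (functor_cat I Cat)"
  then obtain F u G where t: "t = darr I F u G" and u: "dmor I F u G" by (rule functor_cat_ArrE)
  show "AM (pullback J I w) t \<in> Arr (functor_cat J Cat) \<and>
    Dom (functor_cat J Cat) (AM (pullback J I w) t) = OM (pullback J I w) (Dom (functor_cat I Cat) t) \<and>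
    Cod (functor_cat J Cat) (AM (pullback J I w) t) = OM (pullback J I w) (Cod (functor_cat I Cat) t)"
    using dmor_functor[OF u] by (simp add: t pullback_AM[OF w u] pullback_OM pullback_dmor[OF w u])
next
  fix F :: "'a diag" assume "F \<in> Obj (functor_cat I Cat)"
  then have F: "is_functor I Cat F" by simp
  show "AM (pullback J I w) (Ident (functor_cat I Cat) F) =
    Ident (functor_cat J Cat) (OM (pullback J I w) F)"
    unfolding darr_Ident pullback_AM[OF w dmor_id[OF F]] pullback_OM[OF F] by (rule darr_cong) simp
next
  fix s t :: "'a darr" assume st: "s \<in> Arr (functor_cat I Cat)" "t \<in> Arr (functor_cat I Cat)"
    "Dom (functor_cat I Cat) t = Cod (functor_cat I Cat) s"
  from st(1) obtain F u G where s: "s = darr I F u G" and u: "dmor I F u G"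
    by (rule functor_cat_ArrE)
  from st(2) obtain G' v H where "t = darr I G' v H" "dmor I G' v H" by (rule functor_cat_ArrE)
  with st(3) s have t: "t = darr I G v H" and v: "dmor I G v H" by simp_all
  show "AM (pullback J I w) (Comp (functor_cat I Cat) t s) =
    Comp (functor_cat J Cat) (AM (pullback J I w) t) (AM (pullback J I w) s)"
    unfolding s t darr_Comp pullback_AM[OF w u] pullback_AM[OF w v] pullback_AM[OF w dmor_comp[OF u v]]
    by (rule darr_cong) simp
qed (simp_all add: category_functor_cat pullback_def functor_comp[OF w])

section \<open>The counit\<close>

definition counit_map :: "'u::universe scat \<Rightarrow> 'u scat \<Rightarrow> 'u sftr \<Rightarrow> 'u diag \<Rightarrow> 'u \<Rightarrow> 'u sftr" where
  \<comment> \<open>\<open>((j, a), p) \<mapsto> G(p)(a)\<close>, for \<open>p\<close> from \<open>w(j)\<close> to \<open>i\<close> and \<open>a\<close> an object of \<open>G(w(j))\<close>\<close>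
  "counit_map J I w G i =
     \<lparr>OM = \<lambda>z\<in>Obj (shriek_obj J I w (comp_ftr J G w) i). ob G (pi2 z) (pi2 (pi1 z)),
      AM = \<lambda>t\<in>Arr (shriek_obj J I w (comp_ftr J G w) i). ar G (pi2 (atrg t)) (pi2 (aund (aund t)))\<rparr>"

lemma counit_map_simps [simp]:
  "z \<in> Obj (shriek_obj J I w (comp_ftr J G w) i) \<Longrightarrow>
    OM (counit_map J I w G i) z = ob G (pi2 z) (pi2 (pi1 z))"
  "t \<in> Arr (shriek_obj J I w (comp_ftr J G w) i) \<Longrightarrow>
    AM (counit_map J I w G i) t = ar G (pi2 (atrg t)) (pi2 (aund (aund t)))"
  by (simp_all add: counit_map_def del: shriek_Obj shriek_Arr)

lemma counit_map_ext [simp]: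
  "OM (counit_map J I w G i) \<in> extensional (Obj (shriek_obj J I w (comp_ftr J G w) i))"
  "AM (counit_map J I w G i) \<in> extensional (Arr (shriek_obj J I w (comp_ftr J G w) i))"
  by (simp_all add: counit_map_def)

text \<open>An arrow (k, f) from ((j, a), p) to ((j', a'), p') satisfies p' w(k) = p. Hence G(p) =
  G(p') G(w(k)), and G(p')(f) runs from G(p)(a) to G(p')(a').\<close>

lemma counit_map_functor:
  assumes w: "is_functor J I w" and G: "is_functor I Cat G" and i: "i \<in> Obj I"
  shows "is_functor (shriek_obj J I w (comp_ftr J G w) i) (OM G i) (counit_map J I w G i)"
proof -
  note wG = functor_comp[OF w G]
  \<comment> \<open>Functoriality of \<open>G\<close> is oriented so that successive transports
    merge into the transport along a composite; the triangle over \<open>i\<close> can then be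
    applied to that composite.\<close>
  note [simp] = functor_category[OF w] functor_simps[OF w] i category_shriek_obj[OF w wG]
    diag_simps(1-11)[OF G] diag_simps(12,13)[OF G, symmetric] Comp_reassoc[where C = I]
  show ?thesis by (rule functorI) auto
qed

lemma counit_map_dmor:
  assumes J: "small_category J" "small_category I" and w: "is_functor J I w" and G: "is_functor I Cat G"
  shows "dmor I (shriek_diag J I w (comp_ftr J G w)) (counit_map J I w G) G"
proof -
  note wG = functor_comp[OF w G]
  note [simp] = functor_category[OF w] functor_simps[OF w] category_shriek_obj[OF w wG]
    diag_simps(1-11)[OF G] diag_simps(12,13)[OF G, symmetric]
  show ?thesis
    by (rule dmorI) (auto simp: shriek_diag_functor[OF J w wG] G counit_map_functor[OF w G])
qed

text \<open>One composite sends ((j, a), p) to H(p)(u(a)), the other to u(G(p)(a)); naturality of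
  \<open>u\<close> along \<open>p\<close> identifies them.\<close>

lemma counit_map_natural:
  assumes w: "is_functor J I w" and u: "dmor I G u H" and i: "i \<in> Obj I"
  shows "comp_ftr (shriek_obj J I w (comp_ftr J G w) i) (counit_map J I w H i)
      (shriek_map J I w (comp_ftr J G w) (\<lambda>j. u (OM w j)) (comp_ftr J H w) i) =
    comp_ftr (shriek_obj J I w (comp_ftr J G w) i) (u i) (counit_map J I w G i)"
proof -
  note F = dmor_functor[OF u]
  note [simp] = diag_simps[OF F(1)] diag_simps[OF F(2)] dmor_simps[OF u] dmor_natural[OF u]
    groth_map_simps[OF refl] functor_category[OF w] functor_simps[OF w] i
  show ?thesis by (rule comp_ftr_eqI) auto
qed

definition counit :: "'u::universe scat \<Rightarrow> 'u scat \<Rightarrow> 'u sftr \<Rightarrow> 'u diag \<Rightarrow> 'u darr" where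
  "counit J I w = (\<lambda>G\<in>Obj (functor_cat I Cat).
    darr I (shriek_diag J I w (comp_ftr J G w)) (counit_map J I w G) G)"

lemma counit_nat_trans:
  assumes J: "small_category J" "small_category I" and w: "is_functor J I w"
  shows "nat_trans (functor_cat I Cat) (functor_cat I Cat)
    (comp_ftr (functor_cat I Cat) (shriek J I w) (pullback J I w)) (id_ftr (functor_cat I Cat))
    (counit J I w)"
proof (rule nat_transI)
  fix t :: "'a darr" assume t: "t \<in> Arr (functor_cat I Cat)"
  then obtain F u G where e: "t = darr I F u G" and u: "dmor I F u G" by (rule functor_cat_ArrE)
  note F = dmor_functor[OF u]
  show "Comp (functor_cat I Cat) (counit J I w (Cod (functor_cat I Cat) t))
     (AM (comp_ftr (functor_cat I Cat) (shriek J I w) (pullback J I w)) t) =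
    Comp (functor_cat I Cat) (AM (id_ftr (functor_cat I Cat)) t) (counit J I w (Dom (functor_cat I Cat) t))"
    unfolding comp_ftr_simps(2)[OF t] id_ftr_simps(2)[OF t]
    unfolding e pullback_AM[OF w u] shriek_AM[OF w pullback_dmor[OF w u]]
    unfolding counit_def
    using counit_map_natural[OF w u]
    by (simp add: F darr_Comp del: functor_cat_simps(5) cong: darr_cong)
qed (use J in \<open>simp_all add: counit_def functor_id category_functor_cat
    functor_comp[OF pullback_functor[OF w] shriek_functor[OF J w]] pullback_OM shriek_OM
    functor_comp[OF w] counit_map_dmor[OF J w]\<close>)

text \<open>Extensionality makes this an equality rather than an isomorphism, so that the counit for
  the identity of \<open>J\<close> has \<open>shriek J J (id_ftr J)\<close> itself as its source
  functor.\<close>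

lemma pullback_id:
  assumes "category J"
  shows "pullback J J (id_ftr J) = id_ftr (functor_cat J Cat)"
proof (rule functor_eqI'[OF pullback_functor[OF functor_id[OF assms]]])
  fix F :: "'a diag" assume "F \<in> Obj (functor_cat J Cat)"
  then have F: "is_functor J Cat F" by simp
  then show "OM (pullback J J (id_ftr J)) F = OM (id_ftr (functor_cat J Cat)) F"
    by (simp add: pullback_OM[OF F] comp_ftr_id(1)[OF F])
next
  fix t :: "'a darr" assume t: "t \<in> Arr (functor_cat J Cat)"
  then obtain F u G where e: "t = darr J F u G" and u: "dmor J F u G" by (rule functor_cat_ArrE)
  note F = dmor_functor[OF u]
  show "AM (pullback J J (id_ftr J)) t = AM (id_ftr (functor_cat J Cat)) t"
    unfolding id_ftr_simps(2)[OF t] unfolding e pullback_AM[OF functor_id[OF assms] u]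
      comp_ftr_id(1)[OF F(1)] comp_ftr_id(1)[OF F(2)]
    by (rule darr_cong) simp
qed (rule id_ftr_ext)+

text \<open>
  For the identity functor of \<open>J\<close> the counit is the componentwise aspheric replacement
  \<open>((j', a), p) \<mapsto> F(p)(a)\<close> of a diagram \<open>F\<close>.
\<close>

lemma counit_id_nat_trans:
  assumes J: "small_category J"
  shows "nat_trans (functor_cat J Cat) (functor_cat J Cat) (shriek J J (id_ftr J))
    (id_ftr (functor_cat J Cat)) (counit J J (id_ftr J))"
  using counit_nat_trans[OF J J functor_id] J
    comp_ftr_id(1)[OF shriek_functor[OF J J functor_id]]
  by (simp add: pullback_id)

section \<open>The right leg of the unit fraction\<close>

lemma functor_Comp_eq:
  assumes "is_functor A B F" "Comp A g f = h" "f \<in> Arr A" "g \<in> Arr A" "Dom A g = Cod A f"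
  shows "Comp B (AM F g) (AM F f) = AM F h"
  using functor_simps(6)[OF assms(1,3-5)] assms(2) by simp

text \<open>The functor from (\<integral>F)/j to (\<integral>F)/w(j) that turns a structure arrow p
  into w(p). Along a \<mapsto> ((j, a), id) it restricts to the lax unit; on the whole slice it is
  strictly natural in \<open>j\<close>, because w preserves composition.\<close>

definition unit_map :: "'u::universe scat \<Rightarrow> 'u sftr \<Rightarrow> 'u diag \<Rightarrow> 'u \<Rightarrow> 'u sftr" where
  "unit_map J w F j = slice_map (shriek_obj J J (id_ftr J) F j) (id_ftr (groth J F)) (AM w)"

lemma unit_map_functor:
  assumes w: "is_functor J I w" and F: "is_functor J Cat F" and j: "j \<in> Obj J"
  shows "is_functor (shriek_obj J J (id_ftr J) F j) (shriek_obj J I w F (OM w j)) (unit_map J w F j)"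
proof -
  note [simp] = functor_category[OF w] functor_simps[OF w] j diag_simps[OF F]
  show ?thesis
    unfolding unit_map_def
    by (rule slice_map_shriek[OF functor_id F w F functor_id]) (simp_all add: category_groth[OF F])
qed

lemma unit_map_dmor:
  assumes J: "small_category J" "small_category I" and w: "is_functor J I w" and F: "is_functor J Cat F"
  shows "dmor J (shriek_diag J J (id_ftr J) F) (unit_map J w F) (comp_ftr J (shriek_diag J I w F) w)"
proof -
  have id: "is_functor J J (id_ftr J)" using J by (simp add: functor_id)
  \<comment> \<open>\<open>functor_simps(6)\<close> is replaced by \<open>functor_Comp_eq\<close>,
    which rewrites in the opposite direction: the image of a commuting triangle collapses to a
    single arrow instead of being expanded.\<close>
  note [simp] = functor_category[OF w] functor_simps(1-5)[OF w] diag_simps[OF F]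
    functor_Comp_eq[OF w]
  show ?thesis
    by (rule dmorI) (use unit_map_functor[OF w F] in \<open>auto simp: shriek_diag_functor[OF J(1,1) id F]
      functor_comp[OF w shriek_diag_functor[OF J w F]] unit_map_def\<close>)
qed

definition kappa :: "'u::universe scat \<Rightarrow> 'u scat \<Rightarrow> 'u sftr \<Rightarrow> 'u diag \<Rightarrow> 'u darr" where
  "kappa J I w = (\<lambda>F\<in>Obj (functor_cat J Cat).
    darr J (shriek_diag J J (id_ftr J) F) (unit_map J w F) (comp_ftr J (shriek_diag J I w F) w))"

lemma unit_map_natural:
  assumes w: "is_functor J I w" and u: "dmor J F u G" and j: "j \<in> Obj J"
  shows "comp_ftr (shriek_obj J J (id_ftr J) F j) (unit_map J w G j)
      (shriek_map J J (id_ftr J) F u G j) =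
    comp_ftr (shriek_obj J J (id_ftr J) F j) (shriek_map J I w F u G (OM w j)) (unit_map J w F j)"
proof -
  note F = dmor_functor[OF u]
  note [simp] = diag_simps[OF F(1)] diag_simps[OF F(2)] dmor_simps[OF u] dmor_natural[OF u]
    groth_map_simps[OF refl] functor_category[OF w] functor_simps(1-5)[OF w] j functor_Comp_eq[OF w]
  show ?thesis unfolding unit_map_def by (rule comp_ftr_eqI) auto
qed

lemma kappa_nat_trans:
  assumes J: "small_category J" "small_category I" and w: "is_functor J I w"
  shows "nat_trans (functor_cat J Cat) (functor_cat J Cat) (shriek J J (id_ftr J))
    (comp_ftr (functor_cat J Cat) (pullback J I w) (shriek J I w)) (kappa J I w)"
proof (rule nat_transI)
  have id: "is_functor J J (id_ftr J)" using J by (simp add: functor_id)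
  show "is_functor (functor_cat J Cat) (functor_cat J Cat) (shriek J J (id_ftr J))"
    by (rule shriek_functor[OF J(1,1) id])
  fix t :: "'a darr" assume t: "t \<in> Arr (functor_cat J Cat)"
  then obtain F u G where e: "t = darr J F u G" and u: "dmor J F u G" by (rule functor_cat_ArrE)
  note F = dmor_functor[OF u]
  show "Comp (functor_cat J Cat) (kappa J I w (Cod (functor_cat J Cat) t)) (AM (shriek J J (id_ftr J)) t) =
    Comp (functor_cat J Cat) (AM (comp_ftr (functor_cat J Cat) (pullback J I w) (shriek J I w)) t)
      (kappa J I w (Dom (functor_cat J Cat) t))"
    unfolding comp_ftr_simps(2)[OF t]
    unfolding e pullback_AM[OF w shriek_map_dmor[OF J w u]] shriek_AM[OF w u] shriek_AM[OF id u]
    unfolding kappa_def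
    using unit_map_natural[OF w u]
    by (simp add: F darr_Comp del: functor_cat_simps(5) cong: darr_cong)
qed (use J in \<open>simp_all add: kappa_def functor_comp[OF shriek_functor[OF J w] pullback_functor[OF w]]
    pullback_OM shriek_OM shriek_diag_functor[OF J w] unit_map_dmor[OF J w]\<close>)

text \<open>On ((j', a), p) the unit leg produces the structure arrow w(p), and the counit then
  transports \<open>a\<close> by G(w(p)). This is transport along \<open>p\<close> in the restricted
  diagram, that is, the counit for the identity of \<open>J\<close>. It is the triangle that holds
  strictly.\<close>

lemma counit_kappa:
  assumes J: "small_category J" "small_category I" and w: "is_functor J I w" and G: "is_functor I Cat G"
  shows "Comp (functor_cat J Cat) (AM (pullback J I w) (counit J I w G)) (kappa J I w (comp_ftr J G w)) =
    counit J J (id_ftr J) (comp_ftr J G w)"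
proof -
  note wG = functor_comp[OF w G]
  note [simp] = functor_category[OF w] functor_simps(1-5)[OF w] diag_simps[OF G]
    functor_Comp_eq[OF w]
  have "comp_ftr (shriek_obj J J (id_ftr J) (comp_ftr J G w) j) (counit_map J I w G (OM w j))
      (unit_map J w (comp_ftr J G w) j) = counit_map J J (id_ftr J) (comp_ftr J G w) j"
    if "j \<in> Obj J" for j
    unfolding unit_map_def
    by (rule functor_eqI[of _ "Obj (shriek_obj J J (id_ftr J) (comp_ftr J G w) j)" _
        "Arr (shriek_obj J J (id_ftr J) (comp_ftr J G w) j)"])
      (use that counit_map_ext[of J J "id_ftr J" "comp_ftr J G w" j]
        counit_map_simps[of _ J J "id_ftr J" "comp_ftr J G w" j] in
       \<open>auto simp: comp_ftr_id(1)[OF wG]\<close>)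
  then show ?thesis
    using pullback_AM[OF w counit_map_dmor[OF J w G]]
    by (simp add: counit_def kappa_def G wG darr_Comp del: functor_cat_simps(5) cong: darr_cong)
      (simp add: comp_ftr_id(1)[OF wG])
qed


section \<open>Asphericity\<close>

text \<open>The hypothesis says that \<open>u\<close> has a right adjoint.\<close>

lemma aspheric_of_universal_arrows:
  assumes A: "right_asphericity_structure \<A>" "small_category A" "small_category B" "is_functor A B u"
    and r: "\<And>b. b \<in> Obj B \<Longrightarrow> r b \<in> Obj A"
    and e: "\<And>b. b \<in> Obj B \<Longrightarrow> e b \<in> Arr B \<and> Dom B (e b) = OM u (r b) \<and> Cod B (e b) = b"
    and g: "\<And>b a p. b \<in> Obj B \<Longrightarrow> a \<in> Obj A \<Longrightarrow> p \<in> Arr B \<Longrightarrow> Dom B p = OM u a \<Longrightarrow> Cod B p = b \<Longrightarrow>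
      g b a p \<in> Arr A \<and> Dom A (g b a p) = a \<and> Cod A (g b a p) = r b \<and>
      Comp B (e b) (AM u (g b a p)) = p"
    and unique: "\<And>b f. b \<in> Obj B \<Longrightarrow> f \<in> Arr A \<Longrightarrow> Cod A f = r b \<Longrightarrow>
      f = g b (Dom A f) (Comp B (e b) (AM u f))"
  shows "aspheric \<A> A B u"
proof (rule final_object_slice_aspheric[OF A])
  fix b assume b: "b \<in> Obj B"
  have "final_object (slice A B u b) (pair (r b) (e b))"
    unfolding final_object_def
  proof (intro conjI ballI)
    fix z assume "z \<in> Obj (slice A B u b)"
    then have z: "paired z" "pi1 z \<in> Obj A" "pi2 z \<in> Arr B" "Dom B (pi2 z) = OM u (pi1 z)"
      "Cod B (pi2 z) = b" by simp_all
    show "\<exists>!t. t \<in> hom (slice A B u b) z (pair (r b) (e b))"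
    proof (rule ex1I[of _ "mk_arr z (g b (pi1 z) (pi2 z)) (pair (r b) (e b))"])
      show "mk_arr z (g b (pi1 z) (pi2 z)) (pair (r b) (e b)) \<in>
          hom (slice A B u b) z (pair (r b) (e b))"
        using z r[OF b] e[OF b] g[OF b z(2-5)] by (simp add: hom_def)
      fix t assume "t \<in> hom (slice A B u b) z (pair (r b) (e b))"
      then have t0: "t \<in> Arr (slice A B u b)" "asrc t = z" "atrg t = pair (r b) (e b)"
        by (simp_all add: hom_def del: slice_Arr)
      have t1: "tripled t" "aund t \<in> Arr A" "Dom A (aund t) = pi1 (asrc t)"
        "Cod A (aund t) = pi1 (atrg t)" "Comp B (pi2 (atrg t)) (AM u (aund t)) = pi2 (asrc t)"
        using t0(1) by simp_all
      have t: "tripled t" "asrc t = z" "atrg t = pair (r b) (e b)" "aund t \<in> Arr A"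
        "Dom A (aund t) = pi1 z" "Cod A (aund t) = r b" "Comp B (e b) (AM u (aund t)) = pi2 z"
        using t1 t0(2,3) by simp_all
      then show "t = mk_arr z (g b (pi1 z) (pi2 z)) (pair (r b) (e b))"
        using unique[OF b t(4,6)] by (metis tripled_def)
    qed
  qed (use r[OF b] e[OF b] in simp)
  then show "small_category (slice A B u b) \<and> (\<exists>t. final_object (slice A B u b) t)"
    using small_category_slice[OF A(2-4)] by blast
qed

lemma aspheric_source:
  assumes "right_asphericity_structure \<A>" "aspheric \<A> A B u" "B \<in> \<A>"
  shows "A \<in> \<A>"
  using assms unfolding right_asphericity_structure_def aspheric_def by blast

text \<open>The right adjoint sends \<open>b\<close> to ((j, b), id). An arrow from ((j', a), q) to
  this object is forced to have base component \<open>q\<close>, so it amounts to an arrow from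
  F(q)(a) to \<open>b\<close>.\<close>

lemma counit_id_aspheric:
  assumes A: "right_asphericity_structure \<A>" and J: "small_category J"
    and F: "is_functor J Cat F" and j: "j \<in> Obj J"
  shows "aspheric \<A> (shriek_obj J J (id_ftr J) F j) (OM F j) (counit_map J J (id_ftr J) F j)"
proof -
  have id: "is_functor J J (id_ftr J)" using J by (simp add: functor_id)
  note e = comp_ftr_id(1)[OF F]
  note [simp] = counit_map_simps[of _ J J "id_ftr J" F, unfolded e] diag_simps[OF F] j J
  have fn: "is_functor (shriek_obj J J (id_ftr J) F j) (OM F j) (counit_map J J (id_ftr J) F j)"
    using counit_map_functor[OF id F j] by (simp only: e)
  show ?thesis
  proof (rule aspheric_of_universal_arrows[OF A small_category_shriek_obj[OF J J id F] _ fn])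
    let ?S = "shriek_obj J J (id_ftr J) F j"
    \<comment> \<open>As F(id)(b) equals \<open>b\<close> strictly, the universal arrow at
      \<open>b\<close> can be the identity of \<open>b\<close>.\<close>
    let ?r = "\<lambda>b. pair (pair j b) (Ident J j)"
    let ?g = "\<lambda>b z p. mk_arr z (mk_arr (pi1 z) (pair (pi2 z) p) (pair j b)) (?r b)"
    show "small_category (OM F j)" by simp
    fix b assume b [simp]: "b \<in> Obj (OM F j)"
    show "?r b \<in> Obj ?S" by simp
    show "Ident (OM F j) b \<in> Arr (OM F j) \<and>
      Dom (OM F j) (Ident (OM F j) b) = OM (counit_map J J (id_ftr J) F j) (?r b) \<and>
      Cod (OM F j) (Ident (OM F j) b) = b" by simp
    show "?g b z p \<in> Arr ?S \<and> Dom ?S (?g b z p) = z \<and> Cod ?S (?g b z p) = ?r b \<and>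
        Comp (OM F j) (Ident (OM F j) b) (AM (counit_map J J (id_ftr J) F j) (?g b z p)) = p"
      if "z \<in> Obj ?S" and p: "p \<in> Arr (OM F j)"
        "Dom (OM F j) p = OM (counit_map J J (id_ftr J) F j) z" "Cod (OM F j) p = b" for z p
    proof -
      have z: "paired z" "paired (pi1 z)" "pi1 (pi1 z) \<in> Obj J" "pi2 (pi1 z) \<in> Obj (OM F (pi1 (pi1 z)))"
        "pi2 z \<in> Arr J" "Dom J (pi2 z) = pi1 (pi1 z)" "Cod J (pi2 z) = j"
        using that(1) by simp_all
      show ?thesis using p by (simp add: z)
    qed
    show "f = ?g b (Dom ?S f) (Comp (OM F j) (Ident (OM F j) b) (AM (counit_map J J (id_ftr J) F j) f))"
      if f: "f \<in> Arr ?S" "Cod ?S f = ?r b" for f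
    proof -
      have t: "atrg f = ?r b" using f(2) by simp
      have f': "tripled f" "tripled (aund f)" "paired (aund (aund f))" "asrc (aund f) = pi1 (asrc f)"
        "atrg (aund f) = pair j b" "pi1 (aund (aund f)) \<in> Arr J" "Cod J (pi1 (aund (aund f))) = j"
        "pi2 (aund (aund f)) \<in> Arr (OM F j)" "Cod (OM F j) (pi2 (aund (aund f))) = b"
        using f(1) by (simp_all add: t)
      \<comment> \<open>Uniqueness of the base component: the target has an identity as structure
        arrow, so the triangle over \<open>j\<close> equates the base component of \<open>f\<close>
        with the structure arrow of its source.\<close>
      have "Comp J (pi2 (atrg f)) (AM (id_ftr J) (pi1 (aund (aund f)))) = pi2 (asrc f)"
        using f(1) unfolding shriek_Arr by blast
      then have k: "pi1 (aund (aund f)) = pi2 (asrc f)" using f'(6,7) by (simp add: t)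
      have "AM (counit_map J J (id_ftr J) F j) f = pi2 (aund (aund f))"
        using f(1) f'(8) by (simp add: t del: shriek_Arr)
      then have "aund (aund f) = pair (pi2 (asrc f))
          (Comp (OM F j) (Ident (OM F j) b) (AM (counit_map J J (id_ftr J) F j) f))"
        by (metis f'(3) k category_simps(10) diag_simps(2)[OF F j] small_category_category f'(8,9) paired_def)
      moreover have "f = mk_arr (asrc f) (mk_arr (pi1 (asrc f)) (aund (aund f)) (pair j b)) (?r b)"
        by (metis f'(1,2,4,5) t tripled_def)
      ultimately show ?thesis by (metis shriek_obj_simps(1))
    qed
  qed
qed

section \<open>Direct images of componentwise aspheric morphisms\<close>

lemma Asph_darr:
  "darr I F u G \<in> Asph \<A> I \<longleftrightarrow>
    dmor I F u G \<and> (\<forall>i\<in>Obj I. aspheric \<A> (OM F i) (OM G i) (u i))"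
  by (simp add: Asph_def)

definition fiber_map :: "'u::universe diag \<Rightarrow> 'u scat \<Rightarrow> 'u sftr" where
  \<comment> \<open>An object of \<open>S\<close> is an arrow of the direct image with components \<open>k\<close>, \<open>f\<close> out of the image of
    some \<open>((j', a), p)\<close>; it is sent to \<open>(F(k)(a), f)\<close>.\<close>
  "fiber_map F S =
     (let g = (\<lambda>s. pair (ob F (pi1 (aund (aund (pi2 s)))) (pi2 (pi1 (pi1 s)))) (pi2 (aund (aund (pi2 s))))) in
     \<lparr>OM = \<lambda>s\<in>Obj S. g s,
      AM = \<lambda>t\<in>Arr S. mk_arr (g (asrc t))
        (ar F (pi1 (aund (aund (pi2 (atrg t))))) (pi2 (aund (aund (aund t))))) (g (atrg t))\<rparr>)"

lemma fiber_map_simps [simp]: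
  "s \<in> Obj S \<Longrightarrow> OM (fiber_map F S) s =
    pair (ob F (pi1 (aund (aund (pi2 s)))) (pi2 (pi1 (pi1 s)))) (pi2 (aund (aund (pi2 s))))"
  "t \<in> Arr S \<Longrightarrow> AM (fiber_map F S) t = mk_arr
    (pair (ob F (pi1 (aund (aund (pi2 (asrc t))))) (pi2 (pi1 (pi1 (asrc t))))) (pi2 (aund (aund (pi2 (asrc t))))))
    (ar F (pi1 (aund (aund (pi2 (atrg t))))) (pi2 (aund (aund (aund t)))))
    (pair (ob F (pi1 (aund (aund (pi2 (atrg t))))) (pi2 (pi1 (pi1 (atrg t))))) (pi2 (aund (aund (pi2 (atrg t))))))"
  by (simp_all add: fiber_map_def Let_def)

lemma fiber_map_ext [simp]:
  "OM (fiber_map F S) \<in> extensional (Obj S)" "AM (fiber_map F S) \<in> extensional (Arr S)"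
  by (simp_all add: fiber_map_def Let_def)

text \<open>An object of the slice over ((j, b), q) amounts to an object a of F(j'), an arrow k from
  j' to j, and an arrow f from G(k)(u(a)) to b. As G(k)(u(a)) = u(F(k)(a)), the pair (F(k)(a), f)
  lies in the slice of \<open>u j\<close> over \<open>b\<close>. The resulting
  \<open>fiber_map\<close> has a right adjoint, hence is aspheric; its target is a member by
  \<open>asph\<close>, so (As2) gives the source.\<close>

lemma shriek_map_aspheric:
  assumes A: "right_asphericity_structure \<A>" and J: "small_category J" "small_category I"
    and w: "is_functor J I w" and u: "dmor J F u G"
    and asph: "\<And>j. j \<in> Obj J \<Longrightarrow> aspheric \<A> (OM F j) (OM G j) (u j)"
    and i: "i \<in> Obj I"
  shows "aspheric \<A> (shriek_obj J I w F i) (shriek_obj J I w G i) (shriek_map J I w F u G i)"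
proof -
  note F = dmor_functor[OF u]
  note [simp] = diag_simps[OF F(1)] diag_simps[OF F(2)] dmor_simps[OF u] dmor_natural[OF u]
    groth_map_simps[OF refl] functor_category[OF w] functor_simps[OF w] J i
  note sF = small_category_shriek_obj[OF J w F(1), of i] and sG = small_category_shriek_obj[OF J w F(2), of i]
  note m = shriek_map_functor[OF w u, of i]
  have "slice (shriek_obj J I w F i) (shriek_obj J I w G i) (shriek_map J I w F u G i) y \<in> \<A>"
    if y: "y \<in> Obj (shriek_obj J I w G i)" for y
  proof -
    define S where "S = slice (shriek_obj J I w F i) (shriek_obj J I w G i) (shriek_map J I w F u G i) y"
    define j where "j = pi1 (pi1 y)"
    define b where "b = pi2 (pi1 y)"
    have jb: "j \<in> Obj J" "b \<in> Obj (OM G j)" using y by (simp_all add: j_def b_def)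
    define T where "T = slice (OM F j) (OM G j) (u j) b"
    have sS: "small_category S" unfolding S_def by (rule small_category_slice[OF sF sG m])
    have sT: "small_category T"
      unfolding T_def by (rule small_category_slice[OF _ _ F(3)[OF jb(1)]]) (use jb in simp_all)
    have y': "paired y" "paired (pi1 y)" "pi1 (pi1 y) = j" "pi2 (pi1 y) = b" "pi2 y \<in> Arr I"
      "Dom I (pi2 y) = OM w j" "Cod I (pi2 y) = i"
      using y by (simp_all add: j_def b_def)
    have y'': "pi1 y = pair j b" using y'(2-4) by (metis paired_def)
    note [simp] = y' y'' jb sS sT
    let ?SF = "shriek_obj J I w F i" and ?SG = "shriek_obj J I w G i"
    let ?k = "\<lambda>s. pi1 (aund (aund (pi2 s)))" and ?f = "\<lambda>s. pi2 (aund (aund (pi2 s)))"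
    have S_Obj: "paired s" "paired (pi1 s)" "paired (pi1 (pi1 s))" "pi1 (pi1 (pi1 s)) \<in> Obj J"
      "pi2 (pi1 (pi1 s)) \<in> Obj (OM F (pi1 (pi1 (pi1 s))))" "pi2 (pi1 s) \<in> Arr I"
      "Dom I (pi2 (pi1 s)) = OM w (pi1 (pi1 (pi1 s)))" "Cod I (pi2 (pi1 s)) = i"
      "tripled (pi2 s)" "atrg (pi2 s) = y" "asrc (pi2 s) = pair (pair (pi1 (pi1 (pi1 s)))
        (OM (u (pi1 (pi1 (pi1 s)))) (pi2 (pi1 (pi1 s))))) (pi2 (pi1 s))"
      "tripled (aund (pi2 s))" "atrg (aund (pi2 s)) = pi1 y" "asrc (aund (pi2 s)) =
        pair (pi1 (pi1 (pi1 s))) (OM (u (pi1 (pi1 (pi1 s)))) (pi2 (pi1 (pi1 s))))"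
      "paired (aund (aund (pi2 s)))" "?k s \<in> Arr J" "Dom J (?k s) = pi1 (pi1 (pi1 s))"
      "Cod J (?k s) = j" "?f s \<in> Arr (OM G j)"
      "Dom (OM G j) (?f s) = ob G (?k s) (OM (u (pi1 (pi1 (pi1 s)))) (pi2 (pi1 (pi1 s))))"
      "Cod (OM G j) (?f s) = b" "Comp I (pi2 y) (AM w (?k s)) = pi2 (pi1 s)"
      if "s \<in> Obj S" for s
    proof -
      have s: "paired s" "pi1 s \<in> Obj ?SF" "pi2 s \<in> Arr ?SG" "asrc (pi2 s) = OM (shriek_map J I w F u G i) (pi1 s)"
        "atrg (pi2 s) = y" using that unfolding S_def slice_Obj
        by (simp_all del: shriek_Arr shriek_Obj slice_map_simps)
      note z = s(2)[unfolded shriek_Obj groth_Obj]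
      have m: "asrc (pi2 s) = pair (pair (pi1 (pi1 (pi1 s)))
        (OM (u (pi1 (pi1 (pi1 s)))) (pi2 (pi1 (pi1 s))))) (pi2 (pi1 s))"
        using z by (simp add: s(4))
      show "paired s" "paired (pi1 s)" "paired (pi1 (pi1 s))" "pi1 (pi1 (pi1 s)) \<in> Obj J"
      "pi2 (pi1 (pi1 s)) \<in> Obj (OM F (pi1 (pi1 (pi1 s))))" "pi2 (pi1 s) \<in> Arr I"
      "Dom I (pi2 (pi1 s)) = OM w (pi1 (pi1 (pi1 s)))" "Cod I (pi2 (pi1 s)) = i" "atrg (pi2 s) = y"
      "asrc (pi2 s) = pair (pair (pi1 (pi1 (pi1 s)))
        (OM (u (pi1 (pi1 (pi1 s)))) (pi2 (pi1 (pi1 s))))) (pi2 (pi1 s))"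
        using z s(1) s(5) m by simp_all
      note t = s(3)[unfolded shriek_Arr m s(5)]
      show "tripled (pi2 s)" "tripled (aund (pi2 s))" "atrg (aund (pi2 s)) = pi1 y" "asrc (aund (pi2 s)) =
        pair (pi1 (pi1 (pi1 s))) (OM (u (pi1 (pi1 (pi1 s)))) (pi2 (pi1 (pi1 s))))"
      "paired (aund (aund (pi2 s)))" "?k s \<in> Arr J" "Dom J (?k s) = pi1 (pi1 (pi1 s))"
      "Cod J (?k s) = j" "?f s \<in> Arr (OM G j)"
      "Dom (OM G j) (?f s) = ob G (?k s) (OM (u (pi1 (pi1 (pi1 s)))) (pi2 (pi1 (pi1 s))))"
      "Cod (OM G j) (?f s) = b" "Comp I (pi2 y) (AM w (?k s)) = pi2 (pi1 s)"
        using t y' by simp_all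
    qed
    let ?l = "\<lambda>t. pi1 (aund (aund (aund t)))" and ?h = "\<lambda>t. pi2 (aund (aund (aund t)))"
    \<comment> \<open>An arrow of \<open>S\<close> is an arrow (l, h) of \<integral>F compatible
      with the given arrows to \<open>y\<close>; the base and fibre components of this compatibility
      are the last two equations.\<close>
    have S_Arr: "tripled t" "asrc t \<in> Obj S" "atrg t \<in> Obj S" "tripled (aund t)"
      "asrc (aund t) = pi1 (asrc t)" "atrg (aund t) = pi1 (atrg t)" "tripled (aund (aund t))"
      "asrc (aund (aund t)) = pi1 (pi1 (asrc t))" "atrg (aund (aund t)) = pi1 (pi1 (atrg t))"
      "paired (aund (aund (aund t)))" "?l t \<in> Arr J"
      "Dom J (?l t) = pi1 (pi1 (pi1 (asrc t)))" "Cod J (?l t) = pi1 (pi1 (pi1 (atrg t)))"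
      "?h t \<in> Arr (OM F (pi1 (pi1 (pi1 (atrg t)))))"
      "Dom (OM F (pi1 (pi1 (pi1 (atrg t))))) (?h t) = ob F (?l t) (pi2 (pi1 (pi1 (asrc t))))"
      "Cod (OM F (pi1 (pi1 (pi1 (atrg t))))) (?h t) = pi2 (pi1 (pi1 (atrg t)))"
      "Comp J (?k (atrg t)) (?l t) = ?k (asrc t)"
      "Comp (OM G j) (?f (atrg t)) (ar G (?k (atrg t)) (AM (u (pi1 (pi1 (pi1 (atrg t))))) (?h t))) = ?f (asrc t)"
      if "t \<in> Arr S" for t
    proof -
      have s: "tripled t" "asrc t \<in> Obj S" "atrg t \<in> Obj S" "aund t \<in> Arr ?SF"
        "asrc (aund t) = pi1 (asrc t)" "atrg (aund t) = pi1 (atrg t)"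
        and e: "Comp ?SG (pi2 (atrg t)) (AM (shriek_map J I w F u G i) (aund t)) = pi2 (asrc t)"
        using that unfolding S_def slice_Arr
        by (simp_all del: shriek_Arr shriek_Obj slice_map_simps shriek_obj_simps(4) slice_Obj)
      show "tripled t" "asrc t \<in> Obj S" "atrg t \<in> Obj S"
        "asrc (aund t) = pi1 (asrc t)" "atrg (aund t) = pi1 (atrg t)" using s by simp_all
      note a = s(4)[unfolded shriek_Arr s(5,6)]
      show f: "tripled (aund t)" "tripled (aund (aund t))"
        "asrc (aund (aund t)) = pi1 (pi1 (asrc t))" "atrg (aund (aund t)) = pi1 (pi1 (atrg t))"
        "paired (aund (aund (aund t)))" "?l t \<in> Arr J"
        "Dom J (?l t) = pi1 (pi1 (pi1 (asrc t)))" "Cod J (?l t) = pi1 (pi1 (pi1 (atrg t)))"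
        "?h t \<in> Arr (OM F (pi1 (pi1 (pi1 (atrg t)))))"
        "Dom (OM F (pi1 (pi1 (pi1 (atrg t))))) (?h t) = ob F (?l t) (pi2 (pi1 (pi1 (asrc t))))"
        "Cod (OM F (pi1 (pi1 (pi1 (atrg t))))) (?h t) = pi2 (pi1 (pi1 (atrg t)))"
        using a by simp_all
      note q = S_Obj[OF s(2)] S_Obj[OF s(3)]
      have c: "aund (AM (shriek_map J I w F u G i) (aund t)) =
        mk_arr (pair (pi1 (pi1 (pi1 (asrc t)))) (OM (u (pi1 (pi1 (pi1 (asrc t))))) (pi2 (pi1 (pi1 (asrc t))))))
          (pair (?l t) (AM (u (pi1 (pi1 (pi1 (atrg t))))) (?h t)))
          (pair (pi1 (pi1 (pi1 (atrg t)))) (OM (u (pi1 (pi1 (pi1 (atrg t))))) (pi2 (pi1 (pi1 (atrg t))))))"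
        using s(4,5,6) q f by (simp del: shriek_Arr)
      have d: "Comp (groth J G) (aund (pi2 (atrg t))) (aund (AM (shriek_map J I w F u G i) (aund t))) =
         aund (pi2 (asrc t))" using arg_cong[OF e, of aund] by (simp del: slice_map_simps)
      then have d': "pi1 (aund (Comp (groth J G) (aund (pi2 (atrg t)))
          (aund (AM (shriek_map J I w F u G i) (aund t))))) = ?k (asrc t)"
        "pi2 (aund (Comp (groth J G) (aund (pi2 (atrg t)))
          (aund (AM (shriek_map J I w F u G i) (aund t))))) = ?f (asrc t)" by (simp_all only:)
      show "Comp J (?k (atrg t)) (?l t) = ?k (asrc t)"
        "Comp (OM G j) (?f (atrg t)) (ar G (?k (atrg t)) (AM (u (pi1 (pi1 (pi1 (atrg t))))) (?h t))) = ?f (asrc t)"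
        using d' unfolding c by (simp_all add: q)
    qed
    have [simp]: "Dom S = asrc" "Cod S = atrg" "Dom T = asrc" "Cod T = atrg"
      "\<And>s. Ident S s = mk_arr s (Ident ?SF (pi1 s)) s"
      "\<And>t s. Comp S t s = mk_arr (asrc s) (Comp ?SF (aund t) (aund s)) (atrg t)"
      "\<And>s. Ident T s = mk_arr s (Ident (OM F j) (pi1 s)) s"
      "\<And>t s. Comp T t s = mk_arr (asrc s) (Comp (OM F j) (aund t) (aund s)) (atrg t)"
      by (simp_all add: S_def T_def)
    have T_Obj [simp]: "x \<in> Obj T \<longleftrightarrow> paired x \<and> pi1 x \<in> Obj (OM F j) \<and> pi2 x \<in> Arr (OM G j) \<and>
      Dom (OM G j) (pi2 x) = OM (u j) (pi1 x) \<and> Cod (OM G j) (pi2 x) = b" for x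
      by (simp add: T_def)
    have T_Arr [simp]: "t \<in> Arr T \<longleftrightarrow> tripled t \<and> asrc t \<in> Obj T \<and> atrg t \<in> Obj T \<and>
       aund t \<in> Arr (OM F j) \<and> Dom (OM F j) (aund t) = pi1 (asrc t) \<and> Cod (OM F j) (aund t) = pi1 (atrg t) \<and>
       Comp (OM G j) (pi2 (atrg t)) (AM (u j) (aund t)) = pi2 (asrc t)" for t
      by (auto simp add: T_def)
    \<comment> \<open>Functoriality of \<open>F\<close> with the composite given a name, so that the
      base equation of \<open>S_Arr\<close> can discharge the premise.\<close>
    have fold: "ob F k (ob F k0 a) = ob F k' a" if "Comp J k k0 = k'" "k0 \<in> Arr J" "k \<in> Arr J"
      "Dom J k = Cod J k0" "a \<in> Obj (OM F (Dom J k0))" for k k0 k' a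
      using that by auto
    have fold': "ar F k (ar F k0 a) = ar F k' a" if "Comp J k k0 = k'" "k0 \<in> Arr J" "k \<in> Arr J"
      "Dom J k = Cod J k0" "a \<in> Arr (OM F (Dom J k0))" for k k0 k' a
      using that by auto
    have fib: "is_functor S T (fiber_map F S)"
    proof (rule functorI)
      fix s assume s: "s \<in> Obj S"
      show "OM (fiber_map F S) s \<in> Obj T"
        using s by (simp add: S_Obj)
      have "Ident S s \<in> Arr S" by (rule category_simps(3)[OF small_category_category[OF sS] s])
      then show "AM (fiber_map F S) (Ident S s) = Ident T (OM (fiber_map F S) s)"
        using s by (simp add: S_Obj)
    next
      fix t assume t: "t \<in> Arr S"
      have [simp]: "ob F (?k (atrg t)) (ob F (?l t) (pi2 (pi1 (pi1 (asrc t))))) =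
        ob F (?k (asrc t)) (pi2 (pi1 (pi1 (asrc t))))"
        by (rule fold) (use t S_Arr(2,3)[OF t] in \<open>simp_all add: S_Arr S_Obj\<close>)
      show "AM (fiber_map F S) t \<in> Arr T \<and> Dom T (AM (fiber_map F S) t) = OM (fiber_map F S) (Dom S t) \<and>
        Cod T (AM (fiber_map F S) t) = OM (fiber_map F S) (Cod S t)"
        using t S_Arr(2,3)[OF t] by (simp add: S_Arr S_Obj)
    next
      fix s t assume st: "s \<in> Arr S" "t \<in> Arr S" "Dom S t = Cod S s"
      have "Comp S t s \<in> Arr S"
        by (rule category_simps(6)[OF small_category_category[OF sS] st])
      moreover have "ar F (?k (atrg t)) (ar F (?l t) (?h s)) = ar F (?k (asrc t)) (?h s)"
        by (rule fold') (use st S_Arr(2,3)[OF st(1)] S_Arr(2,3)[OF st(2)] in \<open>simp_all add: S_Arr S_Obj\<close>)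
      ultimately show "AM (fiber_map F S) (Comp S t s) = Comp T (AM (fiber_map F S) t) (AM (fiber_map F S) s)"
        using st S_Arr(2,3)[OF st(1)] S_Arr(2,3)[OF st(2)]
        by (simp add: S_Arr S_Obj)
    qed (simp_all)
    \<comment> \<open>The right adjoint takes (a, g), with \<open>g\<close> from u(a) to b, to ((j,
      a), q) equipped with the arrow (id, g) to \<open>y\<close>. Transposing an arrow out of
      (F(k)(a), f) restores \<open>k\<close> as its base component.\<close>
    let ?z = "\<lambda>x. pair (pair j (pi1 x)) (pi2 y)"
    let ?r = "\<lambda>x. pair (?z x) (mk_arr (pair (pair j (OM (u j) (pi1 x))) (pi2 y))
      (mk_arr (pair j (OM (u j) (pi1 x))) (pair (Ident J j) (pi2 x)) (pair j b)) y)"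
    let ?g = "\<lambda>x s p. mk_arr s (mk_arr (pi1 s)
      (mk_arr (pi1 (pi1 s)) (pair (?k s) (aund p)) (pair j (pi1 x))) (?z x)) (?r x)"
    have "aspheric \<A> S T (fiber_map F S)"
    proof (rule aspheric_of_universal_arrows[OF A sS sT fib])
      fix x assume x: "x \<in> Obj T"
      have r: "?r x \<in> Obj S" unfolding S_def using x by simp
      then show "?r x \<in> Obj S" .
      show "Ident T x \<in> Arr T \<and> Dom T (Ident T x) = OM (fiber_map F S) (?r x) \<and> Cod T (Ident T x) = x"
        using x r by simp
      show "?g x s p \<in> Arr S \<and> Dom S (?g x s p) = s \<and> Cod S (?g x s p) = ?r x \<and>
          Comp T (Ident T x) (AM (fiber_map F S) (?g x s p)) = p"
        if s: "s \<in> Obj S" and p: "p \<in> Arr T" "Dom T p = OM (fiber_map F S) s" "Cod T p = x" for s p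
      proof -
        have p': "tripled p" "atrg p = x" "asrc p = pair (ob F (?k s) (pi2 (pi1 (pi1 s)))) (?f s)"
          "aund p \<in> Arr (OM F j)" "Dom (OM F j) (aund p) = ob F (?k s) (pi2 (pi1 (pi1 s)))"
          "Cod (OM F j) (aund p) = pi1 x" "Comp (OM G j) (pi2 x) (AM (u j) (aund p)) = ?f s"
          using p s by auto
        let ?m = "mk_arr (pi1 (pi1 s)) (pair (?k s) (aund p)) (pair j (pi1 x))"
        have m: "mk_arr (pi1 s) ?m (?z x) \<in> Arr ?SF"
          using s x p' by (simp add: S_Obj)
        have "Comp ?SG (pi2 (?r x)) (AM (shriek_map J I w F u G i) (mk_arr (pi1 s) ?m (?z x))) =
          mk_arr (pair (pair (pi1 (pi1 (pi1 s))) (OM (u (pi1 (pi1 (pi1 s)))) (pi2 (pi1 (pi1 s))))) (pi2 (pi1 s)))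
            (mk_arr (pair (pi1 (pi1 (pi1 s))) (OM (u (pi1 (pi1 (pi1 s)))) (pi2 (pi1 (pi1 s)))))
            (pair (?k s) (?f s)) (pair j b)) y"
          using s x p' m by (simp add: S_Obj)
        also have "\<dots> = pi2 s" using s by (simp add: S_Obj)
        finally have "Comp ?SG (pi2 (?r x)) (AM (shriek_map J I w F u G i) (mk_arr (pi1 s) ?m (?z x))) = pi2 s" .
        with r s m have g: "?g x s p \<in> Arr S"
          unfolding S_def slice_Arr by (simp del: slice_Obj shriek_Obj shriek_Arr)
        then show ?thesis using s x r p' by (simp add: S_Obj)
      qed
      show "t = ?g x (Dom S t) (Comp T (Ident T x) (AM (fiber_map F S) t))"
        if t: "t \<in> Arr S" "Cod S t = ?r x" for t
      proof -
        note q = S_Arr[OF t(1)]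
        have a: "atrg t = ?r x" using t(2) by simp
        note d = S_Obj[OF q(2)]
        \<comment> \<open>The target maps to \<open>y\<close> with identity base component, so the
          base equation of \<open>S_Arr\<close> leaves no choice for the base component of
          \<open>t\<close>.\<close>
        have k: "?k (asrc t) = ?l t" using q(11,13,17) by (simp add: a)
        have h: "aund (Comp T (Ident T x) (AM (fiber_map F S) t)) = ?h t"
          using t(1) q(14,16) x by (simp add: a)
        have 1: "pair (?l t) (?h t) = aund (aund (aund t))" using q(10) by simp
        have 2: "mk_arr (pi1 (pi1 (asrc t))) (aund (aund (aund t))) (pair j (pi1 x)) = aund (aund t)"
          by (rule tripled_eq) (simp_all add: q(7-9) a)
        have 3: "mk_arr (pi1 (asrc t)) (aund (aund t)) (?z x) = aund t"
          by (rule tripled_eq) (simp_all add: q(4-6) a)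
        have 4: "mk_arr (asrc t) (aund t) (?r x) = t"
          by (rule tripled_eq) (simp_all add: q(1) a)
        have 5: "Dom S t = asrc t" by simp
        show ?thesis by (simp only: h 5 k 1 2 3 4)
      qed
    qed
    moreover have "T \<in> \<A>" using asph[OF jb(1)] jb by (simp add: aspheric_def T_def)
    ultimately show ?thesis using aspheric_source[OF A] S_def by blast
  qed
  with sF sG m show ?thesis by (simp add: aspheric_def)
qed


section \<open>Two-cells and the adjunction\<close>

definition path_cat :: "'u::universe scat \<Rightarrow> 'u scat" where
  \<comment> \<open>the category of arrows of \<open>C\<close>; a commutative square from \<open>f\<close> to \<open>f'\<close> with horizontal arrows
    \<open>g\<close>, \<open>h\<close> is coded as \<open>mk_arr f (pair g h) f'\<close>\<close>
  "path_cat C =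
     \<lparr>Obj = Arr C,
      Arr = {t. tripled t \<and> paired (aund t) \<and> asrc t \<in> Arr C \<and> atrg t \<in> Arr C \<and>
        pi1 (aund t) \<in> Arr C \<and> pi2 (aund t) \<in> Arr C \<and>
        Dom C (pi1 (aund t)) = Dom C (asrc t) \<and> Cod C (pi1 (aund t)) = Dom C (atrg t) \<and>
        Dom C (pi2 (aund t)) = Cod C (asrc t) \<and> Cod C (pi2 (aund t)) = Cod C (atrg t) \<and>
        Comp C (pi2 (aund t)) (asrc t) = Comp C (atrg t) (pi1 (aund t))},
      Dom = asrc, Cod = atrg,
      Ident = (\<lambda>f. mk_arr f (pair (Ident C (Dom C f)) (Ident C (Cod C f))) f),
      Comp = (\<lambda>t s. mk_arr (asrc s)
        (pair (Comp C (pi1 (aund t)) (pi1 (aund s))) (Comp C (pi2 (aund t)) (pi2 (aund s)))) (atrg t))\<rparr>"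

lemma path_cat_simps [simp]:
  "Obj (path_cat C) = Arr C" "Dom (path_cat C) = asrc" "Cod (path_cat C) = atrg"
  "Ident (path_cat C) f = mk_arr f (pair (Ident C (Dom C f)) (Ident C (Cod C f))) f"
  "Comp (path_cat C) t s = mk_arr (asrc s)
    (pair (Comp C (pi1 (aund t)) (pi1 (aund s))) (Comp C (pi2 (aund t)) (pi2 (aund s)))) (atrg t)"
  "t \<in> Arr (path_cat C) \<longleftrightarrow> tripled t \<and> paired (aund t) \<and> asrc t \<in> Arr C \<and> atrg t \<in> Arr C \<and>
     pi1 (aund t) \<in> Arr C \<and> pi2 (aund t) \<in> Arr C \<and>
     Dom C (pi1 (aund t)) = Dom C (asrc t) \<and> Cod C (pi1 (aund t)) = Dom C (atrg t) \<and>
     Dom C (pi2 (aund t)) = Cod C (asrc t) \<and> Cod C (pi2 (aund t)) = Cod C (atrg t) \<and>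
     Comp C (pi2 (aund t)) (asrc t) = Comp C (atrg t) (pi1 (aund t))"
  by (simp_all add: path_cat_def)

lemma category_path_cat:
  assumes [simp]: "category C"
  shows "category (path_cat C)"
proof (rule categoryI)
  fix s t assume st: "s \<in> Arr (path_cat C)" "t \<in> Arr (path_cat C)"
    "Dom (path_cat C) t = Cod (path_cat C) s"
  have "Comp C (pi2 (aund t)) (Comp C (pi2 (aund s)) (asrc s)) =
    Comp C (pi2 (aund t)) (Comp C (atrg s) (pi1 (aund s)))"
    using st(1) by simp
  also have "\<dots> = Comp C (Comp C (atrg t) (pi1 (aund t))) (pi1 (aund s))"
    using st by (intro Comp_reassoc) simp_all
  finally show "Comp (path_cat C) t s \<in> Arr (path_cat C) \<and>
      Dom (path_cat C) (Comp (path_cat C) t s) = Dom (path_cat C) s \<and>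
      Cod (path_cat C) (Comp (path_cat C) t s) = Cod (path_cat C) t"
    using st by simp
qed simp_all

lemma small_category_path_cat:
  assumes "small_category C"
  shows "small_category (path_cat C)"
proof -
  have C: "small (Arr C)" using assms by (simp add: small_category_def)
  have "Arr (path_cat C) \<subseteq> {mk_arr x y z | x y z. x \<in> Arr C \<and>
      y \<in> {pair g h | g h. g \<in> Arr C \<and> h \<in> Arr C} \<and> z \<in> Arr C}" (is "_ \<subseteq> ?R")
  proof
    fix t assume "t \<in> Arr (path_cat C)"
    then have t: "t = mk_arr (asrc t) (pair (pi1 (aund t)) (pi2 (aund t))) (atrg t)"
      "asrc t \<in> Arr C" "atrg t \<in> Arr C" "pi1 (aund t) \<in> Arr C" "pi2 (aund t) \<in> Arr C"
      by simp_all
    then show "t \<in> ?R" by blast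
  qed
  then have "small (Arr (path_cat C))"
    using small_subset[OF small_triples[OF C small_pairs[OF C C] C]] by blast
  then show ?thesis
    using C category_path_cat[of C] assms by (simp add: small_category_def del: path_cat_simps(6))
qed

definition path_map :: "'u::universe scat \<Rightarrow> 'u sftr \<Rightarrow> 'u sftr" where
  "path_map C u = \<lparr>OM = \<lambda>f\<in>Arr C. AM u f,
    AM = \<lambda>t\<in>Arr (path_cat C). mk_arr (AM u (asrc t))
      (pair (AM u (pi1 (aund t))) (AM u (pi2 (aund t)))) (AM u (atrg t))\<rparr>"

definition path_dom :: "'u::universe scat \<Rightarrow> 'u sftr" where
  "path_dom C = \<lparr>OM = \<lambda>f\<in>Arr C. Dom C f, AM = \<lambda>t\<in>Arr (path_cat C). pi1 (aund t)\<rparr>"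

definition path_cod :: "'u::universe scat \<Rightarrow> 'u sftr" where
  "path_cod C = \<lparr>OM = \<lambda>f\<in>Arr C. Cod C f, AM = \<lambda>t\<in>Arr (path_cat C). pi2 (aund t)\<rparr>"

text \<open>A natural transformation from \<open>u\<close> to \<open>v\<close> as a functor into the
  category of arrows, from which \<open>path_dom\<close> and \<open>path_cod\<close> recover
  \<open>u\<close> and \<open>v\<close>. Applied to the identity transformation of an identity
  functor, it is the common section of the two projections.\<close>

definition path_cell :: "'u::universe scat \<Rightarrow> 'u sftr \<Rightarrow> 'u sftr \<Rightarrow> ('u \<Rightarrow> 'u) \<Rightarrow> 'u sftr" where
  "path_cell A u v \<alpha> = \<lparr>OM = \<lambda>x\<in>Obj A. \<alpha> x,
    AM = \<lambda>f\<in>Arr A. mk_arr (\<alpha> (Dom A f)) (pair (AM u f) (AM v f)) (\<alpha> (Cod A f))\<rparr>"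

lemma path_map_simps [simp]:
  "f \<in> Arr C \<Longrightarrow> OM (path_map C u) f = AM u f"
  "t \<in> Arr (path_cat C) \<Longrightarrow> AM (path_map C u) t =
    mk_arr (AM u (asrc t)) (pair (AM u (pi1 (aund t))) (AM u (pi2 (aund t)))) (AM u (atrg t))"
  "f \<in> Arr C \<Longrightarrow> OM (path_dom C) f = Dom C f"
  "t \<in> Arr (path_cat C) \<Longrightarrow> AM (path_dom C) t = pi1 (aund t)"
  "f \<in> Arr C \<Longrightarrow> OM (path_cod C) f = Cod C f"
  "t \<in> Arr (path_cat C) \<Longrightarrow> AM (path_cod C) t = pi2 (aund t)"
  "x \<in> Obj A \<Longrightarrow> OM (path_cell A u v \<alpha>) x = \<alpha> x"
  "f \<in> Arr A \<Longrightarrow> AM (path_cell A u v \<alpha>) f =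
    mk_arr (\<alpha> (Dom A f)) (pair (AM u f) (AM v f)) (\<alpha> (Cod A f))"
  by (simp_all add: path_map_def path_dom_def path_cod_def path_cell_def del: path_cat_simps(6))

lemma path_map_ext [simp]:
  "OM (path_map C u) \<in> extensional (Arr C)" "AM (path_map C u) \<in> extensional (Arr (path_cat C))"
  "OM (path_dom C) \<in> extensional (Arr C)" "AM (path_dom C) \<in> extensional (Arr (path_cat C))"
  "OM (path_cod C) \<in> extensional (Arr C)" "AM (path_cod C) \<in> extensional (Arr (path_cat C))"
  "OM (path_cell A u v \<alpha>) \<in> extensional (Obj A)" "AM (path_cell A u v \<alpha>) \<in> extensional (Arr A)"
  by (simp_all add: path_map_def path_dom_def path_cod_def path_cell_def)

lemma path_map_functor:
  assumes "is_functor C D u"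
  shows "is_functor (path_cat C) (path_cat D) (path_map C u)"
proof -
  note [simp] = functor_category[OF assms] functor_simps(1-5)[OF assms]
    functor_simps(6)[OF assms, symmetric]
  show ?thesis
  proof (rule functorI)
    fix s t assume st: "s \<in> Arr (path_cat C)" "t \<in> Arr (path_cat C)"
      "Dom (path_cat C) t = Cod (path_cat C) s"
    have "Comp (path_cat C) t s \<in> Arr (path_cat C)"
      by (rule category_simps(6)[OF category_path_cat st]) simp
    then show "AM (path_map C u) (Comp (path_cat C) t s) =
      Comp (path_cat D) (AM (path_map C u) t) (AM (path_map C u) s)"
      using st by simp
  qed (simp_all add: category_path_cat)
qed

lemma path_dom_functor:
  assumes [simp]: "category C"
  shows "is_functor (path_cat C) C (path_dom C)"
proof (rule functorI)
  fix s t assume st: "s \<in> Arr (path_cat C)" "t \<in> Arr (path_cat C)"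
    "Dom (path_cat C) t = Cod (path_cat C) s"
  have "Comp (path_cat C) t s \<in> Arr (path_cat C)"
    by (rule category_simps(6)[OF category_path_cat[OF assms] st])
  then show "AM (path_dom C) (Comp (path_cat C) t s) = Comp C (AM (path_dom C) t) (AM (path_dom C) s)"
    using st by simp
qed (simp_all add: category_path_cat)

lemma path_cod_functor:
  assumes [simp]: "category C"
  shows "is_functor (path_cat C) C (path_cod C)"
proof (rule functorI)
  fix s t assume st: "s \<in> Arr (path_cat C)" "t \<in> Arr (path_cat C)"
    "Dom (path_cat C) t = Cod (path_cat C) s"
  have "Comp (path_cat C) t s \<in> Arr (path_cat C)"
    by (rule category_simps(6)[OF category_path_cat[OF assms] st])
  then show "AM (path_cod C) (Comp (path_cat C) t s) = Comp C (AM (path_cod C) t) (AM (path_cod C) s)"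
    using st by simp
qed (simp_all add: category_path_cat)

lemma path_cell_functor:
  assumes u: "is_functor A C u" and v: "is_functor A C v"
    and \<alpha>: "\<And>x. x \<in> Obj A \<Longrightarrow> \<alpha> x \<in> Arr C \<and> Dom C (\<alpha> x) = OM u x \<and> Cod C (\<alpha> x) = OM v x"
    and nat: "\<And>f. f \<in> Arr A \<Longrightarrow> Comp C (\<alpha> (Cod A f)) (AM u f) = Comp C (AM v f) (\<alpha> (Dom A f))"
  shows "is_functor A (path_cat C) (path_cell A u v \<alpha>)"
proof -
  note [simp] = functor_category[OF u] functor_simps[OF u] functor_simps[OF v] \<alpha> nat
  show ?thesis by (rule functorI) (simp_all add: category_path_cat)
qed

text \<open>A commuting square from \<open>f\<close> to \<open>Ident C b\<close> is determined by
  its edge \<open>p\<close> between codomains, the other edge being \<open>p f\<close>; so sending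
  \<open>b\<close> to its identity is right adjoint to the codomain projection. To the domain
  projection it is left adjoint.\<close>

lemma path_cod_aspheric:
  assumes A: "right_asphericity_structure \<A>" and C: "small_category C"
  shows "aspheric \<A> (path_cat C) C (path_cod C)"
proof -
  note [simp] = C
  show ?thesis
  proof (rule aspheric_of_universal_arrows[OF A small_category_path_cat[OF C] C path_cod_functor])
    let ?r = "Ident C" and ?g = "\<lambda>b f p. mk_arr f (pair (Comp C p f) p) (Ident C b)"
    fix b assume b [simp]: "b \<in> Obj C"
    show "t = ?g b (Dom (path_cat C) t) (Comp C (?r b) (AM (path_cod C) t))"
      if t: "t \<in> Arr (path_cat C)" "Cod (path_cat C) t = ?r b" for t
    proof -
      have a: "atrg t = Ident C b" using t(2) by simp
      have t': "tripled t" "paired (aund t)" "asrc t \<in> Arr C" "pi1 (aund t) \<in> Arr C" "pi2 (aund t) \<in> Arr C"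
        "Cod C (pi1 (aund t)) = b" "Cod C (pi2 (aund t)) = b"
        "Comp C (pi2 (aund t)) (asrc t) = Comp C (Ident C b) (pi1 (aund t))"
        using t(1) by (simp_all add: a)
      have "Comp C (?r b) (AM (path_cod C) t) = pi2 (aund t)" using t(1) t' by (simp add: a)
      moreover have "Comp C (pi2 (aund t)) (asrc t) = pi1 (aund t)" using t' by simp
      moreover have "mk_arr (asrc t) (aund t) (Ident C b) = t" by (rule tripled_eq) (simp_all add: t' a)
      ultimately show ?thesis by (simp add: t'(2))
    qed
  qed simp_all
qed

section \<open>Two-cells between morphisms of diagrams\<close>

definition path_diag :: "'u::universe scat \<Rightarrow> 'u diag \<Rightarrow> 'u diag" where
  "path_diag I Y = \<lparr>OM = \<lambda>i\<in>Obj I. path_cat (OM Y i),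
    AM = \<lambda>r\<in>Arr I. (path_cat (OM Y (Dom I r)), path_map (OM Y (Dom I r)) (und (AM Y r)),
      path_cat (OM Y (Cod I r)))\<rparr>"

lemma path_diag_simps [simp]:
  "i \<in> Obj I \<Longrightarrow> OM (path_diag I Y) i = path_cat (OM Y i)"
  "r \<in> Arr I \<Longrightarrow> und (AM (path_diag I Y) r) = path_map (OM Y (Dom I r)) (und (AM Y r))"
  by (simp_all add: path_diag_def)

lemma path_diag_functor:
  assumes "is_functor I Cat Y"
  shows "is_functor I Cat (path_diag I Y)"
proof -
  note [simp] = diag_simps[OF assms]
  show ?thesis
    unfolding path_diag_def
  proof (rule diagI)
    fix r s t assume "r \<in> Arr I" "s \<in> Arr I" "Dom I s = Cod I r" "t \<in> Arr (path_cat (OM Y (Dom I r)))"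
    moreover from this have "AM (path_map (OM Y (Dom I r)) (und (AM Y r))) t \<in> Arr (path_cat (OM Y (Cod I r)))"
      using functor_simps(2)[OF path_map_functor] diag_simps(3)[OF assms] by blast
    ultimately show "AM (path_map (OM Y (Dom I (Comp I s r))) (und (AM Y (Comp I s r)))) t =
      AM (path_map (OM Y (Dom I s)) (und (AM Y s))) (AM (path_map (OM Y (Dom I r)) (und (AM Y r))) t)"
      by simp
  qed (simp_all add: small_category_path_cat path_map_functor)
qed

text \<open>\<open>mod\<close> makes \<open>\<alpha>\<close> a modification: it respects the
  transition functors, so its cells assemble into a strict morphism to the path diagram. This is a
  homotopy from \<open>u\<close> to \<open>v\<close>, and \<open>zz_eq_path_object\<close> applies
  with the identity paths as common section.\<close>

lemma zz_eq_2cell: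
  assumes A: "right_asphericity_structure \<A>" and u: "dmor I X u Y" and v: "dmor I X v Y"
    and \<alpha>: "\<And>i x. i \<in> Obj I \<Longrightarrow> x \<in> Obj (OM X i) \<Longrightarrow> \<alpha> i x \<in> Arr (OM Y i) \<and>
      Dom (OM Y i) (\<alpha> i x) = OM (u i) x \<and> Cod (OM Y i) (\<alpha> i x) = OM (v i) x"
    and nat: "\<And>i f. i \<in> Obj I \<Longrightarrow> f \<in> Arr (OM X i) \<Longrightarrow>
      Comp (OM Y i) (\<alpha> i (Cod (OM X i) f)) (AM (u i) f) =
      Comp (OM Y i) (AM (v i) f) (\<alpha> i (Dom (OM X i) f))"
    and mod: "\<And>r x. r \<in> Arr I \<Longrightarrow> x \<in> Obj (OM X (Dom I r)) \<Longrightarrow>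
      ar Y r (\<alpha> (Dom I r) x) = \<alpha> (Cod I r) (ob X r x)"
  shows "zz_eq (functor_cat I Cat) (Asph \<A> I) X Y [Fwd (darr I X u Y)] [Fwd (darr I X v Y)]"
proof -
  note F = dmor_functor[OF u]
  note P = path_diag_functor[OF F(2)]
  note [simp] = diag_simps[OF F(1)] diag_simps[OF F(2)] dmor_simps[OF u] dmor_simps[OF v]
    dmor_natural[OF u] dmor_natural[OF v] mod
  let ?c = "\<lambda>i. path_cod (OM Y i)" and ?d = "\<lambda>i. path_dom (OM Y i)"
  let ?e = "\<lambda>i. path_cell (OM Y i) (id_ftr (OM Y i)) (id_ftr (OM Y i)) (Ident (OM Y i))"
  let ?a = "\<lambda>i. path_cell (OM X i) (u i) (v i) (\<alpha> i)"
  let ?P = "path_diag I Y" and ?FC = "functor_cat I Cat"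
  have P_Arr: "AM (path_map (OM Y (Dom I r)) (und (AM Y r))) t \<in> Arr (path_cat (OM Y (Cod I r)))"
    if "r \<in> Arr I" "t \<in> Arr (path_cat (OM Y (Dom I r)))" for r t
    using functor_simps(2)[OF path_map_functor[OF diag_simps(3)[OF F(2) that(1)]] that(2)] .
  have c: "dmor I ?P ?c Y"
  proof (rule dmorI)
    fix r t assume "r \<in> Arr I" "t \<in> Arr (OM ?P (Dom I r))"
    then show "AM (?c (Cod I r)) (ar ?P r t) = ar Y r (AM (?c (Dom I r)) t)"
      using P_Arr[of r t] by simp
  qed (simp_all add: P F path_cod_functor)
  have d: "dmor I ?P ?d Y"
  proof (rule dmorI)
    fix r t assume "r \<in> Arr I" "t \<in> Arr (OM ?P (Dom I r))"
    then show "AM (?d (Cod I r)) (ar ?P r t) = ar Y r (AM (?d (Dom I r)) t)"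
      using P_Arr[of r t] by simp
  qed (simp_all add: P F path_dom_functor)
  have e: "dmor I Y ?e ?P"
    by (rule dmorI) (simp_all add: P F path_cell_functor functor_id)
  have a: "dmor I X ?a ?P"
  proof (rule dmorI)
    fix i assume i: "i \<in> Obj I"
    then show "is_functor (OM X i) (OM ?P i) (?a i)"
      using path_cell_functor[OF F(3)[OF i] dmor_functor(3)[OF v i], of "\<alpha> i"] \<alpha> nat by simp
  qed (use \<alpha> nat in \<open>simp_all add: P F\<close>)
  have cW: "darr I ?P ?c Y \<in> Asph \<A> I"
    using c by (simp add: Asph_darr path_cod_aspheric[OF A])
  have ce: "Comp ?FC (darr I ?P ?c Y) (darr I Y ?e ?P) = Ident ?FC Y"
    unfolding darr_Comp darr_Ident
    by (rule darr_cong, rule functor_eqI'[OF functor_id, symmetric]) simp_all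
  have de: "Comp ?FC (darr I ?P ?d Y) (darr I Y ?e ?P) = Ident ?FC Y"
    unfolding darr_Comp darr_Ident
    by (rule darr_cong, rule functor_eqI'[OF functor_id, symmetric]) simp_all
  have ca: "Comp ?FC (darr I ?P ?c Y) (darr I X ?a ?P) = darr I X v Y"
    unfolding darr_Comp
    by (rule darr_cong, rule functor_eqI'[OF dmor_functor(3)[OF v], symmetric])
      (use \<alpha> nat in simp_all)
  have da: "Comp ?FC (darr I ?P ?d Y) (darr I X ?a ?P) = darr I X u Y"
    unfolding darr_Comp
    by (rule darr_cong, rule functor_eqI'[OF F(3), symmetric])
      (use \<alpha> nat in simp_all)
  show ?thesis
    using zz_eq_path_object[OF category_functor_cat[of I Cat] cW, where d = "darr I ?P ?d Y"
      and i = "darr I Y ?e ?P" and a = "darr I X ?a ?P"]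
      c d e a ce de
    by (simp only: ca da darr_Arr functor_cat_simps(2,3) darr_simps simp_thms)
qed


section \<open>Assembly of the adjunction\<close>

lemma pullback_Asph:
  assumes w: "is_functor J I w"
  shows "AM (pullback J I w) ` (Asph \<A> I \<inter> Arr (functor_cat I Cat)) \<subseteq> Asph \<A> J"
proof (rule image_subsetI)
  fix t assume t: "t \<in> Asph \<A> I \<inter> Arr (functor_cat I Cat)"
  then have "t \<in> Arr (functor_cat I Cat)" by blast
  then obtain F u G where e: "t = darr I F u G" and u: "dmor I F u G" by (rule functor_cat_ArrE)
  with t show "AM (pullback J I w) t \<in> Asph \<A> J"
    by (simp add: e pullback_AM[OF w u] Asph_darr pullback_dmor[OF w u] functor_simps[OF w])
qed

lemma shriek_Asph:
  assumes A: "right_asphericity_structure \<A>" and J: "small_category J" "small_category I"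
    and w: "is_functor J I w"
  shows "AM (shriek J I w) ` (Asph \<A> J \<inter> Arr (functor_cat J Cat)) \<subseteq> Asph \<A> I"
proof (rule image_subsetI)
  fix t assume t: "t \<in> Asph \<A> J \<inter> Arr (functor_cat J Cat)"
  then have "t \<in> Arr (functor_cat J Cat)" by blast
  then obtain F u G where e: "t = darr J F u G" and u: "dmor J F u G" by (rule functor_cat_ArrE)
  with t show "AM (shriek J I w) t \<in> Asph \<A> I"
    by (simp add: e shriek_AM[OF w u] Asph_darr shriek_map_dmor[OF J w u]
      shriek_map_aspheric[OF A J w u])
qed

text \<open>
  Both composites send \<open>((j, ((j', a), p)), q)\<close> to objects of \<open>(\<integral>F)/i\<close>, namely
  \<open>((j', a), q w(p))\<close> and \<open>((j, F(p)(a)), q)\<close>, and \<open>(p, id)\<close> is a natural arrow from the first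
  to the second.
\<close>

lemma counit_shriek_kappa:
  assumes A: "right_asphericity_structure \<A>" and J: "small_category J" "small_category I"
    and w: "is_functor J I w" and F: "is_functor J Cat F"
  shows "zz_eq (functor_cat I Cat) (Asph \<A> I)
    (shriek_diag J I w (shriek_diag J J (id_ftr J) F)) (shriek_diag J I w F)
    [Fwd (Comp (functor_cat I Cat) (counit J I w (shriek_diag J I w F))
      (AM (shriek J I w) (kappa J I w F)))]
    [Fwd (AM (shriek J I w) (counit J J (id_ftr J) F))]"
proof -
  have id: "is_functor J J (id_ftr J)" using J by (simp add: functor_id)
  let ?E = "shriek_diag J J (id_ftr J) F" and ?S = "shriek_diag J I w F"
  have E: "is_functor J Cat ?E" by (rule shriek_diag_functor[OF J(1,1) id F])
  have S: "is_functor I Cat ?S" by (rule shriek_diag_functor[OF J w F])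
  have wS: "is_functor J Cat (comp_ftr J ?S w)" by (rule functor_comp[OF w S])
  have k0: "dmor J ?E (unit_map J w F) (comp_ftr J ?S w)" by (rule unit_map_dmor[OF J w F])
  have e: "dmor J ?E (counit_map J J (id_ftr J) F) F"
    using counit_map_dmor[OF J(1,1) id F] by (simp only: comp_ftr_id(1)[OF F])
  have g: "dmor I (shriek_diag J I w (comp_ftr J ?S w)) (counit_map J I w ?S) ?S"
    by (rule counit_map_dmor[OF J w S])
  \<comment> \<open>\<open>u\<close> and \<open>v\<close> are the componentwise functors of the two
    sides of the triangle: counit after direct image of the unit leg, and direct image of the
    replacement.\<close>
  define u where "u = (\<lambda>i. comp_ftr (OM (shriek_diag J I w ?E) i) (counit_map J I w ?S i)
    (shriek_map J I w ?E (unit_map J w F) (comp_ftr J ?S w) i))"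
  define v where "v = shriek_map J I w ?E (counit_map J J (id_ftr J) F) F"
  have u: "dmor I (shriek_diag J I w ?E) u ?S"
    unfolding u_def by (rule dmor_comp[OF shriek_map_dmor[OF J w k0] g])
  have v: "dmor I (shriek_diag J I w ?E) v ?S"
    unfolding v_def by (rule shriek_map_dmor[OF J w e])
  \<comment> \<open>The index enters only as the codomain of \<open>pi2 z\<close>, so the formula
    does not mention it.\<close>
  define \<alpha> where "\<alpha> = (\<lambda>(i::'a) z. let x = pi2 (pi1 z) in
    mk_arr (pair (pi1 x) (Comp I (pi2 z) (AM w (pi2 x))))
      (mk_arr (pi1 x) (pair (pi2 x) (Ident (OM F (pi1 (pi1 z))) (ob F (pi2 x) (pi2 (pi1 x)))))
        (pair (pi1 (pi1 z)) (ob F (pi2 x) (pi2 (pi1 x)))))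
      (pair (pair (pi1 (pi1 z)) (ob F (pi2 x) (pi2 (pi1 x)))) (pi2 z)))"
  note [simp] = diag_simps[OF F] functor_category[OF w] functor_simps[OF w] J groth_map_simps[OF refl]
  note cs = counit_map_simps[of _ J J "id_ftr J" F, unfolded comp_ftr_id(1)[OF F]]
  have "zz_eq (functor_cat I Cat) (Asph \<A> I) (shriek_diag J I w ?E) ?S
      [Fwd (darr I (shriek_diag J I w ?E) u ?S)] [Fwd (darr I (shriek_diag J I w ?E) v ?S)]"
  proof (rule zz_eq_2cell[OF A u v, of \<alpha>])
    fix i z assume i: "i \<in> Obj I" and z: "z \<in> Obj (OM (shriek_diag J I w ?E) i)"
    have uz: "OM (u i) z = pair (pi1 (pi2 (pi1 z))) (Comp I (pi2 z) (AM w (pi2 (pi2 (pi1 z)))))"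
      using i z unfolding u_def unit_map_def by auto
    have vz: "OM (v i) z = pair (pair (pi1 (pi1 z)) (ob F (pi2 (pi2 (pi1 z))) (pi2 (pi1 (pi2 (pi1 z)))))) (pi2 z)"
      using i z unfolding v_def by (auto simp: cs)
    show "\<alpha> i z \<in> Arr (OM ?S i) \<and> Dom (OM ?S i) (\<alpha> i z) = OM (u i) z \<and> Cod (OM ?S i) (\<alpha> i z) = OM (v i) z"
      using i z unfolding uz vz by (auto simp: \<alpha>_def Let_def)
  next
    fix i t assume i: "i \<in> Obj I" and t: "t \<in> Arr (OM (shriek_diag J I w ?E) i)"
    let ?z = "asrc t" and ?z' = "atrg t"
    define j j' x x' q q' k \<phi> where def: "j = pi1 (pi1 ?z)" "j' = pi1 (pi1 ?z')" "x = pi2 (pi1 ?z)"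
      "x' = pi2 (pi1 ?z')" "q = pi2 ?z" "q' = pi2 ?z'" "k = pi1 (aund (aund t))" "\<phi> = pi2 (aund (aund t))"
    have t': "t \<in> Arr (shriek_obj J I w ?E i)" using t unfolding shriek_diag_simps(1)[OF i] .
    note T = t'[unfolded shriek_Arr shriek_Obj groth_Obj]
    have j: "j \<in> Obj J" "j' \<in> Obj J" using T unfolding def by blast+
    have z: "paired ?z" "paired (pi1 ?z)" "x \<in> Obj (OM ?E j)" "q \<in> Arr I" "Dom I q = OM w j" "Cod I q = i"
      "paired ?z'" "paired (pi1 ?z')" "x' \<in> Obj (OM ?E j')" "q' \<in> Arr I" "Dom I q' = OM w j'" "Cod I q' = i"
      using T unfolding def by blast+
    have k: "k \<in> Arr J" "Dom J k = j" "Cod J k = j'" "Comp I q' (AM w k) = q"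
      using T unfolding def by blast+
    have \<phi>0: "\<phi> \<in> Arr (OM ?E j')" "Dom (OM ?E j') \<phi> = ob ?E k x" "Cod (OM ?E j') \<phi> = x'"
      using T unfolding def by blast+
    have x: "paired x" "paired (pi1 x)" "pi1 (pi1 x) \<in> Obj J" "pi2 (pi1 x) \<in> Obj (OM F (pi1 (pi1 x)))"
      "pi2 x \<in> Arr J" "Dom J (pi2 x) = pi1 (pi1 x)" "Cod J (pi2 x) = j"
      "paired x'" "paired (pi1 x')" "pi1 (pi1 x') \<in> Obj J" "pi2 (pi1 x') \<in> Obj (OM F (pi1 (pi1 x')))"
      "pi2 x' \<in> Arr J" "Dom J (pi2 x') = pi1 (pi1 x')" "Cod J (pi2 x') = j'"
      using z(3,9) j by simp_all
    have kx: "ob ?E k x = pair (pi1 x) (Comp J k (pi2 x))"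
      using k x j by simp
    note \<phi>1 = \<phi>0(2,3)[unfolded shriek_diag_simps(1)[OF j(2)] shriek_obj_simps kx]
    have \<phi>: "tripled \<phi>" "tripled (aund \<phi>)" "asrc (aund \<phi>) = pi1 x" "atrg (aund \<phi>) = pi1 x'"
      "paired (aund (aund \<phi>))" "pi1 (aund (aund \<phi>)) \<in> Arr J"
      "Dom J (pi1 (aund (aund \<phi>))) = pi1 (pi1 x)" "Cod J (pi1 (aund (aund \<phi>))) = pi1 (pi1 x')"
      "pi2 (aund (aund \<phi>)) \<in> Arr (OM F (pi1 (pi1 x')))"
      "Dom (OM F (pi1 (pi1 x'))) (pi2 (aund (aund \<phi>))) = ob F (pi1 (aund (aund \<phi>))) (pi2 (pi1 x))"
      "Cod (OM F (pi1 (pi1 x'))) (pi2 (aund (aund \<phi>))) = pi2 (pi1 x')"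
      using \<phi>0(1) j(2) by (simp_all add: \<phi>1)
    have \<phi>2: "\<phi> \<in> Arr (shriek_obj J J (id_ftr J) F j')"
      using \<phi>0(1) unfolding shriek_diag_simps(1)[OF j(2)] .
    then have "Comp J (pi2 (atrg \<phi>)) (AM (id_ftr J) (pi1 (aund (aund \<phi>)))) = pi2 (asrc \<phi>)"
      unfolding shriek_Arr by blast
    \<comment> \<open>With \<open>p\<close>, \<open>p'\<close> the structure arrows of
      \<open>x\<close>, \<open>x'\<close> and \<open>l\<close> the base component of
      \<open>\<phi>\<close>, the triangle over \<open>j'\<close> reads p' l = k p.\<close>
    then have px: "Comp J (pi2 x') (pi1 (aund (aund \<phi>))) = Comp J k (pi2 x)"
      using \<phi>(6) by (simp add: \<phi>1)
    \<comment> \<open>The fibre part of \<open>v\<close> at \<open>t\<close> is F(p')(f), with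
      \<open>f\<close> the fibre component of \<open>\<phi>\<close>. It starts at F(p')(F(l)(a)),
      and this equation identifies that object with the required F(k)(F(p)(a)).\<close>
    have fx: "ob F k (ob F (pi2 x) (pi2 (pi1 x))) =
      ob F (pi2 x') (ob F (pi1 (aund (aund \<phi>))) (pi2 (pi1 x)))"
      using arg_cong[OF px, of "\<lambda>k. ob F k (pi2 (pi1 x))"] x k \<phi> by simp
    have aE: "aund t \<in> Arr (groth J ?E)" "pi1 ?z \<in> Obj (groth J ?E)" "pi1 ?z' \<in> Obj (groth J ?E)"
      "asrc (aund t) = pi1 ?z" "atrg (aund t) = pi1 ?z'"
      using t' unfolding shriek_obj_def slice_Arr slice_Obj groth_simps by blast+
    let ?t = "AM (shriek_map J I w ?E (unit_map J w F) (comp_ftr J ?S w) i) t"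
    have t1: "?t \<in> Arr (shriek_obj J I w (comp_ftr J ?S w) i)"
      by (rule functor_simps(2)[OF shriek_map_functor[OF w k0] t'])
    have t2: "pi2 (atrg ?t) = q'" "pi2 (aund (aund ?t)) = AM (unit_map J w F j') \<phi>"
      unfolding slice_map_simps(2)[OF t'] mk_arr_simps groth_map_simps(2)[OF refl aE(1)] aE(5)
      by (simp_all add: def)
    have \<phi>3: "AM (unit_map J w F j') \<phi> \<in> Arr (shriek_obj J I w F (OM w j'))"
      by (rule functor_simps(2)[OF unit_map_functor[OF w F j(2)] \<phi>2])
    have \<phi>4: "AM (unit_map J w F j') \<phi> = mk_arr (pair (pi1 x) (AM w (Comp J k (pi2 x)))) (aund \<phi>)
        (pair (pi1 x') (AM w (pi2 x')))"
      unfolding unit_map_def slice_map_simps(2)[OF \<phi>2] \<phi>1 using x \<phi> by simp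
    have "AM (u i) t = ar ?S q' (AM (unit_map J w F j') \<phi>)"
      using t t1 t2 by (simp add: u_def del: shriek_Arr shriek_diag_simps(2) slice_map_simps(2))
    also have "\<dots> = mk_arr (pair (pi1 x) (Comp I q (AM w (pi2 x)))) (aund \<phi>)
        (pair (pi1 x') (Comp I q' (AM w (pi2 x'))))"
      unfolding shriek_diag_simps(2)[OF z(10)] z(11) slice_map_simps(2)[OF \<phi>3] unfolding \<phi>4
      using x \<phi> k z by (simp add: Comp_reassoc[OF k(4)])
    finally have ut: "AM (u i) t = mk_arr (pair (pi1 x) (Comp I q (AM w (pi2 x)))) (aund \<phi>)
        (pair (pi1 x') (Comp I q' (AM w (pi2 x'))))" .
    let ?b = "pair j (ob F (pi2 x) (pi2 (pi1 x)))" and ?b' = "pair j' (ob F (pi2 x') (pi2 (pi1 x')))"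
    have x2: "x \<in> Obj (shriek_obj J J (id_ftr J) F j)" "x' \<in> Obj (shriek_obj J J (id_ftr J) F j')"
      using z(3,9) j by simp_all
    have vt: "AM (v i) t = mk_arr (pair ?b q)
        (mk_arr ?b (pair k (ar F (pi2 x') (pi2 (aund (aund \<phi>))))) ?b') (pair ?b' q')"
      unfolding v_def slice_map_simps(2)[OF t'] groth_map_simps(2)[OF refl aE(1)] aE(4,5)
        groth_map_simps(1)[OF refl aE(2)] groth_map_simps(1)[OF refl aE(3)] def[symmetric]
        cs(1)[OF x2(1)] cs(1)[OF x2(2)] cs(2)[OF \<phi>2] \<phi>1 ..
    \<comment> \<open>One path has base component p' l, the other k p, equal by \<open>px\<close>;
      both have fibre component F(p')(f), since the cells have identities there.\<close>
    show "Comp (OM ?S i) (\<alpha> i (Cod (OM (shriek_diag J I w ?E) i) t)) (AM (u i) t) =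
      Comp (OM ?S i) (AM (v i) t) (\<alpha> i (Dom (OM (shriek_diag J I w ?E) i) t))"
      unfolding ut vt shriek_diag_simps(1)[OF i] shriek_obj_simps \<alpha>_def Let_def def[symmetric]
      using x \<phi> z k j px fx by simp
  next
    fix r z assume r: "r \<in> Arr I" and z: "z \<in> Obj (OM (shriek_diag J I w ?E) (Dom I r))"
    show "ar ?S r (\<alpha> (Dom I r) z) = \<alpha> (Cod I r) (ob (shriek_diag J I w ?E) r z)"
      using r z by (auto simp: \<alpha>_def Let_def)
  qed
  moreover have "Comp (functor_cat I Cat) (counit J I w ?S) (AM (shriek J I w) (kappa J I w F)) =
    darr I (shriek_diag J I w ?E) u ?S"
    unfolding u_def using F S
    by (simp add: kappa_def counit_def shriek_AM[OF w k0] darr_Comp del: functor_cat_simps(5))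
  moreover have "AM (shriek J I w) (counit J J (id_ftr J) F) = darr I (shriek_diag J I w ?E) v ?S"
    unfolding v_def using F shriek_AM[OF w e] by (simp add: counit_def comp_ftr_id(1)[OF F])
  ultimately show ?thesis by simp
qed

theorem theorem2p9:
  fixes \<A> :: "'u::universe scat set"
    and J I :: "'u scat"
    and w :: "'u sftr"
  assumes "right_asphericity_structure \<A>"
    and "small_category J" and "small_category I"
    and "is_functor J I w"
  shows "adjoint_pair (Hot \<A> J) (Hot \<A> I) (hot_shriek \<A> J I w) (hot_pullback \<A> J I w)"
  unfolding Hot_def hot_shriek_def hot_pullback_def
\<comment> \<open>The replacement functor is the direct image along the identity of
  \<open>J\<close>: its counit is the leg to be inverted, and \<open>kappa\<close> is the other leg
  of the unit.\<close>
proof (rule localization_adjunction[of _ _ _ _ _ _ "shriek J J (id_ftr J)" "counit J J (id_ftr J)"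
      "kappa J I w" "counit J I w"])
  note J = assms(2,3) and w = assms(4)
  have id: "is_functor J J (id_ftr J)" using J by (simp add: functor_id)
  show "is_functor (functor_cat J Cat) (functor_cat I Cat) (shriek J I w)"
    by (rule shriek_functor[OF J w])
  show "is_functor (functor_cat I Cat) (functor_cat J Cat) (pullback J I w)"
    by (rule pullback_functor[OF w])
  show "AM (shriek J I w) ` (Asph \<A> J \<inter> Arr (functor_cat J Cat)) \<subseteq> Asph \<A> I"
    by (rule shriek_Asph[OF assms])
  show "AM (pullback J I w) ` (Asph \<A> I \<inter> Arr (functor_cat I Cat)) \<subseteq> Asph \<A> J"
    by (rule pullback_Asph[OF w])
  show "nat_trans (functor_cat J Cat) (functor_cat J Cat) (shriek J J (id_ftr J))
      (id_ftr (functor_cat J Cat)) (counit J J (id_ftr J))"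
    by (rule counit_id_nat_trans[OF J(1)])
  show "nat_trans (functor_cat J Cat) (functor_cat J Cat) (shriek J J (id_ftr J))
      (comp_ftr (functor_cat J Cat) (pullback J I w) (shriek J I w)) (kappa J I w)"
    by (rule kappa_nat_trans[OF J w])
  show "nat_trans (functor_cat I Cat) (functor_cat I Cat)
      (comp_ftr (functor_cat I Cat) (shriek J I w) (pullback J I w)) (id_ftr (functor_cat I Cat))
      (counit J I w)"
    by (rule counit_nat_trans[OF J w])
  fix F :: "'u diag" assume "F \<in> Obj (functor_cat J Cat)"
  then have F: "is_functor J Cat F" by simp
  show "counit J J (id_ftr J) F \<in> Asph \<A> J"
    using F counit_map_dmor[OF J(1,1) id F] counit_id_aspheric[OF assms(1) J(1) F]
    by (simp add: counit_def Asph_darr comp_ftr_id(1)[OF F])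
  show "zz_eq (functor_cat I Cat) (Asph \<A> I) (OM (shriek J I w) (OM (shriek J J (id_ftr J)) F))
      (OM (shriek J I w) F)
      [Fwd (Comp (functor_cat I Cat) (counit J I w (OM (shriek J I w) F))
        (AM (shriek J I w) (kappa J I w F)))]
      [Fwd (AM (shriek J I w) (counit J J (id_ftr J) F))]"
    using counit_shriek_kappa[OF assms F] F shriek_diag_functor[OF J(1,1) id F]
    by (simp only: shriek_OM)
next
  fix G :: "'u diag" assume "G \<in> Obj (functor_cat I Cat)"
  then have G: "is_functor I Cat G" by simp
  show "Comp (functor_cat J Cat) (AM (pullback J I w) (counit J I w G))
      (kappa J I w (OM (pullback J I w) G)) = counit J J (id_ftr J) (OM (pullback J I w) G)"
    using counit_kappa[OF assms(2-4) G] by (simp only: pullback_OM[OF G])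
qed

end
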